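(* Let $\mathcal H_p$ be the $p$-periodic KPZ fixed point with the periodic narrow wedge initial condition, and let $f_p(\beta;\gamma,\tau)=\frac{d}{d\beta}\mathbb P(\mathcal H_p(\gamma,\tau)\le\beta)$ be its one-point density function. Let $p=p(\ell)>0$. Then, as $\ell\to\infty$, $$f_p(\ell;0,1)=\begin{cases}\dfrac{1}{8\pi\ell}\,e^{-\frac43\ell^{3/2}}(1+o(1)) & \text{if } p\ell^{1/4}\to\infty \text{ and } \log p/\ell^{3/2}\to0,\\[2mm] \dfrac{c(\mathsf r)}{8\pi\ell}\,e^{-\frac43\ell^{3/2}}(1+o(1)) & \text{if } p=\mathsf r\,\ell^{-1/4}\text{ with fixed }\mathsf r>0,\\[2mm] \dfrac{1}{4\sqrt{2\pi}\,\ell^{5/4}p}\,e^{-\frac43\ell^{3/2}}(1+o(1)) & \text{if } p\ell/\log\ell\to\infty\text{ and } p\ell^{1/4}\to0,\end{cases}$$ where $$c(\mathsf r)=\sum_{k\in\mathbb Z}e^{-\frac12\mathsf r^2k^2}=\frac{\sqrt{2\pi}}{\mathsf r}\sum_{k\in\mathbb Z}e^{-\frac{2\pi^2}{\mathsf r^2}k^2}.$$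
   Context: **Periodic KPZ fixed point (periodic narrow wedge).** For a positive integer $a$, let $\mathbf h(n,t)$ ($n\in\mathbb Z$, $t\ge0$) be the height function of the TASEP on the ring of size $2a$, extended periodically: $\mathbf h(n\pm2a,t)=\mathbf h(n,t)$, $\mathbf h(n,0)=|n|$ for $-a+1\le n\le a$, $|\mathbf h(n+1,t)-\mathbf h(n,t)|=1$, and at each local minimum (modulo $2a$) the height increases by $2$ independently at rate $1$; it is linearly interpolated to real positions. The process $\mathcal H^{(per)}(\gamma,\tau)$, $(\gamma,\tau)\in\mathbb R\times(0,\infty)$, has finite-dimensional distribution functions $$\lim_{T=(2a)^{3/2}\to\infty}\mathbb P\Big(\bigcap_{i=1}^m\Big\{\frac{\mathbf h(\gamma_iT^{2/3},2\tau_iT)-\tau_iT}{-T^{1/3}}\le\beta_i\Big\}\Big),$$ which exist, and for $p>0$, $\mathcal H_p(\gamma,\tau)=p^{1/2}\mathcal H^{(per)}(p^{-1}\gamma,p^{-3/2}\tau)$. **Explicit one-point law** (known from the literature): $$\mathbb P(\mathcal H_p(\gamma,\tau)\le\beta)=\frac1{2\pi\mathrm i}\oint C(z)D(z)\frac{dz}{z}$$ over a circle $|z|=$ const in $(0,1)$, where, with $\mathrm{Li}_s$ the polylogarithm, $$C(z)=\exp\Big(-\tfrac{\beta}{p^{1/2}\sqrt{2\pi}}\mathrm{Li}_{3/2}(z)-\tfrac{\tau}{p^{3/2}\sqrt{2\pi}}\mathrm{Li}_{5/2}(z)+2B(z,z)\Big),\quad B(z,z')=\tfrac1{4\pi}\sum_{k,k'\ge1}\frac{z^k(z')^{k'}}{(k+k')\sqrt{kk'}},$$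 $$D(z)=\sum_{n\ge0}\frac1{(n!)^2}\sum_{U,\hat U\in\mathrm L_z^n}\prod_{j=1}^n\frac{e^{2h(u_j,z)+2h(\hat u_j,z)}E^+(u_j)E^-(\hat u_j)}{u_j\hat u_j}\ \det\Big(\frac{1}{-\hat u_i-u_j}\Big)_{i,j=1}^n\det\Big(\frac1{u_i+\hat u_j}\Big)_{i,j=1}^n,$$ $U=(u_1,\dots,u_n)$, $\hat U=(\hat u_1,\dots,\hat u_n)$, $\mathrm L_z=\{w\in\mathbb C:e^{-w^2/2}=z,\ \mathrm{Re}\,w<0\}$, $h(w,z)=-\frac1{\sqrt{2\pi}}\int_{-\infty}^w\mathrm{Li}_{1/2}(ze^{(w^2-y^2)/2})dy$ for $\mathrm{Re}\,w<0$ (along the horizontal half-line ending at $w$), and $E^{\pm}(s)=\exp\big(-\frac{\tau}{3p^{3/2}}s^3\pm\frac{\gamma}{2p}s^2+\frac{\beta}{p^{1/2}}s\big)$. *)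

theory Defs
  imports
    "HOL-Probability.Probability"
    "HOL-Complex_Analysis.Complex_Analysis"
    "HOL-Library.Landau_Symbols"
    "Jordan_Normal_Form.Determinant"
begin

section \<open>TASEP on the ring of size 2a\<close>

text \<open>
  Graphical construction: every site of the ring carries an independent rate-one Poisson clock,
  given by its i.i.d. exponential waiting times. Whenever a clock rings, the height at
  that site increases by 2 if it is a local minimum and is left unchanged otherwise.
  A sample point assigns to (i, k) the waiting time before the k-th ring (k = 0, 1, ...) of site i.
\<close>

definition clock_space :: "nat \<Rightarrow> (int \<times> nat \<Rightarrow> real) measure" where
  "clock_space a = PiM ({0..<2 * int a} \<times> UNIV)
     (\<lambda>_. density lborel (\<lambda>x. ennreal (exponential_density 1 x)))"

definition arrival :: "(int \<times> nat \<Rightarrow> real) \<Rightarrow> int \<Rightarrow> nat \<Rightarrow> real" where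
  "arrival \<omega> i k = (\<Sum>j\<le>k. \<omega> (i, j))"

definition ring_times :: "nat \<Rightarrow> (int \<times> nat \<Rightarrow> real) \<Rightarrow> real set" where
  "ring_times a \<omega> = {s. \<exists>i\<in>{0..<2 * int a}. \<exists>k. s = arrival \<omega> i k}"

text \<open>Almost surely the ring times are pairwise distinct, positive and locally finite, so that
  the following recursion lists them in increasing order, starting with the dummy time 0.\<close>

primrec nth_ring :: "nat \<Rightarrow> (int \<times> nat \<Rightarrow> real) \<Rightarrow> nat \<Rightarrow> real" where
  "nth_ring a \<omega> 0 = 0"
| "nth_ring a \<omega> (Suc m) = Inf {s \<in> ring_times a \<omega>. nth_ring a \<omega> m < s}"

text \<open>The 2a-periodic extension of the function |n| on -a+1, ..., a.\<close>

definition periodic_wedge :: "nat \<Rightarrow> int \<Rightarrow> int" where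
  "periodic_wedge a n = \<bar>(n + int a - 1) mod (2 * int a) - (int a - 1)\<bar>"

definition flip_minima :: "nat \<Rightarrow> int set \<Rightarrow> (int \<Rightarrow> int) \<Rightarrow> int \<Rightarrow> int" where
  "flip_minima a S \<eta> n =
     (if n mod (2 * int a) \<in> S \<and> \<eta> n < \<eta> (n - 1) \<and> \<eta> n < \<eta> (n + 1) then \<eta> n + 2 else \<eta> n)"

primrec height_after :: "nat \<Rightarrow> (int \<times> nat \<Rightarrow> real) \<Rightarrow> nat \<Rightarrow> int \<Rightarrow> int" where
  "height_after a \<omega> 0 = periodic_wedge a"
| "height_after a \<omega> (Suc m) =
     flip_minima a {i \<in> {0..<2 * int a}. \<exists>k. arrival \<omega> i k = nth_ring a \<omega> (Suc m)}
       (height_after a \<omega> m)"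

definition tasep_height :: "nat \<Rightarrow> (int \<times> nat \<Rightarrow> real) \<Rightarrow> int \<Rightarrow> real \<Rightarrow> int" where
  "tasep_height a \<omega> n t = height_after a \<omega> (card {s \<in> ring_times a \<omega>. s \<le> t}) n"

definition tasep_height_interp :: "nat \<Rightarrow> (int \<times> nat \<Rightarrow> real) \<Rightarrow> real \<Rightarrow> real \<Rightarrow> real" where
  "tasep_height_interp a \<omega> x t =
     of_int (tasep_height a \<omega> \<lfloor>x\<rfloor> t)
     + frac x * of_int (tasep_height a \<omega> (\<lfloor>x\<rfloor> + 1) t - tasep_height a \<omega> \<lfloor>x\<rfloor> t)"


section \<open>The periodic KPZ fixed point with periodic narrow wedge initial condition\<close>

definition rescaled_tasep :: "nat \<Rightarrow> (int \<times> nat \<Rightarrow> real) \<Rightarrow> real \<Rightarrow> real \<Rightarrow> real" where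
  "rescaled_tasep a \<omega> \<gamma> \<tau> =
     (let T = (2 * real a) powr (3/2) in
       (tasep_height_interp a \<omega> (\<gamma> * T powr (2/3)) (2 * \<tau> * T) - \<tau> * T) / (- (T powr (1/3))))"

definition periodic_KPZ_fixed_point :: "'w measure \<Rightarrow> (real \<Rightarrow> real \<Rightarrow> 'w \<Rightarrow> real) \<Rightarrow> bool" where
  "periodic_KPZ_fixed_point M H \<longleftrightarrow>
     prob_space M \<and>
     (\<forall>\<gamma> \<tau>. \<tau> > 0 \<longrightarrow> H \<gamma> \<tau> \<in> borel_measurable M) \<and>
     (\<forall>(m::nat) (\<gamma>::nat \<Rightarrow> real) (\<tau>::nat \<Rightarrow> real) (\<beta>::nat \<Rightarrow> real). (\<forall>i<m. \<tau> i > 0) \<longrightarrow>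
       (\<lambda>a. measure (clock_space a)
              {\<omega> \<in> space (clock_space a). \<forall>i<m. rescaled_tasep a \<omega> (\<gamma> i) (\<tau> i) \<le> \<beta> i})
       \<longlonglongrightarrow> measure M {\<omega> \<in> space M. \<forall>i<m. H (\<gamma> i) (\<tau> i) \<omega> \<le> \<beta> i})"

definition p_periodic :: "real \<Rightarrow> (real \<Rightarrow> real \<Rightarrow> 'w \<Rightarrow> real) \<Rightarrow> real \<Rightarrow> real \<Rightarrow> 'w \<Rightarrow> real" where
  "p_periodic p H \<gamma> \<tau> \<omega> = p powr (1/2) * H (p powr (-1) * \<gamma>) (p powr (-3/2) * \<tau>) \<omega>"

definition one_point_cdf ::
    "'w measure \<Rightarrow> (real \<Rightarrow> real \<Rightarrow> 'w \<Rightarrow> real) \<Rightarrow> real \<Rightarrow> real \<Rightarrow> real \<Rightarrow> real \<Rightarrow> real" where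
  "one_point_cdf M H p \<gamma> \<tau> \<beta> = measure M {\<omega> \<in> space M. p_periodic p H \<gamma> \<tau> \<omega> \<le> \<beta>}"

definition one_point_density ::
    "'w measure \<Rightarrow> (real \<Rightarrow> real \<Rightarrow> 'w \<Rightarrow> real) \<Rightarrow> real \<Rightarrow> real \<Rightarrow> real \<Rightarrow> real \<Rightarrow> real" where
  "one_point_density M H p \<beta> \<gamma> \<tau> = deriv (\<lambda>b. one_point_cdf M H p \<gamma> \<tau> b) \<beta>"


section \<open>The explicit one-point formula\<close>

text \<open>Only used for |z| < 1.\<close>

definition polylog :: "real \<Rightarrow> complex \<Rightarrow> complex" where
  "polylog s z = (\<Sum>k. z ^ Suc k / of_real (real (Suc k) powr s))"

definition B_fun :: "complex \<Rightarrow> complex \<Rightarrow> complex" where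
  "B_fun z z' = 1 / (4 * of_real pi) *
     (\<Sum>\<^sub>\<infinity>(k, k')\<in>{1::nat..} \<times> {1::nat..}. z ^ k * z' ^ k' / of_real ((real k + real k') * sqrt (real k * real k')))"

definition C_fun :: "real \<Rightarrow> real \<Rightarrow> real \<Rightarrow> complex \<Rightarrow> complex" where
  "C_fun p \<tau> \<beta> z = exp (
     - of_real (\<beta> / (p powr (1/2) * sqrt (2 * pi))) * polylog (3/2) z
     - of_real (\<tau> / (p powr (3/2) * sqrt (2 * pi))) * polylog (5/2) z
     + 2 * B_fun z z)"

definition L_set :: "complex \<Rightarrow> complex set" where
  "L_set z = {w. exp (- (w\<^sup>2) / 2) = z \<and> Re w < 0}"

text \<open>The half-line ending at w is parametrised by its real part x.\<close>

definition h_fun :: "complex \<Rightarrow> complex \<Rightarrow> complex" where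
  "h_fun w z = - (1 / of_real (sqrt (2 * pi))) *
     (LINT x:{..Re w}|lborel. polylog (1/2) (z * exp ((w\<^sup>2 - (Complex x (Im w))\<^sup>2) / 2)))"

text \<open>The sign sg is 1 or -1 (for the superscript plus or minus).\<close>

definition E_fun :: "real \<Rightarrow> real \<Rightarrow> real \<Rightarrow> real \<Rightarrow> real \<Rightarrow> complex \<Rightarrow> complex" where
  "E_fun sg p \<gamma> \<tau> \<beta> s = exp (
     - of_real (\<tau> / (3 * p powr (3/2))) * s ^ 3
     + of_real (sg * (\<gamma> / (2 * p))) * s\<^sup>2
     + of_real (\<beta> / p powr (1/2)) * s)"

text \<open>Tuples are indexed by 0, ..., n-1.\<close>

definition D_summand ::
    "real \<Rightarrow> real \<Rightarrow> real \<Rightarrow> real \<Rightarrow> complex \<Rightarrow> nat \<Rightarrow> (nat \<Rightarrow> complex) \<Rightarrow> (nat \<Rightarrow> complex) \<Rightarrow> complex" where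
  "D_summand p \<gamma> \<tau> \<beta> z n u v =
     (\<Prod>j<n. exp (2 * h_fun (u j) z + 2 * h_fun (v j) z)
             * E_fun 1 p \<gamma> \<tau> \<beta> (u j) * E_fun (-1) p \<gamma> \<tau> \<beta> (v j) / (u j * v j))
     * Determinant.det (Matrix.mat n n (\<lambda>(i, j). 1 / (- v i - u j)))
     * Determinant.det (Matrix.mat n n (\<lambda>(i, j). 1 / (u i + v j)))"

definition D_fun :: "real \<Rightarrow> real \<Rightarrow> real \<Rightarrow> real \<Rightarrow> complex \<Rightarrow> complex" where
  "D_fun p \<gamma> \<tau> \<beta> z =
     (\<Sum>n. 1 / (of_nat (fact n))\<^sup>2 *
        (\<Sum>\<^sub>\<infinity>(u, v)\<in>({..<n} \<rightarrow>\<^sub>E L_set z) \<times> ({..<n} \<rightarrow>\<^sub>E L_set z). D_summand p \<gamma> \<tau> \<beta> z n u v))"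

text \<open>The formula known from the literature for the one-point distribution functions,
  over any circle of radius between 0 and 1.\<close>

definition explicit_one_point_law :: "'w measure \<Rightarrow> (real \<Rightarrow> real \<Rightarrow> 'w \<Rightarrow> real) \<Rightarrow> bool" where
  "explicit_one_point_law M H \<longleftrightarrow>
     (\<forall>p \<gamma> \<tau> \<beta> \<rho>. p > 0 \<longrightarrow> \<tau> > 0 \<longrightarrow> 0 < \<rho> \<longrightarrow> \<rho> < 1 \<longrightarrow>
        complex_of_real (one_point_cdf M H p \<gamma> \<tau> \<beta>) =
          1 / (2 * of_real pi * \<i>) *
          contour_integral (circlepath 0 \<rho>) (\<lambda>z. C_fun p \<tau> \<beta> z * D_fun p \<gamma> \<tau> \<beta> z / z))"


section \<open>The constant in the critical regime\<close>

definition c_const :: "real \<Rightarrow> real" where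
  "c_const r = (\<Sum>\<^sub>\<infinity>k\<in>(UNIV::int set). exp (- (1/2) * r\<^sup>2 * (of_int k)\<^sup>2))"

end

theory Submission
  imports Defs "HOL-Real_Asymp.Real_Asymp"
begin

text \<open>
  Take the contour of radius exp (-pl/2), so that the set L_z is the sequence of points
  -sqrt (pl - 2i(t + 2 pi k)) and contains, for t = k = 0, the common saddle point -sqrt (pl) of the
  exponents of E+ and E-. The term n = 0 of D contributes exactly 1, since C is holomorphic in the disc
  with C(0) = 1, and the terms n >= 2 are smaller by a factor exp (-(2/3) l^(3/2)). Near the saddle
  point, with s = (t + 2 pi k) / r and r = p l^(1/4), each exponent equals -(2/3) l^(3/2) - s^2 + o(1),
  so the term n = 1 is asymptotically a prefactor times the integral over t of the square of the
  periodised Gaussian, which is (r^2/2) c(r). All error terms are of relative size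
  O(l^(-3/4) + l^(3/2) exp (-pl/2)), uniformly in p. Hence the density is asymptotic to
  c(r) / (8 pi l) exp (-(4/3) l^(3/2)) in all three regimes, and Poisson summation for c, which follows
  from the Dirichlet kernel and Bessel's inequality, gives the three cases.
\<close>

section \<open>Series and parameter integrals of holomorphic functions\<close>

text \<open>The radius is forced. On a circle of constant |z| the points w of L_z lie on a hyperbola
  of constant Re (w^2), and the exponents of E+ and E- are critical where w^2 = p l; radius exp (- p
  l / 2) puts the saddle point on the hyperbola. The real part of the exponent is then an explicit
  function of Re w along the whole hyperbola, so one estimate covers points near to and far from the
  saddle. The obstacle is uniformity in p. In the angle t the Gaussian has width r, while the points
  are spaced by 2 pi; r may tend to 0, stay fixed or tend to infinity. Every error is therefore kept
  under an exponential envelope in t / r. Summed over the points and integrated, the envelopes give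
  O(r + r^2), and the main term is (r^2 / 2) c(r). The two are comparable for all r because c(r) >=
  1 and, by Poisson summation, r c(r) >= 2. The density needs a derivative in b. For n = 1 it is
  exact: it brings down (w + w') / sqrt p up to a small correction and cancels one of the two Cauchy
  denominators. For n >= 2 a crude Cauchy bound is affordable, because those terms are exponentially
  smaller.\<close>

lemma continuous_on_infsum:
  fixes f :: "'i \<Rightarrow> 'a::topological_space \<Rightarrow> 'b::banach"
  assumes "\<And>i. i \<in> X \<Longrightarrow> continuous_on S (f i)"
    and "\<And>i x. i \<in> X \<Longrightarrow> x \<in> S \<Longrightarrow> norm (f i x) \<le> M i"
    and "M summable_on X"
  shows "continuous_on S (\<lambda>x. \<Sum>\<^sub>\<infinity>i\<in>X. f i x)"
proof (rule uniform_limit_theorem)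
  show "uniform_limit S (\<lambda>Y x. \<Sum>i\<in>Y. f i x) (\<lambda>x. \<Sum>\<^sub>\<infinity>i\<in>X. f i x) (finite_subsets_at_top X)"
    by (rule Weierstrass_m_test_general) (use assms in auto)
  show "\<forall>\<^sub>F Y in finite_subsets_at_top X. continuous_on S (\<lambda>x. \<Sum>i\<in>Y. f i x)"
    by (rule eventually_finite_subsets_at_top_weakI) (use assms(1) in \<open>auto intro!: continuous_intros\<close>)
qed simp

text \<open>Weierstrass: partial sums that converge uniformly on a disc may be differentiated term
  by term. The second conclusion later allows the derivative of the one-particle series to be
  compared with a Gaussian series term by term.\<close>

lemma has_field_derivative_infsum:
  fixes f :: "'i \<Rightarrow> complex \<Rightarrow> complex"
  assumes "open S"
    and hol: "\<And>i. i \<in> X \<Longrightarrow> f i holomorphic_on S"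
    and bnd: "\<And>i x. i \<in> X \<Longrightarrow> x \<in> S \<Longrightarrow> norm (f i x) \<le> M i"
    and sm: "M summable_on X" and "x \<in> S"
  obtains d where "((\<lambda>x. \<Sum>\<^sub>\<infinity>i\<in>X. f i x) has_field_derivative d) (at x)"
    "((\<lambda>i. deriv (f i) x) has_sum d) X"
proof -
  obtain e where e: "e > 0" "cball x e \<subseteq> S"
    using assms(1,5) open_contains_cball by blast
  have 1: "\<forall>\<^sub>F Y in finite_subsets_at_top X.
      continuous_on (cball x e) (\<lambda>w. \<Sum>i\<in>Y. f i w) \<and>
      (\<forall>w\<in>ball x e. ((\<lambda>w. \<Sum>i\<in>Y. f i w) has_field_derivative (\<Sum>i\<in>Y. deriv (f i) w)) (at w))"
  proof (rule eventually_finite_subsets_at_top_weakI, intro conjI ballI)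
    fix Y assume Y: "finite Y" "Y \<subseteq> X"
    show "continuous_on (cball x e) (\<lambda>w. \<Sum>i\<in>Y. f i w)"
      by (intro continuous_intros holomorphic_on_imp_continuous_on
            holomorphic_on_subset[OF hol e(2)]) (use Y in auto)
    fix w assume "w \<in> ball x e"
    then have "w \<in> S" using e(2) by auto
    show "((\<lambda>w. \<Sum>i\<in>Y. f i w) has_field_derivative (\<Sum>i\<in>Y. deriv (f i) w)) (at w)"
      by (rule DERIV_sum) (use Y hol holomorphic_derivI[OF _ \<open>open S\<close> \<open>w \<in> S\<close>] in blast)
  qed
  have 2: "uniform_limit (cball x e) (\<lambda>Y x. \<Sum>i\<in>Y. f i x) (\<lambda>x. \<Sum>\<^sub>\<infinity>i\<in>X. f i x) (finite_subsets_at_top X)"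
    by (rule Weierstrass_m_test_general) (use bnd sm e in auto)
  obtain g' where g': "\<And>w. w \<in> ball x e \<Longrightarrow> ((\<lambda>x. \<Sum>\<^sub>\<infinity>i\<in>X. f i x) has_field_derivative (g' w)) (at w) \<and>
      ((\<lambda>Y. \<Sum>i\<in>Y. deriv (f i) w) \<longlongrightarrow> g' w) (finite_subsets_at_top X)"
    by (rule has_complex_derivative_uniform_limit[OF 1 2 _ e(1)]) auto
  show thesis
    by (rule that[of "g' x"]) (use g'[of x] e(1) in \<open>auto simp: has_sum_def\<close>)
qed

lemma holomorphic_on_infsum:
  fixes f :: "'i \<Rightarrow> complex \<Rightarrow> complex"
  assumes "open S"
    and "\<And>i. i \<in> X \<Longrightarrow> f i holomorphic_on S"
    and "\<And>i x. i \<in> X \<Longrightarrow> x \<in> S \<Longrightarrow> norm (f i x) \<le> M i"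
    and "M summable_on X"
  shows "(\<lambda>x. \<Sum>\<^sub>\<infinity>i\<in>X. f i x) holomorphic_on S"
proof (rule holomorphic_onI)
  fix x assume "x \<in> S"
  from has_field_derivative_infsum[OF assms this]
  show "(\<lambda>x. \<Sum>\<^sub>\<infinity>i\<in>X. f i x) field_differentiable at x within S"
    by (metis field_differentiable_at_within field_differentiable_def)
qed

lemma norm_infsum_le_bound:
  fixes f :: "'i \<Rightarrow> 'b::banach"
  assumes "\<And>i. i \<in> X \<Longrightarrow> norm (f i) \<le> M i" and "M summable_on X"
  shows "f summable_on X" "norm (\<Sum>\<^sub>\<infinity>i\<in>X. f i) \<le> (\<Sum>\<^sub>\<infinity>i\<in>X. M i)"
proof -
  show 1: "f summable_on X"
    by (rule Infinite_Sum.abs_summable_summable, rule Infinite_Sum.abs_summable_on_comparison_test'[OF assms(2)]) (use assms(1) in auto)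
  show "norm (\<Sum>\<^sub>\<infinity>i\<in>X. f i) \<le> (\<Sum>\<^sub>\<infinity>i\<in>X. M i)"
    by (rule norm_infsum_le[OF has_sum_infsum[OF 1] has_sum_infsum[OF assms(2)] assms(1)])
qed

text \<open>Taylor expansion to first order, with the second derivative bounded by Cauchy's
  inequality on discs of radius 1/4, whence 32 = 2! * 4^2. The bound depends on f through M alone,
  so it is uniform over a family of functions.\<close>

lemma holomorphic_difference_quotient_bound:
  fixes f :: "complex \<Rightarrow> complex"
  assumes hol: "f holomorphic_on ball c 1" and bnd: "\<And>x. x \<in> ball c 1 \<Longrightarrow> norm (f x) \<le> M"
    and h: "h \<noteq> 0" "norm h < 1/4"
  shows "norm ((f (c + h) - f c) / h - deriv f c) \<le> 32 * M * norm h"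
proof -
  let ?S = "ball c (1/4)"
  have sub: "cball w (1/4) \<subseteq> ball c 1" if "w \<in> ?S" for w
  proof
    fix v assume v: "v \<in> cball w (1/4)"
    then have "dist c v \<le> dist c w + dist w v" by (rule_tac dist_triangle)
    then show "v \<in> ball c 1" using that v by auto
  qed
  have M0: "M \<ge> 0" using order_trans[OF norm_ge_zero bnd[of c]] by simp
  have d2: "norm ((deriv ^^ 2) f w) \<le> 32 * M" if "w \<in> ?S" for w
  proof -
    have "norm ((deriv ^^ 2) f w) \<le> fact 2 * M / (1/4)^2"
    proof (rule Cauchy_inequality)
      show "f holomorphic_on ball w (1/4)"
        using sub[OF that] holomorphic_on_subset[OF hol] ball_subset_cball by blast
      show "continuous_on (cball w (1/4)) f"
        using sub[OF that] holomorphic_on_subset[OF hol] holomorphic_on_imp_continuous_on by blast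
      fix x :: complex assume "norm (w - x) = 1/4"
      then have "x \<in> cball w (1/4)" by (simp add: dist_norm)
      then show "norm (f x) \<le> M" using sub[OF that] bnd by blast
    qed simp
    then show ?thesis by (simp add: power2_eq_square)
  qed
  have "norm ((deriv ^^ 0) f (c + h) - (\<Sum>i\<le>1. (deriv ^^ i) f c * ((c + h) - c) ^ i / fact i))
      \<le> 32 * M * norm ((c + h) - c) ^ Suc 1 / fact 1"
  proof (rule complex_Taylor)
    show "convex ?S" by simp
    show "c \<in> ?S" "c + h \<in> ?S" using h by (auto simp: dist_norm)
    show "norm ((deriv ^^ Suc 1) f x) \<le> 32 * M" if "x \<in> ?S" for x
      using d2[OF that] by (simp add: numeral_2_eq_2)
    fix i x assume x: "x \<in> ?S" and "i \<le> (1::nat)"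
    have "(deriv ^^ i) f holomorphic_on ball c 1"
      by (rule holomorphic_higher_deriv[OF hol]) simp
    then show "((deriv ^^ i) f has_field_derivative (deriv ^^ Suc i) f x) (at x within ?S)"
      using holomorphic_derivI[of _ "ball c 1" x ?S] x by auto
  qed
  then have "norm (f (c + h) - f c - deriv f c * h) \<le> 32 * M * norm h ^ 2"
    by (simp add: numeral_2_eq_2 algebra_simps)
  moreover have "(f (c + h) - f c) / h - deriv f c = (f (c + h) - f c - deriv f c * h) / h"
    using h by (simp add: field_simps)
  ultimately show ?thesis
    using h by (simp add: norm_divide divide_simps power2_eq_square mult_ac)
qed

text \<open>The difference quotients converge uniformly in t by the preceding bound. This gives at
  once the continuity of the derivative in t, as a uniform limit, and the exchange of limit and
  integral.\<close>

lemma has_field_derivative_integral_holomorphic: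
  fixes \<Phi> :: "complex \<Rightarrow> real \<Rightarrow> complex"
  assumes hol: "\<And>t. t \<in> {a..b} \<Longrightarrow> (\<lambda>x. \<Phi> x t) holomorphic_on ball c 1"
    and bnd: "\<And>x t. x \<in> ball c 1 \<Longrightarrow> t \<in> {a..b} \<Longrightarrow> norm (\<Phi> x t) \<le> M"
    and cont: "\<And>x. x \<in> ball c 1 \<Longrightarrow> continuous_on {a..b} (\<Phi> x)"
  shows "continuous_on {a..b} (\<lambda>t. deriv (\<lambda>x. \<Phi> x t) c)"
    and "((\<lambda>x. integral {a..b} (\<Phi> x)) has_field_derivative
            integral {a..b} (\<lambda>t. deriv (\<lambda>x. \<Phi> x t) c)) (at c)"
proof -
  define M' where "M' = \<bar>M\<bar> + 1"
  have M': "M' > 0" "M \<le> M'" by (auto simp: M'_def)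
  let ?Q = "\<lambda>h t. (\<Phi> (c + h) t - \<Phi> c t) / h"
  let ?d = "\<lambda>t. deriv (\<lambda>x. \<Phi> x t) c"
  have ul: "uniform_limit {a..b} ?Q ?d (at 0)"
  proof (rule uniform_limitI)
    fix e :: real assume e: "e > 0"
    let ?\<delta> = "min (1/4) (e / (32 * M'))"
    have \<delta>: "?\<delta> > 0" using e M' by simp
    show "\<forall>\<^sub>F h in at 0. \<forall>t\<in>{a..b}. dist (?Q h t) (?d t) < e"
      unfolding eventually_at
    proof (intro exI[of _ ?\<delta>] conjI \<delta> ballI impI)
      fix h :: complex and t assume h: "h \<noteq> 0 \<and> dist h 0 < ?\<delta>" and t: "t \<in> {a..b}"
      have "norm (?Q h t - ?d t) \<le> 32 * M' * norm h"
        by (rule holomorphic_difference_quotient_bound[OF hol[OF t]])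
          (use h bnd[OF _ t] M' in \<open>auto intro: order_trans\<close>)
      also have "\<dots> < e" using h M' by (simp add: field_simps)
      finally show "dist (?Q h t) (?d t) < e" by (simp add: dist_norm)
    qed
  qed
  have near: "\<forall>\<^sub>F h in at (0::complex). c + h \<in> ball c 1 \<and> h \<noteq> 0"
    unfolding eventually_at by (rule exI[of _ 1]) (auto simp: dist_norm)
  have contQ: "\<forall>\<^sub>F h in at 0. continuous_on {a..b} (?Q h)"
    using near by eventually_elim (intro continuous_intros cont, auto)
  show 1: "continuous_on {a..b} ?d"
    by (rule uniform_limit_theorem[OF contQ ul]) simp
  have "((\<lambda>h. integral {a..b} (?Q h)) \<longlongrightarrow> integral {a..b} ?d) (at 0)"
    unfolding tendsto_iff
  proof (intro allI impI)
    fix e :: real assume e: "e > 0"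
    define e' where "e' = e / (\<bar>b - a\<bar> + 1)"
    have e': "e' > 0" using e by (simp add: e'_def)
    have "\<forall>\<^sub>F h in at 0. \<forall>t\<in>{a..b}. dist (?Q h t) (?d t) < e'"
      using ul e' by (auto simp: uniform_limit_iff)
    with contQ show "\<forall>\<^sub>F h in at 0. dist (integral {a..b} (?Q h)) (integral {a..b} ?d) < e"
    proof eventually_elim
      case (elim h)
      show ?case
      proof (cases "a \<le> b")
        case True
        have "norm (integral {a..b} (\<lambda>t. ?Q h t - ?d t)) \<le> e' * (b - a)"
          by (rule integral_bound) (use elim 1 True in \<open>auto intro!: continuous_intros simp: dist_norm less_imp_le\<close>)
        also have "\<dots> < e"
          using True e by (simp add: e'_def field_simps)
        finally have "norm (integral {a..b} (\<lambda>t. ?Q h t - ?d t)) < e" .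
        moreover have "integral {a..b} (\<lambda>t. ?Q h t - ?d t) = integral {a..b} (?Q h) - integral {a..b} ?d"
          by (rule integral_diff) (use elim 1 in \<open>auto intro: integrable_continuous_interval\<close>)
        ultimately show ?thesis by (simp add: dist_norm)
      next
        case False then show ?thesis using e by simp
      qed
    qed
  qed
  moreover have "\<forall>\<^sub>F h in at 0. integral {a..b} (?Q h) =
      (integral {a..b} (\<Phi> (c + h)) - integral {a..b} (\<Phi> c)) / h"
    using near
  proof eventually_elim
    case (elim h)
    have "integral {a..b} (\<lambda>t. \<Phi> (c + h) t - \<Phi> c t) = integral {a..b} (\<Phi> (c + h)) - integral {a..b} (\<Phi> c)"
      by (rule integral_diff) (use elim in \<open>auto intro!: integrable_continuous_interval cont\<close>)
    then show ?case by simp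
  qed
  ultimately show "((\<lambda>x. integral {a..b} (\<Phi> x)) has_field_derivative integral {a..b} ?d) (at c)"
    unfolding DERIV_def by (rule Lim_transform_eventually)
qed

section \<open>Poisson summation for Gaussian sums\<close>

lemma has_sum_integral_infsum:
  fixes f :: "'i \<Rightarrow> real \<Rightarrow> 'b::banach"
  assumes cont: "\<And>i. i \<in> X \<Longrightarrow> continuous_on {a..b} (f i)"
    and bnd: "\<And>i x. i \<in> X \<Longrightarrow> x \<in> {a..b} \<Longrightarrow> norm (f i x) \<le> M i"
    and sm: "M summable_on X"
  shows "((\<lambda>i. integral {a..b} (f i)) has_sum integral {a..b} (\<lambda>x. \<Sum>\<^sub>\<infinity>i\<in>X. f i x)) X"
proof -
  \<comment> \<open>Extension by zero makes every partial sum continuous, also for index sets Y that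
    are not contained in X.\<close>
  define g where "g i = (if i \<in> X then f i else (\<lambda>_. 0))" for i
  have g: "continuous_on {a..b} (g i)" for i
    using cont by (auto simp: g_def)
  have ul: "uniform_limit {a..b} (\<lambda>Y x. \<Sum>i\<in>Y. g i x) (\<lambda>x. \<Sum>\<^sub>\<infinity>i\<in>X. g i x) (finite_subsets_at_top X)"
    by (rule Weierstrass_m_test_general[OF _ sm]) (use bnd in \<open>auto simp: g_def\<close>)
  obtain I J where I: "\<And>Y. ((\<lambda>x. \<Sum>i\<in>Y. g i x) has_integral I Y) {a..b}"
    and J: "((\<lambda>x. \<Sum>\<^sub>\<infinity>i\<in>X. g i x) has_integral J) {a..b}"
    and lim: "(I \<longlongrightarrow> J) (finite_subsets_at_top X)"
    by (rule uniform_limit_integral[OF ul]) (auto intro!: continuous_intros g)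
  have "I Y = (\<Sum>i\<in>Y. integral {a..b} (g i))" if "finite Y" for Y
    using integral_unique[OF I[of Y]] integral_sum[OF that, of g "{a..b}"]
      integrable_continuous_interval[OF g] by simp
  then have "\<forall>\<^sub>F Y in finite_subsets_at_top X. I Y = (\<Sum>i\<in>Y. integral {a..b} (g i))"
    by (intro eventually_finite_subsets_at_top_weakI) auto
  then have "((\<lambda>i. integral {a..b} (g i)) has_sum J) X"
    unfolding has_sum_def by (rule Lim_transform_eventually[OF lim])
  note Js = this
  show ?thesis
  proof -
    have "(\<lambda>x. \<Sum>\<^sub>\<infinity>i\<in>X. g i x) = (\<lambda>x. \<Sum>\<^sub>\<infinity>i\<in>X. f i x)"
      by (intro ext infsum_cong) (simp add: g_def)
    then have "integral {a..b} (\<lambda>x. \<Sum>\<^sub>\<infinity>i\<in>X. f i x) = J"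
      using integral_unique[OF J] by simp
    moreover have "((\<lambda>i. integral {a..b} (g i)) has_sum J) X = ((\<lambda>i. integral {a..b} (f i)) has_sum J) X"
      by (intro has_sum_cong) (simp add: g_def)
    ultimately show ?thesis using Js by simp
  qed
qed

text \<open>Countable additivity over the half-open intervals [k, k + 1), enumerated by
  \<open>int_decode\<close>. The majorant M makes the resulting series unconditionally convergent,
  so that the enumeration can be forgotten.\<close>

lemma has_sum_unit_intervals:
  fixes f :: "real \<Rightarrow> real"
  assumes cont: "continuous_on UNIV f" and int: "integrable lborel f"
    and bnd: "\<And>k x. x \<in> {0..1} \<Longrightarrow> norm (f (x + of_int k)) \<le> M k"
    and sm: "M summable_on (UNIV::int set)"
  shows "((\<lambda>k. integral {0..1} (\<lambda>x. f (x + of_int k))) has_sum (LINT x|lborel. f x)) UNIV"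
proof -
  let ?A = "\<lambda>n. {of_int (int_decode n)..<of_int (int_decode n) + (1::real)}"
  have disj: "?A i \<inter> ?A j = {}" if "i \<noteq> j" for i j
  proof -
    have "int_decode i \<noteq> int_decode j" using that by (metis int_decode_inverse)
    then consider "int_decode i + 1 \<le> int_decode j" | "int_decode j + 1 \<le> int_decode i" by linarith
    then show ?thesis
    proof cases
      case 1
      then have "real_of_int (int_decode i) + 1 \<le> real_of_int (int_decode j)" by linarith
      then show ?thesis by auto
    next
      case 2
      then have "real_of_int (int_decode j) + 1 \<le> real_of_int (int_decode i)" by linarith
      then show ?thesis by auto
    qed
  qed
  have cover: "(\<Union>n. ?A n) = UNIV"
  proof -
    have "x \<in> ?A (int_encode \<lfloor>x\<rfloor>)" for x :: real by simp
    then show ?thesis by blast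
  qed
  have piece: "(LINT x:?A n|lborel. f x) = integral {0..1} (\<lambda>x. f (x + of_int (int_decode n)))" for n
  proof -
    have "(LINT x:?A n|lborel. f x) = integral (?A n) f"
      by (rule set_borel_integral_eq_integral)
        (use integrable_mult_indicator[OF _ int] in \<open>auto simp: set_integrable_def\<close>)
    also have "\<dots> = integral {of_int (int_decode n)..of_int (int_decode n) + 1} f"
      by (rule integral_spike_set) (auto intro: negligible_subset[of "{of_int (int_decode n) + 1}"])
    also have "\<dots> = integral {0..1} (\<lambda>x. f (x + of_int (int_decode n)))"
      using integral_shift_Icc_real[of 0 1 f "of_int (int_decode n)"]
      by (simp add: add.commute o_def)
    finally show ?thesis .
  qed
  have "(LINT x:(\<Union>n. ?A n)|lborel. f x) = (\<Sum>n. (LINT x:?A n|lborel. f x))"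
    by (rule lebesgue_integral_countable_add)
      (use disj cover int in \<open>auto simp: set_integrable_def\<close>)
  then have eq: "(LINT x|lborel. f x) = (\<Sum>n. integral {0..1} (\<lambda>x. f (x + of_int (int_decode n))))"
    unfolding cover piece by (simp add: set_lebesgue_integral_def)
  have le: "norm (integral {0..1} (\<lambda>x. f (x + of_int k))) \<le> M k" for k
  proof -
    have "norm (integral {0..1} (\<lambda>x. f (x + of_int k))) \<le> M k * (1 - 0)"
      by (rule integral_bound)
        (auto intro!: continuous_intros continuous_on_compose2[OF cont] bnd simp del: real_norm_def)
    then show ?thesis by simp
  qed
  have s: "(\<lambda>k. integral {0..1} (\<lambda>x. f (x + of_int k))) summable_on (UNIV::int set)"
    by (rule norm_infsum_le_bound[OF le sm])
  have bij: "bij_betw int_decode UNIV UNIV" by (rule bij_int_decode)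
  have s': "(\<lambda>n. integral {0..1} (\<lambda>x. f (x + of_int (int_decode n)))) summable_on UNIV"
    using s summable_on_reindex_bij_betw[OF bij, of "\<lambda>k. integral {0..1} (\<lambda>x. f (x + of_int k))"] by simp
  have "((\<lambda>n. integral {0..1} (\<lambda>x. f (x + of_int (int_decode n)))) has_sum (LINT x|lborel. f x)) UNIV"
    using has_sum_infsum[OF s'] sums_unique[OF has_sum_imp_sums[OF has_sum_infsum[OF s']]] eq by simp
  then show ?thesis
    using has_sum_reindex_bij_betw[OF bij, of "\<lambda>k. integral {0..1} (\<lambda>x. f (x + of_int k))"] by simp
qed

text \<open>The exponent is the distance of the interval [k, k + 1] from 0, hence a lower bound for
  |x + k| when x is in [0, 1]; this explains the shift by one for negative k.\<close>

definition two_sided_power :: "real \<Rightarrow> int \<Rightarrow> real" where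
  "two_sided_power q k = (if k \<ge> 0 then q ^ nat k else q ^ nat (- k - 1))"

lemma two_sided_power_nonneg: "0 \<le> q \<Longrightarrow> 0 \<le> two_sided_power q k"
  by (simp add: two_sided_power_def)

lemma has_sum_int_split:
  fixes f :: "int \<Rightarrow> 'b::topological_comm_monoid_add"
  assumes "((\<lambda>n::nat. f (int n)) has_sum a) UNIV" "((\<lambda>n::nat. f (- int n - 1)) has_sum b) UNIV"
  shows "(f has_sum (a + b)) UNIV"
proof -
  have "bij_betw int UNIV {0::int..}"
    by (rule bij_betwI[of _ _ _ nat]) auto
  then have 1: "(f has_sum a) {0..}"
    using assms(1) has_sum_reindex_bij_betw by blast
  have "bij_betw (\<lambda>n. - int n - 1) UNIV {..<0::int}"
    by (rule bij_betwI[of _ _ _ "\<lambda>k. nat (- k - 1)"]) auto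
  then have 2: "(f has_sum b) {..<0}"
    using assms(2) has_sum_reindex_bij_betw by blast
  have "(f has_sum (a + b)) ({0..} \<union> {..<0})"
    by (rule has_sum_Un_disjoint[OF 1 2]) auto
  moreover have "{0..} \<union> {..<0} = (UNIV :: int set)" by auto
  ultimately show ?thesis by simp
qed

lemma has_sum_geometric:
  fixes q :: real
  assumes "0 \<le> q" "q < 1"
  shows "((\<lambda>n. c * q ^ n) has_sum (c / (1 - q))) (UNIV::nat set)"
proof -
  have "((\<lambda>n. q ^ n) has_sum (1 / (1 - q))) UNIV"
    by (rule norm_summable_imp_has_sum) (use assms in \<open>auto intro: geometric_sums summable_geometric\<close>)
  from has_sum_cmult_right[OF this, of c] show ?thesis by simp
qed

lemma has_sum_two_sided_power:
  assumes "0 \<le> q" "q < 1"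
  shows "(two_sided_power q has_sum (2 / (1 - q))) UNIV"
proof -
  have "(two_sided_power q has_sum (1 / (1 - q) + 1 / (1 - q))) UNIV"
    by (rule has_sum_int_split) (use has_sum_geometric[OF assms, of 1] in \<open>auto simp: two_sided_power_def\<close>)
  then show ?thesis by simp
qed

lemma summable_two_sided_power: "0 \<le> q \<Longrightarrow> q < 1 \<Longrightarrow> two_sided_power q summable_on UNIV"
  using has_sum_two_sided_power has_sum_imp_summable by blast

lemma exp_square_le_two_sided_power:
  fixes c x :: real
  assumes "c > 0" "x \<in> {0..1}"
  shows "exp (- c * (x + of_int k)\<^sup>2) \<le> two_sided_power (exp (- c)) k"
proof -
  define m where "m = (if k \<ge> 0 then nat k else nat (- k - 1))"
  have m: "real m \<le> \<bar>x + of_int k\<bar>"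
    using assms by (auto simp: m_def)
  have "real m \<le> real m ^ 2"
    by (metis of_nat_le_iff of_nat_power power2_nat_le_imp_le power2_nat_le_eq_le le_square power2_eq_square)
  also have "\<dots> \<le> (x + of_int k)\<^sup>2"
    using m by (metis abs_le_square_iff abs_of_nat)
  finally have "exp (- c * (x + of_int k)\<^sup>2) \<le> exp (- c * real m)" using assms by simp
  also have "\<dots> = exp (- c) ^ m" by (simp add: exp_of_nat_mult[symmetric] mult.commute)
  also have "\<dots> = two_sided_power (exp (- c)) k" by (simp add: two_sided_power_def m_def)
  finally show ?thesis .
qed

text \<open>A Jacobi theta function: the 1-periodisation of the Gaussian.\<close>

definition gauss_sum :: "real \<Rightarrow> real \<Rightarrow> real" where
  "gauss_sum c x = (\<Sum>\<^sub>\<infinity>k\<in>(UNIV::int set). exp (- c * (x + of_int k)\<^sup>2))"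

lemma summable_gauss:
  fixes c x :: real
  assumes "c > 0" "x \<in> {0..1}"
  shows "(\<lambda>k::int. exp (- c * (x + of_int k)\<^sup>2)) summable_on UNIV"
  by (rule norm_infsum_le_bound(1)[of _ _ "two_sided_power (exp (- c))"])
    (use exp_square_le_two_sided_power[OF assms] summable_two_sided_power[of "exp (-c)"] assms in auto)

lemma gauss_sum_one: "gauss_sum c 1 = gauss_sum c 0"
  unfolding gauss_sum_def
  by (rule infsum_reindex_bij_witness[of _ "\<lambda>k. k - 1" "\<lambda>k. k + 1"]) (auto simp: add_ac)

lemma continuous_on_gauss_sum: "c > 0 \<Longrightarrow> continuous_on {0..1} (gauss_sum c)"
  unfolding gauss_sum_def
  by (rule continuous_on_infsum[where M = "two_sided_power (exp (- c))"])
    (use exp_square_le_two_sided_power summable_two_sided_power[of "exp (-c)"] in \<open>auto intro!: continuous_intros\<close>)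

lemma integral_exp_square:
  assumes "c > 0"
  shows "integrable lborel (\<lambda>x. exp (- c * (x + a)\<^sup>2))" "(LINT x|lborel. exp (- c * (x + a)\<^sup>2)) = sqrt (pi / c)"
proof -
  define s where "s = 1 / sqrt (2 * c)"
  have s: "s > 0" "2 * s\<^sup>2 = 1 / c" using assms by (auto simp: s_def power_divide)
  have e: "exp (- c * (x + a)\<^sup>2) = sqrt (pi / c) * normal_density (- a) s x" for x
  proof -
    have "sqrt (2 * pi * s\<^sup>2) = sqrt (pi / c)"
      using s by (simp add: field_simps)
    moreover have "- (x - - a)\<^sup>2 / (2 * s\<^sup>2) = - c * (x + a)\<^sup>2"
      using s assms by (simp add: field_simps)
    ultimately show ?thesis using assms unfolding normal_density_def by simp
  qed
  show "integrable lborel (\<lambda>x. exp (- c * (x + a)\<^sup>2))" unfolding e by (simp add: s)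
  show "(LINT x|lborel. exp (- c * (x + a)\<^sup>2)) = sqrt (pi / c)" unfolding e by (simp add: s)
qed

text \<open>The real part of the characteristic function of the standard normal law, after the
  substitution x -> sqrt (2 c) x.\<close>

lemma integral_exp_square_cos:
  assumes "c > 0"
  shows "integrable lborel (\<lambda>x. exp (- c * x\<^sup>2) * cos (t * x))"
    "(LINT x|lborel. exp (- c * x\<^sup>2) * cos (t * x)) = sqrt (pi / c) * exp (- t\<^sup>2 / (4 * c))"
proof -
  show "integrable lborel (\<lambda>x. exp (- c * x\<^sup>2) * cos (t * x))"
    by (rule Bochner_Integration.integrable_bound[OF integral_exp_square(1)[OF assms, of 0]])
      (auto simp: abs_mult)
  define s where "s = sqrt (2 * c)"
  have s: "s > 0" "s\<^sup>2 = 2 * c" using assms by (auto simp: s_def)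
  have char: "(LINT x|lborel. std_normal_density x * cos (u * x)) = exp (- u\<^sup>2 / 2)" for u :: real
  proof -
    have "integrable std_normal_distribution (\<lambda>x. iexp (u * x))"
      by (rule prob_space.integrable_iexp[OF prob_space_normal_density]) auto
    then have "Re (char std_normal_distribution u) = (LINT x|std_normal_distribution. Re (iexp (u * x)))"
      unfolding char_def by (subst integral_Re[symmetric]) auto
    also have "\<dots> = (LINT x|lborel. std_normal_density x * cos (u * x))"
      by (subst integral_density) (auto simp: Re_exp)
    finally show ?thesis by (simp add: char_std_normal_distribution)
  qed
  have "exp (- (t / s)\<^sup>2 / 2) = \<bar>s\<bar> *\<^sub>R (LINT x|lborel. std_normal_density (0 + s * x) * cos (t / s * (0 + s * x)))"
    unfolding char[symmetric] by (rule lborel_integral_real_affine) (use s in simp)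
  also have "(\<lambda>x. std_normal_density (0 + s * x) * cos (t / s * (0 + s * x)))
      = (\<lambda>x. 1 / sqrt (2 * pi) * (exp (- c * x\<^sup>2) * cos (t * x)))"
    using s by (auto simp: std_normal_density_def power_mult_distrib)
  also have "(LINT x|lborel. 1 / sqrt (2 * pi) * (exp (- c * x\<^sup>2) * cos (t * x)))
      = 1 / sqrt (2 * pi) * (LINT x|lborel. exp (- c * x\<^sup>2) * cos (t * x))"
    by (rule integral_mult_right_zero)
  finally have "exp (- (t / s)\<^sup>2 / 2) = s / sqrt (2 * pi) * (LINT x|lborel. exp (- c * x\<^sup>2) * cos (t * x))"
    using s by simp
  moreover have "- (t / s)\<^sup>2 / 2 = - t\<^sup>2 / (4 * c)" using s by (simp add: power_divide)
  moreover have one: "s / sqrt (2 * pi) * sqrt (pi / c) = 1"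
    using assms by (simp add: s_def real_sqrt_mult real_sqrt_divide)
  ultimately have "sqrt (pi / c) * exp (- t\<^sup>2 / (4 * c)) =
      sqrt (pi / c) * (s / sqrt (2 * pi) * (LINT x|lborel. exp (- c * x\<^sup>2) * cos (t * x)))"
    by simp
  also have "\<dots> = s / sqrt (2 * pi) * sqrt (pi / c) * (LINT x|lborel. exp (- c * x\<^sup>2) * cos (t * x))"
    by (simp only: mult_ac times_divide_eq_right times_divide_eq_left)
  finally show "(LINT x|lborel. exp (- c * x\<^sup>2) * cos (t * x)) = sqrt (pi / c) * exp (- t\<^sup>2 / (4 * c))"
    by (simp only: one mult_1)
qed

text \<open>Bessel's inequality: the squared distance of g from the span of s 0, ..., s (N - 1) is
  nonnegative, so the squares of the coefficients have bounded sums. This serves as the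
  Riemann-Lebesgue lemma and asks only that g be bounded and measurable, which suits a quotient by a
  sine.\<close>

lemma bessel_tendsto_zero:
  fixes g :: "'a \<Rightarrow> real" and s :: "nat \<Rightarrow> 'a \<Rightarrow> real"
  assumes "finite_measure M" and [measurable]: "g \<in> borel_measurable M" "\<And>n. s n \<in> borel_measurable M"
    and gb: "\<And>x. x \<in> space M \<Longrightarrow> \<bar>g x\<bar> \<le> B" and sb: "\<And>n x. \<bar>s n x\<bar> \<le> 1"
    and orth: "\<And>n m. (LINT x|M. s n x * s m x) = (if n = m then c else 0)" and "c > 0"
  shows "(\<lambda>n. LINT x|M. g x * s n x) \<longlonglongrightarrow> 0"
proof -
  interpret finite_measure M by fact
  have ints: "integrable M (\<lambda>x. s n x * s m x)" for n m
  proof (rule integrable_const_bound[where B = 1], rule AE_I2)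
    fix x show "norm (s n x * s m x) \<le> 1"
      using mult_mono[OF sb[of n x] sb[of m x]] by (simp add: abs_mult)
  qed simp
  have intg: "integrable M (\<lambda>x. g x * s n x)" for n
  proof (rule integrable_const_bound[where B = B], rule AE_I2)
    fix x assume "x \<in> space M"
    then show "norm (g x * s n x) \<le> B"
      using mult_mono[OF gb sb[of n x]] order_trans[OF abs_ge_zero gb] by (simp add: abs_mult)
  qed simp
  have intgg: "integrable M (\<lambda>x. g x * g x)"
  proof (rule integrable_const_bound[where B = "B * B"], rule AE_I2)
    fix x assume "x \<in> space M"
    then show "norm (g x * g x) \<le> B * B"
      using mult_mono[OF gb gb, of x x] order_trans[OF abs_ge_zero gb, of x] by (simp add: abs_mult del: abs_mult_self_eq)
  qed simp
  define a where "a n = (LINT x|M. g x * s n x)" for n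
  have le: "(\<Sum>n<N. (a n)\<^sup>2) \<le> c * (LINT x|M. g x * g x)" for N
  proof -
    have i1: "integrable M (\<lambda>x. \<Sum>n<N. 2 * (a n / c) * (g x * s n x))"
      by (intro Bochner_Integration.integrable_sum integrable_mult_right intg)
    have i2: "integrable M (\<lambda>x. \<Sum>n<N. \<Sum>m<N. (a n / c) * (a m / c) * (s n x * s m x))"
      by (intro Bochner_Integration.integrable_sum integrable_mult_right ints)
    have "0 \<le> (LINT x|M. (g x - (\<Sum>n<N. a n / c * s n x))\<^sup>2)" by simp
    also have "(\<lambda>x. (g x - (\<Sum>n<N. a n / c * s n x))\<^sup>2) = (\<lambda>x. g x * g x - (\<Sum>n<N. 2 * (a n / c) * (g x * s n x))
        + (\<Sum>n<N. \<Sum>m<N. (a n / c) * (a m / c) * (s n x * s m x)))"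
    proof
      fix x
      have "(\<Sum>n<N. a n / c * s n x) * (\<Sum>n<N. a n / c * s n x) =
          (\<Sum>n<N. \<Sum>m<N. (a n / c) * (a m / c) * (s n x * s m x))"
        unfolding sum_product by (intro sum.cong refl) (simp add: mult_ac)
      moreover have "2 * g x * (\<Sum>n<N. a n / c * s n x) = (\<Sum>n<N. 2 * (a n / c) * (g x * s n x))"
        unfolding sum_distrib_left by (intro sum.cong refl) (simp add: mult_ac)
      ultimately show "(g x - (\<Sum>n<N. a n / c * s n x))\<^sup>2 = g x * g x - (\<Sum>n<N. 2 * (a n / c) * (g x * s n x))
        + (\<Sum>n<N. \<Sum>m<N. (a n / c) * (a m / c) * (s n x * s m x))"
        by (simp add: power2_eq_square algebra_simps)
    qed
    also have "(LINT x|M. g x * g x - (\<Sum>n<N. 2 * (a n / c) * (g x * s n x))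
        + (\<Sum>n<N. \<Sum>m<N. (a n / c) * (a m / c) * (s n x * s m x)))
        = (LINT x|M. g x * g x) - (\<Sum>n<N. 2 * (a n / c) * a n) + (\<Sum>n<N. \<Sum>m<N. (a n / c) * (a m / c) * (if n = m then c else 0))"
      using intgg i1 i2 intg ints
      by (simp add: Bochner_Integration.integral_sum a_def orth del: mult_eq_0_iff cong: sum.cong)
    also have "\<dots> = (LINT x|M. g x * g x) - (\<Sum>n<N. (a n)\<^sup>2) / c"
      using \<open>c > 0\<close> by (simp add: if_distrib sum.delta power2_eq_square sum_divide_distrib sum_distrib_left[symmetric] field_simps cong: if_cong)
        (simp add: sum_distrib_left mult_ac)
    finally show ?thesis using \<open>c > 0\<close> by (simp add: field_simps)
  qed
  have "summable (\<lambda>n. (a n)\<^sup>2)"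
    by (rule summableI_nonneg_bounded[of _ "c * (LINT x|M. g x * g x)"]) (use le in auto)
  then have "(\<lambda>n. (a n)\<^sup>2) \<longlonglongrightarrow> 0" by (rule summable_LIMSEQ_zero)
  then have "(\<lambda>n. sqrt ((a n)\<^sup>2)) \<longlonglongrightarrow> sqrt 0" by (rule tendsto_real_sqrt)
  then have "(\<lambda>n. a n) \<longlonglongrightarrow> 0" by (simp add: tendsto_rabs_zero_iff)
  then show ?thesis by (simp add: a_def)
qed

section \<open>Pointwise convergence of the Fourier series of the periodised Gaussian at 0\<close>

lemma infsum_diff:
  fixes f g :: "'i \<Rightarrow> real"
  assumes "f summable_on X" "g summable_on X"
  shows "(\<Sum>\<^sub>\<infinity>i\<in>X. f i - g i) = infsum f X - infsum g X"
  using infsumI[OF has_sum_add[OF has_sum_infsum[OF assms(1)] has_sum_uminusI[OF has_sum_infsum[OF assms(2)]]]]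
  by simp

text \<open>Mean value theorem. The derivative contains v exp (- v^2) with v = sqrt c |u|; one half
  of the Gaussian absorbs the factor v, since v exp (- v^2 / 2) <= 1, and the other half is bounded
  by m.\<close>

lemma abs_gauss_diff_le:
  fixes c a b m :: real
  assumes "c > 0" and m: "\<And>u. a \<le> u \<Longrightarrow> u \<le> b \<Longrightarrow> exp (- (c / 2) * u\<^sup>2) \<le> m" and "a \<le> b"
  shows "\<bar>exp (- c * b\<^sup>2) - exp (- c * a\<^sup>2)\<bar> \<le> 2 * sqrt c * m * (b - a)"
proof -
  have "norm (exp (- c * b\<^sup>2) - exp (- c * a\<^sup>2)) \<le> (2 * sqrt c * m) * norm (b - a)"
  proof (rule field_differentiable_bound)
    show "convex {a..b}" by simp
    show "((\<lambda>u. exp (- c * u\<^sup>2)) has_field_derivative exp (- c * u\<^sup>2) * (- c * (2 * u))) (at u within {a..b})" for u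
      by (auto intro!: derivative_eq_intros)
    fix u assume u: "u \<in> {a..b}"
    define v where "v = sqrt c * \<bar>u\<bar>"
    have v2: "v\<^sup>2 = c * u\<^sup>2" "v \<ge> 0" using assms by (simp_all add: v_def power_mult_distrib)
    have "v \<le> 1 + v\<^sup>2 / 2" using sum_squares_ge_zero[of "v - 1" 0] by (simp add: power2_eq_square algebra_simps)
    also have "\<dots> \<le> exp (v\<^sup>2 / 2)" by (rule exp_ge_add_one_self)
    finally have ve: "v * exp (- (v\<^sup>2 / 2)) \<le> 1" by (simp add: exp_minus field_simps)
    have "norm (exp (- c * u\<^sup>2) * (- c * (2 * u))) = 2 * sqrt c * (v * exp (- (v\<^sup>2 / 2))) * exp (- (c / 2) * u\<^sup>2)"
    proof -
      have "exp (- (c / 2) * u\<^sup>2) * exp (- (c / 2) * u\<^sup>2) = exp (- c * u\<^sup>2)"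
        by (simp flip: exp_add)
      moreover have "2 * sqrt c * v = 2 * c * \<bar>u\<bar>" using assms by (simp add: v_def)
      ultimately show ?thesis using assms v2 by (simp add: abs_mult mult_ac)
    qed
    also have "\<dots> \<le> 2 * sqrt c * 1 * m"
      by (intro mult_mono ve m mult_nonneg_nonneg) (use u assms v2 in auto)
    finally show "norm (exp (- c * u\<^sup>2) * (- c * (2 * u))) \<le> 2 * sqrt c * m" by simp
  qed (use assms in auto)
  then show ?thesis using assms by simp
qed

text \<open>The Lipschitz bound keeps the difference quotient against sin (pi x) bounded at both
  ends of the period.\<close>

lemma gauss_sum_lipschitz:
  assumes "c > 0"
  obtains K where "\<And>x y. x \<in> {0..1} \<Longrightarrow> y \<in> {0..1} \<Longrightarrow> \<bar>gauss_sum c x - gauss_sum c y\<bar> \<le> K * \<bar>x - y\<bar>"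
proof -
  define M where "M = (\<lambda>k. 2 * sqrt c * two_sided_power (exp (- (c / 2))) k)"
  have M: "M summable_on UNIV" unfolding M_def
    by (intro summable_on_cmult_right summable_two_sided_power) (use assms in auto)
  have le: "\<bar>gauss_sum c x - gauss_sum c y\<bar> \<le> infsum M UNIV * \<bar>x - y\<bar>"
    if xy: "x \<in> {0..1}" "y \<in> {0..1}" "y \<le> x" for x y
  proof -
    have "norm (exp (- c * (x + of_int k)\<^sup>2) - exp (- c * (y + of_int k)\<^sup>2)) \<le> M k * \<bar>x - y\<bar>" for k
    proof -
      have "\<bar>exp (- c * (x + of_int k)\<^sup>2) - exp (- c * (y + of_int k)\<^sup>2)\<bar>
          \<le> 2 * sqrt c * two_sided_power (exp (- (c / 2))) k * ((x + of_int k) - (y + of_int k))"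
      proof (rule abs_gauss_diff_le[OF assms])
        fix u assume "y + of_int k \<le> u" "u \<le> x + of_int k"
        then show "exp (- (c / 2) * u\<^sup>2) \<le> two_sided_power (exp (- (c / 2))) k"
          using exp_square_le_two_sided_power[of "c / 2" "u - of_int k" k] xy assms by simp
      qed (use xy in auto)
      then show ?thesis using xy by (simp add: M_def)
    qed
    then have "norm (\<Sum>\<^sub>\<infinity>k\<in>UNIV. exp (- c * (x + of_int k)\<^sup>2) - exp (- c * (y + of_int k)\<^sup>2))
        \<le> (\<Sum>\<^sub>\<infinity>k\<in>UNIV. M k * \<bar>x - y\<bar>)"
      by (rule norm_infsum_le_bound(2)) (rule summable_on_cmult_left[OF M])
    also have "(\<Sum>\<^sub>\<infinity>k\<in>UNIV. exp (- c * (x + of_int k)\<^sup>2) - exp (- c * (y + of_int k)\<^sup>2)) = gauss_sum c x - gauss_sum c y"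
      unfolding gauss_sum_def
      by (rule infsum_diff[OF summable_gauss[OF assms xy(1)] summable_gauss[OF assms xy(2)]])
    finally show ?thesis by (simp add: infsum_cmult_left' del: atLeastAtMost_iff)
  qed
  show thesis
  proof (rule that)
    fix x y :: real assume "x \<in> {0..1}" "y \<in> {0..1}"
    then show "\<bar>gauss_sum c x - gauss_sum c y\<bar> \<le> infsum M UNIV * \<bar>x - y\<bar>"
      using le[of x y] le[of y x] by (cases "y \<le> x") (auto simp: abs_minus_commute)
  qed
qed

text \<open>Unfolding: cos (2 pi n x) has period 1, so integrating the periodised Gaussian against
  it over one period is integrating the Gaussian itself over the line.\<close>

lemma fourier_coefficient_gauss_sum:
  assumes "c > 0"
  shows "integral {0..1} (\<lambda>x. gauss_sum c x * cos (2 * pi * of_int n * x)) = sqrt (pi / c) * exp (- (pi\<^sup>2 / c) * (of_int n)\<^sup>2)"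
proof -
  let ?f = "\<lambda>x. exp (- c * x\<^sup>2) * cos ((2 * pi * of_int n) * x)"
  let ?M = "two_sided_power (exp (- c))"
  have cos: "cos (2 * pi * of_int n * (x + of_int k)) = cos (2 * pi * of_int n * x)" for x k
  proof -
    have "2 * pi * of_int n * (x + of_int k) = 2 * pi * of_int n * x + of_int (n * k) * (2 * pi)"
      by (simp add: algebra_simps)
    then show ?thesis using cos.plus_of_int[of "2 * pi * of_int n * x" "n * k"] by simp
  qed
  have M: "?M summable_on UNIV" by (rule summable_two_sided_power) (use assms in auto)
  have b: "norm (?f (x + of_int k)) \<le> ?M k" if "x \<in> {0..1}" for x k
  proof -
    have "norm (?f (x + of_int k)) \<le> exp (- c * (x + of_int k)\<^sup>2) * 1"
      unfolding real_norm_def abs_mult by (intro mult_mono) auto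
    with exp_square_le_two_sided_power[OF assms that, of k] show ?thesis by simp
  qed
  have "((\<lambda>k. integral {0..1} (\<lambda>x. ?f (x + of_int k))) has_sum (LINT x|lborel. ?f x)) UNIV"
    by (rule has_sum_unit_intervals[OF _ integral_exp_square_cos(1)[OF assms] b M])
      (auto intro!: continuous_intros)
  moreover have "((\<lambda>k. integral {0..1} (\<lambda>x. ?f (x + of_int k))) has_sum
      integral {0..1} (\<lambda>x. \<Sum>\<^sub>\<infinity>k\<in>(UNIV::int set). ?f (x + of_int k))) UNIV"
    by (rule has_sum_integral_infsum[OF _ b M]) (auto intro!: continuous_intros)
  ultimately have "integral {0..1} (\<lambda>x. \<Sum>\<^sub>\<infinity>k\<in>(UNIV::int set). ?f (x + of_int k)) = (LINT x|lborel. ?f x)"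
    using has_sum_unique by blast
  moreover have "(\<lambda>x. \<Sum>\<^sub>\<infinity>k\<in>(UNIV::int set). ?f (x + of_int k)) = (\<lambda>x. gauss_sum c x * cos (2 * pi * of_int n * x))"
    unfolding cos gauss_sum_def by (simp add: infsum_cmult_left')
  moreover have "- (2 * pi * of_int n)\<^sup>2 / (4 * c) = - (pi\<^sup>2 / c) * (of_int n)\<^sup>2"
    by (simp add: power_mult_distrib)
  ultimately show ?thesis
    using integral_exp_square_cos(2)[OF assms, of "2 * pi * of_int n"] by simp
qed

lemma dirichlet_kernel:
  "sin (pi * x) * (1 + 2 * (\<Sum>n=1..N. cos (2 * pi * real n * x))) = sin ((2 * real N + 1) * pi * x)"
proof (induction N)
  case (Suc N)
  have "sin ((2 * real (Suc N) + 1) * pi * x) - sin ((2 * real N + 1) * pi * x)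
      = 2 * sin (pi * x) * cos (2 * pi * real (Suc N) * x)"
    unfolding sin_diff_sin by (simp add: algebra_simps add_divide_distrib)
  with Suc show ?case by (simp add: algebra_simps)
qed simp

lemma integral_cos_2pi:
  "integral {0..1} (\<lambda>x. cos (2 * pi * real n * x)) = (if n = 0 then 1 else 0)"
proof (cases "n = 0")
  case False
  have "((\<lambda>x. cos (2 * pi * real n * x)) has_integral
      sin (2 * pi * real n * 1) / (2 * pi * real n) - sin (2 * pi * real n * 0) / (2 * pi * real n)) {0..1}"
    by (rule fundamental_theorem_of_calculus)
      (use False in \<open>auto intro!: derivative_eq_intros simp flip: has_real_derivative_iff_has_vector_derivative\<close>)
  moreover have "sin (2 * pi * real n) = 0"
    using sin_2npi[of n] by (simp add: mult_ac)
  ultimately show ?thesis using False by (simp add: integral_unique)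
qed simp

lemma integral_sin_odd_pi:
  "integral {0..1} (\<lambda>x. sin ((2 * real n + 1) * pi * x) * sin ((2 * real m + 1) * pi * x)) = (if n = m then 1 / 2 else 0)"
proof -
  \<comment> \<open>The difference |n - m| is turned into a natural number so that
    \<open>integral_cos_2pi\<close> applies to both cosines.\<close>
  have *: "sin ((2 * real n + 1) * pi * x) * sin ((2 * real m + 1) * pi * x) =
      (cos (2 * pi * real (nat \<bar>int n - int m\<bar>) * x) - cos (2 * pi * real (n + m + 1) * x)) / 2" for x
  proof -
    have "cos (2 * pi * real (nat \<bar>int n - int m\<bar>) * x) = cos ((2 * real n + 1) * pi * x - (2 * real m + 1) * pi * x)"
    proof (cases "n \<ge> m")
      case True then show ?thesis by (simp add: algebra_simps of_nat_diff)
    next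
      case False
      then have "2 * pi * real (nat \<bar>int n - int m\<bar>) * x = - ((2 * real n + 1) * pi * x - (2 * real m + 1) * pi * x)"
        by (simp add: algebra_simps)
      then show ?thesis by (metis cos_minus)
    qed
    moreover have "cos (2 * pi * real (n + m + 1) * x) = cos ((2 * real n + 1) * pi * x + (2 * real m + 1) * pi * x)"
      by (simp add: algebra_simps)
    ultimately show ?thesis by (simp add: sin_times_sin)
  qed
  have i: "(\<lambda>x. cos (2 * pi * real n * x)) integrable_on {0..1}" for n
    by (intro integrable_continuous_interval continuous_intros)
  have "integral {0..1} (\<lambda>x. sin ((2 * real n + 1) * pi * x) * sin ((2 * real m + 1) * pi * x))
      = integral {0..1} (\<lambda>x. (cos (2 * pi * real (nat \<bar>int n - int m\<bar>) * x) - cos (2 * pi * real (n + m + 1) * x)) / 2)"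
    by (simp only: *)
  also have "\<dots> = (integral {0..1} (\<lambda>x. cos (2 * pi * real (nat \<bar>int n - int m\<bar>) * x)) - integral {0..1} (\<lambda>x. cos (2 * pi * real (n + m + 1) * x))) / 2"
    by (subst Henstock_Kurzweil_Integration.integral_diff[symmetric, OF i i]) simp
  also have "\<dots> = (if n = m then 1 / 2 else 0)"
    unfolding integral_cos_2pi by auto
  finally show ?thesis .
qed

lemma sin_pi_ge_min:
  fixes x :: real
  assumes "x \<in> {0..1}"
  shows "2 * min x (1 - x) \<le> sin (pi * x)"
proof -
  have *: "2 * y \<le> sin (pi * y)" if "y \<in> {0..1/2}" for y :: real
  proof -
    have cc: "concave_on {0..pi} sin"
      by (rule f''_le0_imp_concave[where f' = cos and f'' = "\<lambda>x. - sin x"])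
        (auto intro!: derivative_eq_intros sin_ge_zero)
    have "(1 - 2 * y) * sin 0 + 2 * y * sin (pi / 2) \<le> sin ((1 - 2 * y) *\<^sub>R 0 + (2 * y) *\<^sub>R (pi / 2))"
      by (rule concave_onD[OF cc]) (use that in auto)
    then show ?thesis by (simp add: mult_ac)
  qed
  show ?thesis
  proof (cases "x \<le> 1/2")
    case True then show ?thesis using *[of x] assms by simp
  next
    case False
    have "sin (pi * (1 - x)) = sin (pi * x)" by (simp add: right_diff_distrib)
    then show ?thesis using *[of "1 - x"] False assms by simp
  qed
qed

text \<open>The Dirichlet kernel has integral 1, so the error of the N-th partial sum is the
  integral of g(x) sin ((2 N + 1) pi x), where g is the difference to the value at 0 divided by sin
  (pi x). This g is bounded because the theta function is Lipschitz and takes the same value at 0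
  and 1; the sines are orthogonal, so Bessel's inequality applies.\<close>

lemma fourier_partial_sums_gauss_sum:
  assumes "c > 0"
  shows "(\<lambda>N. integral {0..1} (\<lambda>x. gauss_sum c x * (1 + 2 * (\<Sum>n=1..N. cos (2 * pi * real n * x))))) \<longlonglongrightarrow> gauss_sum c 0"
proof -
  obtain K where K: "\<And>x y. x \<in> {0..1} \<Longrightarrow> y \<in> {0..1} \<Longrightarrow> \<bar>gauss_sum c x - gauss_sum c y\<bar> \<le> K * \<bar>x - y\<bar>"
    using gauss_sum_lipschitz[OF assms] by blast
  have K0: "K \<ge> 0" using K[of 0 1] by simp
  \<comment> \<open>The open interval avoids the zeros of sin (pi x) at both ends, where the
    quotient g is not continuous.\<close>
  let ?M = "restrict_space lborel {0<..<1::real}"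
  have fin: "finite_measure ?M"
    by (rule finite_measureI) (simp add: emeasure_restrict_space)
  define g where "g x = (gauss_sum c x - gauss_sum c 0) / sin (pi * x)" for x
  define s where "s n x = sin ((2 * real n + 1) * pi * x)" for n :: nat and x
  have spos: "sin (pi * x) > 0" if "x \<in> {0<..<1}" for x :: real
    using that by (intro sin_gt_zero) auto
  have gc: "continuous_on {0<..<1} g"
    unfolding g_def using spos
    by (intro continuous_intros continuous_on_subset[OF continuous_on_gauss_sum[OF assms]]) fastforce+
  have gm: "g \<in> borel_measurable ?M"
    using borel_measurable_continuous_on_restrict[OF gc]
    by (simp cong: measurable_cong_sets add: sets_restrict_space_cong[OF sets_lborel])
  have sc: "continuous_on A (s n)" for n A unfolding s_def by (intro continuous_intros)
  have sm: "s n \<in> borel_measurable ?M" for n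
    by (rule measurable_restrict_space1) (simp add: borel_measurable_continuous_onI sc)
  have gb: "\<bar>g x\<bar> \<le> K / 2" if "x \<in> space ?M" for x
  proof -
    have x: "x \<in> {0<..<1}" using that by (simp add: space_restrict_space)
    have "\<bar>gauss_sum c x - gauss_sum c 0\<bar> \<le> K * min x (1 - x)"
      using K[of x 0] K[of x 1] x gauss_sum_one[of c] by (auto simp: min_def)
    also have "\<dots> \<le> K * (sin (pi * x) / 2)"
      by (intro mult_left_mono K0) (use sin_pi_ge_min[of x] x in auto)
    finally show ?thesis using spos[OF x] by (simp add: g_def abs_divide field_simps)
  qed
  have conv: "(LINT x|?M. f x) = integral {0..1} f" if "continuous_on {0..1} f" for f :: "real \<Rightarrow> real"
  proof -
    have "(LINT x|?M. f x) = (LINT x:{0<..<1}|lborel. f x)"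
      by (subst integral_restrict_space) (auto simp: set_lebesgue_integral_def)
    also have "\<dots> = integral {0<..<1} f"
      by (rule set_borel_integral_eq_integral)
        (rule set_integrable_subset[OF borel_integrable_atLeastAtMost'[OF that]]; auto)
    also have "\<dots> = integral {0..1} f" by (simp add: integral_open_interval_real)
    finally show ?thesis .
  qed
  have "(\<lambda>n. LINT x|?M. g x * s n x) \<longlonglongrightarrow> 0"
  proof (rule bessel_tendsto_zero[where c = "1 / 2 :: real", OF fin gm sm gb])
    show "(0::real) < 1 / 2" by simp
    show "\<bar>s n x\<bar> \<le> 1" for n x by (simp add: s_def)
    show "(LINT x|?M. s n x * s m x) = (if n = m then 1 / 2 else 0)" for n m
      using integral_sin_odd_pi[of n m] by (subst conv) (auto intro!: continuous_intros sc simp: s_def)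
  qed
  moreover have "(LINT x|?M. g x * s n x) =
    integral {0..1} (\<lambda>x. gauss_sum c x * (1 + 2 * (\<Sum>n=1..n. cos (2 * pi * real n * x)))) - gauss_sum c 0" for n
  proof -
    let ?D = "\<lambda>x. 1 + 2 * (\<Sum>n=1..n. cos (2 * pi * real n * x))"
    have cG: "continuous_on {0..1} (gauss_sum c)" by (rule continuous_on_gauss_sum[OF assms])
    have "(LINT x|?M. g x * s n x) = (LINT x|?M. (gauss_sum c x - gauss_sum c 0) * ?D x)"
    proof (rule Bochner_Integration.integral_cong[OF refl])
      fix x assume "x \<in> space ?M"
      then have "sin (pi * x) \<noteq> 0" using spos[of x] by (simp add: space_restrict_space)
      then show "g x * s n x = (gauss_sum c x - gauss_sum c 0) * ?D x"
        unfolding s_def dirichlet_kernel[symmetric] by (simp add: g_def)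
    qed
    also have "\<dots> = integral {0..1} (\<lambda>x. gauss_sum c x * ?D x - gauss_sum c 0 * ?D x)"
      by (subst conv) (auto intro!: continuous_intros cG simp: left_diff_distrib)
    also have "\<dots> = integral {0..1} (\<lambda>x. gauss_sum c x * ?D x) - integral {0..1} (\<lambda>x. gauss_sum c 0 * ?D x)"
      by (intro Henstock_Kurzweil_Integration.integral_diff integrable_continuous_interval continuous_intros cG)
    also have "integral {0..1} ?D = integral {0..1} (\<lambda>x::real. 1::real) + integral {0..1} (\<lambda>x. 2 * (\<Sum>n=1..n. cos (2 * pi * real n * x)))"
      by (intro Henstock_Kurzweil_Integration.integral_add integrable_continuous_interval continuous_intros)
    then have "integral {0..1} ?D = 1"
      by (simp add: Henstock_Kurzweil_Integration.integral_sum integral_cos_2pi integrable_continuous_interval continuous_intros)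
    then have "integral {0..1} (\<lambda>x. gauss_sum c 0 * ?D x) = gauss_sum c 0"
      by simp
    finally show ?thesis .
  qed
  ultimately show ?thesis by (simp add: LIM_zero_iff)
qed

text \<open>The symmetric partial sums of the Fourier series have two limits: the value at 0, by
  pointwise convergence, and the unconditional sum of the coefficients.\<close>

lemma gauss_sum_zero_poisson:
  assumes "c > 0"
  shows "gauss_sum c 0 = sqrt (pi / c) * gauss_sum (pi\<^sup>2 / c) 0"
proof -
  define a where "a n = sqrt (pi / c) * exp (- (pi\<^sup>2 / c) * (of_int n)\<^sup>2)" for n :: int
  have c': "pi\<^sup>2 / c > 0" using assms by simp
  have "(\<lambda>k::int. exp (- (pi\<^sup>2 / c) * (0 + of_int k)\<^sup>2)) summable_on UNIV"
    by (rule summable_gauss[OF c']) simp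
  then have sa: "(a has_sum (sqrt (pi / c) * gauss_sum (pi\<^sup>2 / c) 0)) UNIV"
    unfolding a_def gauss_sum_def using has_sum_cmult_right[OF has_sum_infsum] by fastforce
  have cG: "continuous_on {0..1} (gauss_sum c)" by (rule continuous_on_gauss_sum[OF assms])
  have S: "integral {0..1} (\<lambda>x. gauss_sum c x * (1 + 2 * (\<Sum>n=1..N. cos (2 * pi * real n * x)))) = sum a {- int N..int N}" for N
  proof -
    have F: "integral {0..1} (\<lambda>x. gauss_sum c x * cos (2 * pi * real n * x)) = a (int n)" for n
      using fourier_coefficient_gauss_sum[OF assms, of "int n"] by (simp add: a_def)
    have "integral {0..1} (\<lambda>x. gauss_sum c x * (1 + 2 * (\<Sum>n=1..N. cos (2 * pi * real n * x))))
      = integral {0..1} (\<lambda>x. gauss_sum c x * cos (2 * pi * real 0 * x) + (\<Sum>n=1..N. 2 * (gauss_sum c x * cos (2 * pi * real n * x))))"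
      by (simp add: algebra_simps sum_distrib_left)
    also have "\<dots> = integral {0..1} (\<lambda>x. gauss_sum c x * cos (2 * pi * real 0 * x)) + integral {0..1} (\<lambda>x. \<Sum>n=1..N. 2 * (gauss_sum c x * cos (2 * pi * real n * x)))"
      by (intro Henstock_Kurzweil_Integration.integral_add integrable_continuous_interval continuous_intros cG)
    also have "integral {0..1} (\<lambda>x. \<Sum>n=1..N. 2 * (gauss_sum c x * cos (2 * pi * real n * x))) = (\<Sum>n=1..N. 2 * a (int n))"
      by (subst Henstock_Kurzweil_Integration.integral_sum)
        (auto intro!: integrable_continuous_interval continuous_intros cG sum.cong simp: F)
    finally have 1: "integral {0..1} (\<lambda>x. gauss_sum c x * (1 + 2 * (\<Sum>n=1..N. cos (2 * pi * real n * x))))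
       = a 0 + (\<Sum>n=1..N. 2 * a (int n))" unfolding F by simp
    have "sum a {- int N..int N} = a 0 + (\<Sum>n=1..N. 2 * a (int n))"
    proof (induction N)
      case (Suc N)
      have "{- int (Suc N)..int (Suc N)} = insert (int (Suc N)) (insert (- int (Suc N)) {- int N..int N})" by auto
      moreover have "a (- int (Suc N)) = a (int (Suc N))" by (simp only: a_def of_int_minus power2_minus)
      ultimately show ?case using Suc by simp
    qed simp
    with 1 show ?thesis by simp
  qed
  have lim: "(\<lambda>N. sum a {- int N..int N}) \<longlonglongrightarrow> gauss_sum c 0"
    using fourier_partial_sums_gauss_sum[OF assms] unfolding S .
  \<comment> \<open>The symmetric intervals eventually contain every finite set of integers, so an
    unconditional sum may be computed along them.\<close>
  have "filterlim (\<lambda>N. {- int N..int N}) (finite_subsets_at_top UNIV) sequentially"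
    unfolding filterlim_finite_subsets_at_top
  proof (intro allI impI)
    fix X :: "int set" assume "finite X \<and> X \<subseteq> UNIV"
    then have "finite (abs ` X)" by simp
    then obtain m where m: "\<And>x. x \<in> X \<Longrightarrow> \<bar>x\<bar> \<le> m"
      by (meson finite_imageI bdd_above_finite bdd_above.E imageI)
    show "\<forall>\<^sub>F N in sequentially. finite {- int N..int N} \<and> X \<subseteq> {- int N..int N} \<and> {- int N..int N} \<subseteq> UNIV"
      using eventually_ge_at_top[of "nat m"]
    proof eventually_elim
      case (elim N)
      have "\<bar>x\<bar> \<le> int N" if "x \<in> X" for x using m[OF that] elim by linarith
      then show ?case by (fastforce simp: abs_le_iff)
    qed
  qed
  with sa have "(\<lambda>N. sum a {- int N..int N}) \<longlonglongrightarrow> sqrt (pi / c) * gauss_sum (pi\<^sup>2 / c) 0"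
    unfolding has_sum_def by (rule filterlim_compose)
  with lim show ?thesis using LIMSEQ_unique by blast
qed

section \<open>The mean square of the periodised Gaussian\<close>

lemma has_sum_times_nonneg:
  fixes f :: "'i \<Rightarrow> real" and g :: "'j \<Rightarrow> real"
  assumes "(f has_sum a) A" "(g has_sum b) B"
    and "\<And>x. x \<in> A \<Longrightarrow> 0 \<le> f x" "\<And>y. y \<in> B \<Longrightarrow> 0 \<le> g y"
  shows "((\<lambda>(x, y). f x * g y) has_sum (a * b)) (A \<times> B)"
proof (rule has_sum_SigmaI)
  show 1: "((\<lambda>y. case (x, y) of (x, y) \<Rightarrow> f x * g y) has_sum f x * b) B" for x
    using has_sum_cmult_right[OF assms(2)] by simp
  show 2: "((\<lambda>x. f x * b) has_sum a * b) A"
    by (rule has_sum_cmult_left[OF assms(1)])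
  show "(\<lambda>(x, y). f x * g y) summable_on A \<times> B"
    by (rule summable_on_SigmaI[OF 1 has_sum_imp_summable[OF 2]]) (use assms in auto)
qed

text \<open>The square is a double series over (k, j). With j = k + m and m fixed, the sum over k
  unfolds to an integral over the line of exp (- c (x^2 + (x + m)^2)), and x^2 + (x + m)^2 = 2 (x +
  m / 2)^2 + m^2 / 2. The remaining series over m is again a theta series, with c / 2.\<close>

lemma integral_gauss_sum_square:
  assumes "c > 0"
  shows "integral {0..1} (\<lambda>x. (gauss_sum c x)\<^sup>2) = sqrt (pi / (2 * c)) * gauss_sum (c / 2) 0"
proof -
  let ?M = "two_sided_power (exp (- c))"
  have M: "?M summable_on UNIV" by (rule summable_two_sided_power) (use assms in auto)
  have Mnn: "?M k \<ge> 0" for k by (simp add: two_sided_power_nonneg)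
  define g where "g x = exp (- c * x\<^sup>2)" for x
  have g: "0 \<le> g x" "g x \<le> 1" for x using assms by (auto simp: g_def)
  have gc: "continuous_on A (\<lambda>x. g (x + b))" for A b unfolding g_def by (intro continuous_intros)
  have gM: "g (x + of_int k) \<le> ?M k" if "x \<in> {0..1}" for x k
    using exp_square_le_two_sided_power[OF assms that, of k] by (simp add: g_def)
  have gs: "((\<lambda>k::int. g (x + of_int k)) has_sum gauss_sum c x) UNIV" if "x \<in> {0..1}" for x
    unfolding g_def gauss_sum_def by (rule has_sum_infsum[OF summable_gauss[OF assms that]])
  let ?I = "\<lambda>(k::int, j::int). integral {0..1} (\<lambda>x. g (x + of_int k) * g (x + of_int j))"
  have "((\<lambda>p. integral {0..1} (\<lambda>x. g (x + of_int (fst p)) * g (x + of_int (snd p)))) has_sum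
      integral {0..1} (\<lambda>x. \<Sum>\<^sub>\<infinity>p\<in>(UNIV::int set)\<times>(UNIV::int set). g (x + of_int (fst p)) * g (x + of_int (snd p)))) (UNIV \<times> UNIV)"
  proof (rule has_sum_integral_infsum[where M = "\<lambda>(k, j). ?M k * ?M j"])
    show "continuous_on {0..1} (\<lambda>x. g (x + of_int (fst p)) * g (x + of_int (snd p)))" for p :: "int \<times> int"
      by (intro continuous_intros gc)
    show "(\<lambda>(k, j). ?M k * ?M j) summable_on UNIV \<times> UNIV"
      using has_sum_times_nonneg[OF has_sum_infsum[OF M] has_sum_infsum[OF M] Mnn Mnn] has_sum_imp_summable by blast
    show "norm (g (x + of_int (fst p)) * g (x + of_int (snd p))) \<le> (case p of (k, j) \<Rightarrow> ?M k * ?M j)"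
      if "x \<in> {0..1}" for x and p :: "int \<times> int"
      using mult_mono[OF gM[OF that] gM[OF that] Mnn g(1), of "fst p" "snd p"] g
      by (simp add: case_prod_unfold abs_mult)
  qed
  also have "integral {0..1} (\<lambda>x. \<Sum>\<^sub>\<infinity>p\<in>(UNIV::int set)\<times>(UNIV::int set). g (x + of_int (fst p)) * g (x + of_int (snd p)))
      = integral {0..1} (\<lambda>x. (gauss_sum c x)\<^sup>2)"
  proof (rule integral_cong)
    fix x :: real assume "x \<in> {0..1}"
    from has_sum_times_nonneg[OF gs[OF this] gs[OF this]] g
    show "(\<Sum>\<^sub>\<infinity>p\<in>(UNIV::int set)\<times>(UNIV::int set). g (x + of_int (fst p)) * g (x + of_int (snd p))) = (gauss_sum c x)\<^sup>2"
      by (simp add: infsumI case_prod_unfold power2_eq_square)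
  qed
  finally have "(?I has_sum integral {0..1} (\<lambda>x. (gauss_sum c x)\<^sup>2)) (UNIV \<times> UNIV)"
    by (simp add: case_prod_unfold)
  moreover have "bij_betw (\<lambda>(m, k). (k, k + m)) (UNIV \<times> UNIV) (UNIV \<times> (UNIV :: int set))"
    by (rule bij_betwI[of _ _ _ "\<lambda>(k, j). (j - k, k)"]) auto
  ultimately have "((\<lambda>p. ?I ((\<lambda>(m, k). (k, k + m)) p)) has_sum integral {0..1} (\<lambda>x. (gauss_sum c x)\<^sup>2)) (UNIV \<times> UNIV)"
    using has_sum_reindex_bij_betw by blast
  then have "((\<lambda>m. sqrt (pi / (2 * c)) * exp (- (c / 2) * (of_int m)\<^sup>2)) has_sum integral {0..1} (\<lambda>x. (gauss_sum c x)\<^sup>2)) UNIV"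
  proof (rule has_sum_Sigma')
    fix m :: int
    define f where "f x = g x * g (x + of_int m)" for x
    have f: "f x = exp (- (c / 2) * (of_int m)\<^sup>2) * exp (- (2 * c) * (x + of_int m / 2)\<^sup>2)" for x
      unfolding f_def g_def by (simp add: exp_add[symmetric] power2_eq_square algebra_simps)
    have c2: "2 * c > 0" using assms by simp
    have int: "integrable lborel f"
      unfolding f by (intro integrable_mult_right integral_exp_square(1) c2)
    have "((\<lambda>k. integral {0..1} (\<lambda>x. f (x + of_int k))) has_sum (LINT x|lborel. f x)) UNIV"
    proof (rule has_sum_unit_intervals[OF _ int _ M])
      show "continuous_on UNIV f" unfolding f by (intro continuous_intros)
      show "norm (f (x + of_int k)) \<le> ?M k" if "x \<in> {0..1}" for x k
        using mult_mono[OF gM[OF that, of k] g(2) Mnn g(1)] g by (simp add: f_def abs_mult)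
    qed
    moreover have "(LINT x|lborel. f x) = sqrt (pi / (2 * c)) * exp (- (c / 2) * (of_int m)\<^sup>2)"
      unfolding f using integral_exp_square(2)[OF c2, of "of_int m / 2"] by simp
    ultimately show "((\<lambda>k. ?I ((\<lambda>(m, k). (k, k + m)) (m, k))) has_sum
        sqrt (pi / (2 * c)) * exp (- (c / 2) * (of_int m)\<^sup>2)) UNIV"
      by (simp add: f_def add_ac)
  qed
  moreover have "((\<lambda>m. sqrt (pi / (2 * c)) * exp (- (c / 2) * (of_int m)\<^sup>2)) has_sum sqrt (pi / (2 * c)) * gauss_sum (c / 2) 0) UNIV"
    unfolding gauss_sum_def
    using has_sum_cmult_right[OF has_sum_infsum[OF summable_gauss[of "c / 2" 0]]] assms by fastforce
  ultimately show ?thesis using has_sum_unique by blast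
qed

section \<open>The constant c(r)\<close>

lemma c_const_eq_gauss_sum: "c_const r = gauss_sum (r\<^sup>2 / 2) 0"
  by (simp add: c_const_def gauss_sum_def)

lemma c_const_poisson:
  assumes "r > 0"
  shows "c_const r = sqrt (2 * pi) / r * c_const (2 * pi / r)"
proof -
  have "c_const r = sqrt (pi / (r\<^sup>2 / 2)) * gauss_sum (pi\<^sup>2 / (r\<^sup>2 / 2)) 0"
    unfolding c_const_eq_gauss_sum by (rule gauss_sum_zero_poisson) (use assms in simp)
  moreover have "sqrt (pi / (r\<^sup>2 / 2)) = sqrt (2 * pi) / r"
    using assms by (simp add: real_sqrt_divide real_sqrt_mult mult.commute)
  moreover have "pi\<^sup>2 / (r\<^sup>2 / 2) = (2 * pi / r)\<^sup>2 / 2"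
    by (simp add: power_divide power_mult_distrib)
  ultimately show ?thesis unfolding c_const_eq_gauss_sum by (simp only:)
qed

lemma c_const_ge_one: "r > 0 \<Longrightarrow> 1 \<le> c_const r"
proof -
  assume "r > 0"
  have "(\<lambda>k::int. exp (- (r\<^sup>2 / 2) * (0 + of_int k)\<^sup>2)) summable_on UNIV"
    by (rule summable_gauss) (use \<open>r > 0\<close> in auto)
  from finite_sum_le_infsum[OF this, of "{0}"] show ?thesis
    by (simp add: c_const_eq_gauss_sum gauss_sum_def)
qed

text \<open>For large r only k = 0 survives: since k^2 >= |k|, the other terms are dominated by two
  geometric series with ratio exp (- r^2 / 2).\<close>

lemma c_const_minus_one_le:
  assumes "r > 0"
  shows "c_const r - 1 \<le> 2 * exp (- r\<^sup>2 / 2) / (1 - exp (- r\<^sup>2 / 2))"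
proof -
  let ?q = "exp (- r\<^sup>2 / 2)"
  have q: "0 \<le> ?q" "?q < 1" using assms by auto
  define M where "M k = (if k = 0 then 1 else ?q ^ nat \<bar>k\<bar>)" for k :: int
  have "(M has_sum (1 / (1 - ?q) + ?q / (1 - ?q))) UNIV"
  proof (rule has_sum_int_split)
    have "(\<lambda>n. M (int n)) = (\<lambda>n. 1 * ?q ^ n)" by (auto simp: M_def)
    then show "((\<lambda>n. M (int n)) has_sum 1 / (1 - ?q)) UNIV" using has_sum_geometric[OF q, of 1] by simp
    have "(\<lambda>n. M (- int n - 1)) = (\<lambda>n. ?q * ?q ^ n)"
    proof
      fix n
      have "nat \<bar>- int n - 1\<bar> = Suc n" by simp
      then show "M (- int n - 1) = ?q * ?q ^ n" unfolding M_def by simp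
    qed
    then show "((\<lambda>n. M (- int n - 1)) has_sum ?q / (1 - ?q)) UNIV" using has_sum_geometric[OF q, of ?q] by simp
  qed
  then have "infsum M UNIV = 1 / (1 - ?q) + ?q / (1 - ?q)" "M summable_on UNIV"
    by (auto simp: infsumI has_sum_imp_summable)
  moreover have "c_const r \<le> infsum M UNIV"
    unfolding c_const_def
  proof (rule infsum_mono)
    show "(\<lambda>k::int. exp (- (1/2) * r\<^sup>2 * (of_int k)\<^sup>2)) summable_on UNIV"
      using summable_gauss[of "r\<^sup>2 / 2" 0] assms by simp
    show "M summable_on UNIV" by fact
    fix k :: int
    have "real (nat \<bar>k\<bar>) \<le> (of_int k)\<^sup>2"
    proof -
      have "\<bar>k\<bar> \<le> k\<^sup>2" using self_le_power[of "\<bar>k\<bar>" 2] by (cases "k = 0") auto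
      then have "real_of_int \<bar>k\<bar> \<le> real_of_int (k\<^sup>2)" by linarith
      then show ?thesis by simp
    qed
    then have "r\<^sup>2 / 2 * real (nat \<bar>k\<bar>) \<le> r\<^sup>2 / 2 * (of_int k)\<^sup>2" by (intro mult_left_mono) auto
    then have "exp (- (1/2) * r\<^sup>2 * (of_int k)\<^sup>2) \<le> exp (real (nat \<bar>k\<bar>) * (- r\<^sup>2 / 2))" by (simp add: mult_ac)
    also have "\<dots> = ?q ^ nat \<bar>k\<bar>" by (rule exp_of_nat_mult)
    also have "\<dots> = M k" by (simp add: M_def)
    finally show "exp (- (1/2) * r\<^sup>2 * (of_int k)\<^sup>2) \<le> M k" .
  qed
  ultimately show ?thesis using q by (simp add: field_simps)
qed

lemma c_const_tendsto_one: "(c_const \<longlongrightarrow> 1) at_top"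
proof (rule tendsto_sandwich)
  show "\<forall>\<^sub>F r in at_top. 1 \<le> c_const r"
    using eventually_gt_at_top[of 0] by eventually_elim (rule c_const_ge_one)
  show "\<forall>\<^sub>F r in at_top. c_const r \<le> 1 + 2 * exp (- r\<^sup>2 / 2) / (1 - exp (- r\<^sup>2 / 2))"
    using eventually_gt_at_top[of 0] by eventually_elim (use c_const_minus_one_le in force)
  show "((\<lambda>r::real. 1 + 2 * exp (- r\<^sup>2 / 2) / (1 - exp (- r\<^sup>2 / 2))) \<longlongrightarrow> 1) at_top"
    by real_asymp
qed simp

text \<open>This is the origin of c(r) in the theorem. The substitution t = 2 pi x leads to the
  theta function with c = (2 pi / r)^2; its mean square produces the dual value
  \<open>c_const (2 * pi / r)\<close>, which Poisson summation converts back to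
  \<open>c_const r\<close>.\<close>

lemma integral_periodic_gauss_square:
  assumes "r > 0"
  defines "S \<equiv> \<lambda>t. \<Sum>\<^sub>\<infinity>k\<in>(UNIV::int set). exp (- ((t + 2 * pi * of_int k) / r)\<^sup>2)"
  shows "continuous_on {0..2 * pi} S" "integral {0..2 * pi} (\<lambda>t. (S t)\<^sup>2) = r\<^sup>2 / 2 * c_const r"
proof -
  define c where "c = 4 * pi\<^sup>2 / r\<^sup>2"
  have c: "c > 0" using assms by (simp add: c_def)
  have S: "S t = gauss_sum c (t / (2 * pi))" for t
  proof -
    have "((t + 2 * pi * of_int k) / r)\<^sup>2 = c * (t / (2 * pi) + of_int k)\<^sup>2" for k :: int
    proof -
      have "(t + 2 * pi * of_int k) / r = (2 * pi / r) * (t / (2 * pi) + of_int k)"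
        by (simp add: distrib_left add_divide_distrib)
      then show ?thesis by (simp only: power_mult_distrib) (simp add: c_def power_divide power_mult_distrib)
    qed
    then show ?thesis by (simp add: S_def gauss_sum_def)
  qed
  have "continuous_on {0..2 * pi} (\<lambda>t. gauss_sum c (t / (2 * pi)))"
    by (rule continuous_on_compose2[OF continuous_on_gauss_sum[OF c]]) (auto intro!: continuous_intros)
  then show "continuous_on {0..2 * pi} S" by (simp add: S[abs_def])
  have ci: "(\<lambda>x. (gauss_sum c x)\<^sup>2) integrable_on {0..1}"
    by (intro integrable_continuous_interval continuous_intros continuous_on_gauss_sum[OF c])
  have "((\<lambda>x. (gauss_sum c ((1 / (2 * pi)) *\<^sub>R x + 0))\<^sup>2) has_integral
      (1 / \<bar>1 / (2 * pi)\<bar> ^ DIM(real)) *\<^sub>R integral {0..1} (\<lambda>x. (gauss_sum c x)\<^sup>2))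
      ((\<lambda>x. (1 / (1 / (2 * pi))) *\<^sub>R x + -((1 / (1 / (2 * pi))) *\<^sub>R 0)) ` cbox 0 1)"
    by (rule has_integral_affinity) (use ci in \<open>auto simp: has_integral_integral\<close>)
  moreover have "(\<lambda>x. (1 / (1 / (2 * pi))) *\<^sub>R x + -((1 / (1 / (2 * pi))) *\<^sub>R 0)) ` cbox 0 (1::real) = {0..2 * pi}"
    using image_affinity_atLeastAtMost[of "2 * pi" 0 0 1] by simp
  ultimately have "integral {0..2 * pi} (\<lambda>t. (S t)\<^sup>2) = 2 * pi * integral {0..1} (\<lambda>x. (gauss_sum c x)\<^sup>2)"
    by (simp add: S integral_unique)
  also have "\<dots> = 2 * pi * (sqrt (pi / (2 * c)) * gauss_sum (c / 2) 0)"
    by (simp only: integral_gauss_sum_square[OF c])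
  also have "gauss_sum (c / 2) 0 = c_const (2 * pi / r)"
    by (simp add: c_const_eq_gauss_sum c_def power_divide power_mult_distrib)
  also have "\<dots> = r / sqrt (2 * pi) * c_const r"
    using c_const_poisson[OF assms(1)] assms by (simp add: field_simps)
  also have "sqrt (pi / (2 * c)) = r / (2 * sqrt (2 * pi))"
  proof (rule real_sqrt_unique)
    show "(r / (2 * sqrt (2 * pi)))\<^sup>2 = pi / (2 * c)"
      using assms by (simp add: c_def power_divide power_mult_distrib power2_eq_square field_simps)
  qed (use assms in auto)
  also have "2 * pi * (r / (2 * sqrt (2 * pi)) * (r / sqrt (2 * pi) * c_const r)) = r\<^sup>2 / 2 * c_const r"
  proof -
    define q where "q = sqrt (2 * pi)"
    have q: "2 * pi = q * q" "q \<noteq> 0" by (simp_all add: q_def)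
    have "(q * q) * (r / (2 * q) * (r / q * c_const r)) = r\<^sup>2 / 2 * c_const r"
      using q(2) by (simp add: power2_eq_square)
    then show ?thesis unfolding q_def[symmetric] by (simp only: q(1))
  qed
  finally show "integral {0..2 * pi} (\<lambda>t. (S t)\<^sup>2) = r\<^sup>2 / 2 * c_const r" .
qed

section \<open>The functions Li, B and h and the points of L\<close>

lemma norm_polylog_term_le:
  assumes "s \<ge> 0"
  shows "norm (z ^ Suc k / of_real (real (Suc k) powr s) :: complex) \<le> norm z ^ Suc k"
proof -
  have "1 \<le> real (Suc k) powr s" using assms by (intro ge_one_powr_ge_zero) auto
  then have "norm z ^ Suc k / real (Suc k) powr s \<le> norm z ^ Suc k / 1"
    by (intro divide_left_mono) auto
  then show ?thesis by (simp add: norm_divide norm_power norm_mult)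
qed

lemma norm_polylog_le:
  assumes "s \<ge> 0" "norm z < 1"
  shows "norm (polylog s z) \<le> norm z / (1 - norm z)"
proof -
  have g: "(\<lambda>k. norm z ^ Suc k) sums (norm z * (1 / (1 - norm z)))"
    using sums_mult[OF geometric_sums[of "norm z"], of "norm z"] assms by simp
  have "norm (polylog s z) \<le> (\<Sum>k. norm z ^ Suc k)"
    unfolding polylog_def by (rule norm_suminf_le[OF norm_polylog_term_le[OF assms(1)] sums_summable[OF g]])
  then show ?thesis using sums_unique[OF g] by simp
qed

lemma norm_polylog_le_double:
  assumes "s \<ge> 0" "norm z \<le> 1/2"
  shows "norm (polylog s z) \<le> 2 * norm z"
proof -
  have "norm z / (1 - norm z) \<le> norm z / (1/2)"
    using assms by (intro divide_left_mono) auto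
  then show ?thesis using norm_polylog_le[OF assms(1), of z] assms by simp
qed

lemma polylog_0 [simp]: "polylog s 0 = 0"
  by (simp add: polylog_def)

lemma holomorphic_on_polylog:
  assumes "s \<ge> 0"
  shows "polylog s holomorphic_on ball 0 1"
proof -
  define g where "g z = (\<Sum>k. 1 / of_real (real (Suc k) powr s) * z ^ k)" for z :: complex
  have sm: "summable (\<lambda>k. 1 / of_real (real (Suc k) powr s) * z ^ k)" if "norm z < 1" for z :: complex
  proof (rule summable_comparison_test')
    show "summable (\<lambda>k. norm z ^ k)" using that by (simp add: summable_geometric)
    fix k
    have "1 \<le> real (Suc k) powr s" using assms by (intro ge_one_powr_ge_zero) auto
    then have "norm z ^ k / real (Suc k) powr s \<le> norm z ^ k / 1"
      by (intro divide_left_mono) auto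
    then show "norm (1 / of_real (real (Suc k) powr s) * z ^ k) \<le> norm z ^ k"
      by (simp add: norm_divide norm_power norm_mult)
  qed
  have "g holomorphic_on ball 0 1"
    by (rule power_series_holomorphic[where a = "\<lambda>k. 1 / of_real (real (Suc k) powr s)"])
      (use summable_sums[OF sm] in \<open>simp add: g_def\<close>)
  then have "(\<lambda>z. z * g z) holomorphic_on ball 0 1" by (intro holomorphic_intros)
  moreover have "polylog s z = z * g z" if "z \<in> ball 0 1" for z
    using suminf_mult[OF sm, of z z] that by (simp add: polylog_def g_def mult_ac)
  ultimately show ?thesis by (metis (no_types, lifting) holomorphic_transform)
qed

lemma norm_B_term_le:
  fixes z :: complex
  assumes "norm z \<le> R" "kk \<in> {1::nat..} \<times> {1::nat..}"
  shows "norm (case kk of (k, k') \<Rightarrow> z ^ k * z ^ k' / of_real ((real k + real k') * sqrt (real k * real k')))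
    \<le> (case kk of (k, k') \<Rightarrow> R ^ k * R ^ k')"
proof -
  obtain k k' where kk: "kk = (k, k')" "k \<ge> 1" "k' \<ge> 1" using assms(2) by auto
  have "1 * 1 \<le> (real k + real k') * sqrt (real k * real k')"
    using kk by (intro mult_mono) (auto simp: mult_ge1_I)
  then have "norm z ^ k * norm z ^ k' / ((real k + real k') * sqrt (real k * real k')) \<le> norm z ^ k * norm z ^ k' / 1"
    by (intro divide_left_mono) auto
  also have "\<dots> \<le> R ^ k * R ^ k'"
    using assms(1) order_trans[OF norm_ge_zero assms(1)] by (simp, intro mult_mono power_mono) auto
  finally show ?thesis
    unfolding kk(1) prod.case norm_divide norm_mult norm_power norm_of_real using kk by (simp add: abs_mult)
qed

lemma has_sum_geometric_pairs:
  fixes R :: real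
  assumes "0 \<le> R" "R < 1"
  shows "((\<lambda>(k, k'). R ^ k * R ^ k') has_sum ((R / (1 - R)) * (R / (1 - R)))) ({1::nat..} \<times> {1::nat..})"
  by (rule has_sum_times_nonneg) (use assms has_sum_geometric_from_1[of R] in auto)

lemma norm_B_fun_le:
  assumes "norm z \<le> 1/2"
  shows "norm (B_fun z z) \<le> norm z / 2"
proof -
  let ?r = "norm z"
  have "norm (\<Sum>\<^sub>\<infinity>(k, k')\<in>{1::nat..} \<times> {1::nat..}. z ^ k * z ^ k' / of_real ((real k + real k') * sqrt (real k * real k')))
      \<le> (\<Sum>\<^sub>\<infinity>(k, k')\<in>{1::nat..} \<times> {1::nat..}. ?r ^ k * ?r ^ k')"
    by (rule norm_infsum_le_bound(2)[OF norm_B_term_le has_sum_imp_summable[OF has_sum_geometric_pairs]])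
      (use assms in auto)
  also have "\<dots> = (?r / (1 - ?r)) * (?r / (1 - ?r))"
    by (rule infsumI[OF has_sum_geometric_pairs]) (use assms in auto)
  also have "\<dots> \<le> (?r / (1/2)) * (?r / (1/2))"
    by (intro mult_mono divide_left_mono) (use assms in auto)
  also have "\<dots> \<le> 2 * ?r"
    using assms mult_left_mono[of ?r "1/2" ?r] by simp
  finally have "norm (B_fun z z) \<le> 1 / (4 * pi) * (2 * ?r)"
    unfolding B_fun_def norm_mult by (intro mult_mono) (auto simp: norm_divide norm_mult)
  also have "\<dots> \<le> ?r / 2"
  proof -
    have "1 / (4 * pi) \<le> 1 / 4" using pi_gt3 by (simp add: field_simps)
    from mult_right_mono[OF this, of "2 * ?r"] show ?thesis by simp
  qed
  finally show ?thesis .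
qed

lemma holomorphic_on_B_fun:
  assumes "0 \<le> R" "R < 1"
  shows "(\<lambda>z. B_fun z z) holomorphic_on ball 0 R"
proof -
  have "(\<lambda>z. \<Sum>\<^sub>\<infinity>p\<in>{1::nat..} \<times> {1::nat..}.
      case p of (k, k') \<Rightarrow> z ^ k * z ^ k' / of_real ((real k + real k') * sqrt (real k * real k'))) holomorphic_on ball 0 R"
    by (rule holomorphic_on_infsum[where M = "\<lambda>(k, k'). R ^ k * R ^ k'"])
      (use norm_B_term_le[of _ R] has_sum_imp_summable[OF has_sum_geometric_pairs[OF assms]]
        in \<open>auto intro!: holomorphic_intros simp: less_imp_le\<close>)
  then show ?thesis
    unfolding B_fun_def by (intro holomorphic_intros) auto
qed

section \<open>The function h on the points of L_z\<close>

lemma integral_exp_neg: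
  "integrable lborel (\<lambda>y::real. indicator {0..} y * exp (- y) :: real)"
  "(LINT y|lborel. indicator {0..} y * exp (- y)) = (1::real)"
proof -
  have "(\<integral>\<^sup>+y. ennreal (exp (- y)) * indicator {0..} y \<partial>lborel) = ennreal (0 - (- exp (- 0)))"
  proof (rule nn_integral_FTC_atLeast)
    show "((\<lambda>y::real. - exp (- y)) \<longlongrightarrow> 0) at_top" by real_asymp
  qed (auto intro!: derivative_eq_intros)
  moreover have "ennreal (exp (- y)) * indicator {0..} y = ennreal (indicator {0..} y * exp (- y))" for y :: real
    by (simp add: indicator_def)
  ultimately have nn: "(\<integral>\<^sup>+y. ennreal (indicator {0..} y * exp (- y)) \<partial>lborel) = ennreal 1"
    by simp
  show "integrable lborel (\<lambda>y. indicator {0..} y * exp (- y) :: real)"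
    by (rule integrableI_nn_integral_finite[OF _ _ nn]) auto
  show "(LINT y|lborel. indicator {0..} y * exp (- y)) = (1::real)"
    by (rule integral_eq_nn_integral[THEN trans]) (auto simp: nn)
qed

text \<open>On L_z one has z = exp (- w^2 / 2), so the integrand of \<open>h_fun\<close> depends on
  w alone. Reversing the half-line makes the domain independent of w, as dominated convergence in w
  requires.\<close>

definition h_integral :: "complex \<Rightarrow> complex" where
  "h_integral w = (LINT y:{0..}|lborel. polylog (1/2) (exp (- ((w - of_real y)\<^sup>2) / 2)))"

lemma h_fun_eq_h_integral:
  assumes "exp (- (w\<^sup>2) / 2) = z"
  shows "h_fun w z = - (1 / of_real (sqrt (2 * pi))) * h_integral w"
proof -
  let ?f = "\<lambda>x. indicator {..Re w} x *\<^sub>R polylog (1/2) (z * exp ((w\<^sup>2 - (Complex x (Im w))\<^sup>2) / 2))"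
  have "(LINT x|lborel. ?f x) = \<bar>-1\<bar> *\<^sub>R (LINT y|lborel. ?f (Re w + (-1) * y))"
    by (rule lborel_integral_real_affine) simp
  also have "(\<lambda>y. ?f (Re w + (-1) * y)) = (\<lambda>y. indicator {0..} y *\<^sub>R polylog (1/2) (exp (- ((w - of_real y)\<^sup>2) / 2)))"
  proof
    fix y :: real
    have "Complex (Re w + (-1) * y) (Im w) = w - of_real y" by (simp add: complex_eq_iff)
    moreover have "z * exp ((w\<^sup>2 - (w - of_real y)\<^sup>2) / 2) = exp (- ((w - of_real y)\<^sup>2) / 2)"
      unfolding assms[symmetric] exp_add[symmetric] by (simp add: field_simps)
    ultimately show "?f (Re w + (-1) * y) = indicator {0..} y *\<^sub>R polylog (1/2) (exp (- ((w - of_real y)\<^sup>2) / 2))"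
      by (simp add: indicator_def)
  qed
  finally show ?thesis
    unfolding h_fun_def h_integral_def set_lebesgue_integral_def by simp
qed

text \<open>Moving left from w by y multiplies the argument of the polylogarithm by exp (y w - y^2 /
  2), whose modulus is at most exp (- y) once Re w <= -1.\<close>

lemma norm_exp_shift_le:
  assumes "Re w \<le> -1" "y \<ge> 0"
  shows "norm (exp (- ((w - of_real y)\<^sup>2) / 2)) \<le> exp (- Re (w\<^sup>2) / 2) * exp (- y)"
proof -
  have "Re ((w - of_real y)\<^sup>2) = Re (w\<^sup>2) - 2 * (y * Re w) + y\<^sup>2"
    by (simp add: power2_eq_square algebra_simps)
  moreover have "y \<le> - (y * Re w)" using mult_left_mono[of 1 "- Re w" y] assms by simp
  ultimately have "- Re ((w - of_real y)\<^sup>2) / 2 \<le> - Re (w\<^sup>2) / 2 - y"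
    using zero_le_power2[of y] by linarith
  then show ?thesis by (simp add: exp_add[symmetric])
qed

lemma exp_neg_one_le_half: "exp (- 1) \<le> (1/2 :: real)"
  using exp_ge_add_one_self[of "1::real"] by (simp add: exp_minus field_simps)

lemma norm_polylog_exp_shift_le:
  assumes "Re w \<le> -1" "Re (w\<^sup>2) \<ge> 2" "y \<ge> 0"
  shows "norm (exp (- ((w - of_real y)\<^sup>2) / 2)) \<le> 1/2"
    "norm (polylog (1/2) (exp (- ((w - of_real y)\<^sup>2) / 2))) \<le> 2 * exp (- Re (w\<^sup>2) / 2) * exp (- y)"
proof -
  have "exp (- Re (w\<^sup>2) / 2) * exp (- y) \<le> exp (-1) * 1"
    using assms by (intro mult_mono) auto
  then show 1: "norm (exp (- ((w - of_real y)\<^sup>2) / 2)) \<le> 1/2"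
    using norm_exp_shift_le[OF assms(1,3)] exp_neg_one_le_half by linarith
  show "norm (polylog (1/2) (exp (- ((w - of_real y)\<^sup>2) / 2))) \<le> 2 * exp (- Re (w\<^sup>2) / 2) * exp (- y)"
    using norm_polylog_le_double[OF _ 1, of "1/2"] norm_exp_shift_le[OF assms(1,3)] by simp
qed

lemma norm_h_integral_le:
  assumes "Re w \<le> -1" "Re (w\<^sup>2) \<ge> 2"
  shows "norm (h_integral w) \<le> 2 * exp (- Re (w\<^sup>2) / 2)"
proof -
  let ?c = "2 * exp (- Re (w\<^sup>2) / 2)"
  let ?f = "\<lambda>y. indicator {0..} y *\<^sub>R polylog (1/2) (exp (- ((w - of_real y)\<^sup>2) / 2))"
  let ?g = "\<lambda>y. ?c * (indicator {0..} y * exp (- y))"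
  have g: "integrable lborel ?g" by (intro integrable_mult_right integral_exp_neg)
  have le: "norm (?f y) \<le> ?g y" for y
    using norm_polylog_exp_shift_le(2)[OF assms, of y] by (simp add: indicator_def)
  have "norm (h_integral w) \<le> (LINT y|lborel. ?g y)"
  proof (cases "integrable lborel ?f")
    case True
    then show ?thesis unfolding h_integral_def set_lebesgue_integral_def
      by (rule Bochner_Integration.integral_norm_bound_integral[OF _ g le])
  next
    \<comment> \<open>The Bochner integral of a non-integrable function is 0, so the bound holds
      without knowing integrability.\<close>
    case False
    then have "h_integral w = 0"
      unfolding h_integral_def set_lebesgue_integral_def by (rule not_integrable_integral_eq)
    then show ?thesis by (simp add: indicator_def integral_nonneg)
  qed
  also have "\<dots> = ?c" using integral_exp_neg(2) by simp
  finally show ?thesis .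
qed

lemma norm_h_fun_le:
  assumes "exp (- (w\<^sup>2) / 2) = z" "Re w \<le> -1" "Re (w\<^sup>2) \<ge> 2"
  shows "norm (h_fun w z) \<le> norm z"
proof -
  have nz: "norm z = exp (- Re (w\<^sup>2) / 2)" unfolding assms(1)[symmetric] by simp
  have "2 \<le> sqrt (2 * pi)" using pi_gt3 by (intro real_le_rsqrt) auto
  then have "1 / sqrt (2 * pi) \<le> 1 / 2" by (intro divide_left_mono) auto
  then have "1 / sqrt (2 * pi) * norm (h_integral w) \<le> 1 / 2 * (2 * norm z)"
    using norm_h_integral_le[OF assms(2,3)] nz by (intro mult_mono) auto
  then show ?thesis
    unfolding h_fun_eq_h_integral[OF assms(1)] by (simp add: norm_mult norm_divide)
qed

text \<open>Dominated convergence along sequences, with majorant exp (- y) because 2 exp (-1) <= 1.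
  It makes the integrands in t continuous, hence integrable.\<close>

lemma continuous_on_h_integral:
  "continuous_on {w. Re w \<le> -1 \<and> Re (w\<^sup>2) \<ge> 2} h_integral"
proof -
  let ?S = "{w. Re w \<le> -1 \<and> Re (w\<^sup>2) \<ge> 2}"
  let ?f = "\<lambda>w y. indicator {0..} y *\<^sub>R polylog (1/2) (exp (- ((w - of_real y)\<^sup>2) / 2))"
  have pc: "continuous_on (ball 0 1) (polylog (1/2))"
    by (intro holomorphic_on_imp_continuous_on holomorphic_on_polylog) simp
  have meas: "?f w \<in> borel_measurable lborel" if "w \<in> ?S" for w
  proof -
    have "(\<lambda>y. indicator {0..} y *\<^sub>R polylog (1/2) (exp (- ((w - of_real y)\<^sup>2) / 2))) \<in> borel_measurable borel"
    proof (rule borel_measurable_continuous_on_indicator)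
      show "continuous_on {0..} (\<lambda>y. polylog (1/2) (exp (- ((w - of_real y)\<^sup>2) / 2)))"
      proof (rule continuous_on_compose2[OF pc])
        show "continuous_on {0..} (\<lambda>y. exp (- ((w - of_real y)\<^sup>2) / 2))"
          by (intro continuous_intros) auto
        show "(\<lambda>y. exp (- ((w - of_real y)\<^sup>2) / 2)) ` {0..} \<subseteq> ball 0 1"
        proof (rule image_subsetI)
          fix y :: real assume "y \<in> {0..}"
          then have "norm (exp (- ((w - of_real y)\<^sup>2) / 2)) \<le> 1 / 2"
            using norm_polylog_exp_shift_le(1)[of w y] that by blast
          then show "exp (- ((w - of_real y)\<^sup>2) / 2) \<in> ball 0 1" unfolding mem_ball_0 by linarith
        qed
      qed
    qed simp
    then show ?thesis by simp
  qed
  have "(\<lambda>n. h_integral (u n)) \<longlonglongrightarrow> h_integral w"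
    if u: "\<And>n. u n \<in> ?S" "u \<longlonglongrightarrow> w" and w: "w \<in> ?S" for u w
    unfolding h_integral_def set_lebesgue_integral_def
  proof (rule integral_dominated_convergence[where w = "\<lambda>y. indicator {0..} y * exp (- y)"])
    show "?f w \<in> borel_measurable lborel" by (rule meas[OF w])
    show "?f (u n) \<in> borel_measurable lborel" for n by (rule meas[OF u(1)])
    show "integrable lborel (\<lambda>y. indicator {0..} y * exp (- y) :: real)" by (rule integral_exp_neg)
    show "AE y in lborel. (\<lambda>n. ?f (u n) y) \<longlonglongrightarrow> ?f w y"
    proof (rule AE_I2)
      fix y :: real
      show "(\<lambda>n. ?f (u n) y) \<longlonglongrightarrow> ?f w y"
      proof (cases "y \<ge> 0")
        case True
        have "(\<lambda>n. polylog (1/2) (exp (- ((u n - of_real y)\<^sup>2) / 2))) \<longlonglongrightarrow> polylog (1/2) (exp (- ((w - of_real y)\<^sup>2) / 2))"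
        proof (rule continuous_on_tendsto_compose[OF pc])
          show "(\<lambda>n. exp (- ((u n - of_real y)\<^sup>2) / 2)) \<longlonglongrightarrow> exp (- ((w - of_real y)\<^sup>2) / 2)"
            by (intro tendsto_intros u) simp
          have *: "exp (- ((v - of_real y)\<^sup>2) / 2) \<in> ball 0 1" if v: "v \<in> ?S" for v
          proof -
            have "norm (exp (- ((v - of_real y)\<^sup>2) / 2)) \<le> 1 / 2"
              using norm_polylog_exp_shift_le(1)[of v y] v True by blast
            then show ?thesis unfolding mem_ball_0 by linarith
          qed
          show "exp (- ((w - of_real y)\<^sup>2) / 2) \<in> ball 0 1" by (rule *[OF w])
          show "\<forall>\<^sub>F n in sequentially. exp (- ((u n - of_real y)\<^sup>2) / 2) \<in> ball 0 1"
            by (intro always_eventually allI * u(1))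
        qed
        then show ?thesis using True by simp
      qed simp
    qed
    show "AE y in lborel. norm (?f (u n) y) \<le> indicator {0..} y * exp (- y)" for n
    proof (rule AE_I2)
      fix y :: real
      have S: "Re (u n) \<le> -1" "Re ((u n)\<^sup>2) \<ge> 2" using u(1)[of n] by auto
      have "2 * exp (- Re ((u n)\<^sup>2) / 2) \<le> 2 * exp (-1)" using S by simp
      also have "\<dots> \<le> 1" using exp_neg_one_le_half by simp
      finally have "2 * exp (- Re ((u n)\<^sup>2) / 2) * exp (- y) \<le> 1 * exp (- y)"
        by (rule mult_right_mono) simp
      then show "norm (?f (u n) y) \<le> indicator {0..} y * exp (- y)"
        using order_trans[OF norm_polylog_exp_shift_le(2)[OF S, of y]] by (cases "y \<ge> 0") simp_all
    qed
  qed
  then show ?thesis unfolding continuous_on_sequentially o_def by blast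
qed

text \<open>Only t = 0 gives the saddle point itself. In general this is the branch, continuous in
  t, of the solution of w^2 = L - 2 i t in the left half-plane.\<close>

definition saddle_point :: "real \<Rightarrow> real \<Rightarrow> complex" where
  "saddle_point L t = - csqrt (Complex L (- 2 * t))"

lemma saddle_point_square: "(saddle_point L t)\<^sup>2 = Complex L (- 2 * t)"
  by (simp add: saddle_point_def)

lemma Re_csqrt_ge:
  assumes "L > 0"
  shows "sqrt L \<le> Re (csqrt (Complex L x))"
proof -
  have "\<bar>L\<bar> \<le> cmod (Complex L x)" using abs_Re_le_cmod[of "Complex L x"] by simp
  then show ?thesis using assms by (simp add: csqrt.sel)
qed

lemma Re_saddle_point_le: "L > 0 \<Longrightarrow> Re (saddle_point L t) \<le> - sqrt L"
  using Re_csqrt_ge[of L "- 2 * t"] by (simp add: saddle_point_def)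

lemma continuous_on_saddle_point: "L > 0 \<Longrightarrow> continuous_on A (saddle_point L)"
  unfolding saddle_point_def
  by (intro continuous_intros continuous_on_compose2[of "- \<real>\<^sub>\<le>\<^sub>0" csqrt] continuous_on_csqrt)
    (auto simp: complex_nonpos_Reals_iff Complex_eq intro!: continuous_intros)

lemma exp_saddle_point: "exp (- ((saddle_point L t)\<^sup>2) / 2) = of_real (exp (- L / 2)) * cis t"
proof -
  have "- (Complex L (- 2 * t)) / 2 = of_real (- L / 2) + \<i> * of_real t"
    by (simp add: complex_eq_iff)
  then show ?thesis by (simp only: saddle_point_square exp_add cis_conv_exp exp_of_real)
qed

text \<open>The equation exp (- w^2 / 2) = z determines w^2 up to multiples of 4 pi i, and Re w < 0
  then selects one of the two roots.\<close>

lemma bij_betw_saddle_point: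
  assumes "L > 0"
  shows "bij_betw (\<lambda>k::int. saddle_point L (t + 2 * pi * of_int k)) UNIV (L_set (of_real (exp (- L / 2)) * cis t))"
  unfolding bij_betw_def
proof
  show "inj (\<lambda>k::int. saddle_point L (t + 2 * pi * of_int k))"
  proof (rule injI)
    fix k k' :: int
    assume "saddle_point L (t + 2 * pi * of_int k) = saddle_point L (t + 2 * pi * of_int k')"
    then have "(saddle_point L (t + 2 * pi * of_int k))\<^sup>2 = (saddle_point L (t + 2 * pi * of_int k'))\<^sup>2" by simp
    then show "k = k'" unfolding saddle_point_square by simp
  qed
  show "range (\<lambda>k::int. saddle_point L (t + 2 * pi * of_int k)) = L_set (of_real (exp (- L / 2)) * cis t)" (is "?A = ?B")
  proof (intro antisym subsetI)
    fix w assume "w \<in> ?A"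
    then obtain k :: int where k: "w = saddle_point L (t + 2 * pi * of_int k)" by blast
    have "cis (t + 2 * pi * of_int k) = cis t"
      by (simp add: cis_mult[symmetric] cis_multiple_2pi)
    moreover have "Re w < 0"
      unfolding k using Re_saddle_point_le[OF assms, of "t + 2 * pi * of_int k"] real_sqrt_gt_zero[OF assms] by linarith
    ultimately show "w \<in> ?B"
      unfolding k L_set_def using exp_saddle_point[of L "t + 2 * pi * of_int k"] by simp
  next
    fix w assume "w \<in> ?B"
    then have w: "exp (- (w\<^sup>2) / 2) = of_real (exp (- L / 2)) * cis t" "Re w < 0" by (auto simp: L_set_def)
    have "exp (- (w\<^sup>2) / 2) = exp (of_real (- L / 2) + \<i> * of_real t)"
      unfolding w(1) by (simp only: exp_add cis_conv_exp exp_of_real)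
    then obtain n :: int where "- (w\<^sup>2) / 2 = of_real (- L / 2) + \<i> * of_real t + (of_int (2 * n) * pi) * \<i>"
      unfolding exp_eq by blast
    then have "w\<^sup>2 = Complex L (- 2 * (t + 2 * pi * of_int n))"
      by (simp add: complex_eq_iff field_simps)
    then have "csqrt (Complex L (- 2 * (t + 2 * pi * of_int n))) = - w"
      by (intro csqrt_unique) (use w(2) in auto)
    then have "w = saddle_point L (t + 2 * pi * of_int n)" by (simp add: saddle_point_def)
    then show "w \<in> ?A" by blast
  qed
qed

section \<open>The exponent near the saddle point\<close>

lemma norm_exp_diff_le:
  fixes a b :: complex
  assumes "Re a \<le> c" "Re b \<le> c"
  shows "norm (exp a - exp b) \<le> exp c * norm (a - b)"
proof (rule field_differentiable_bound)
  show "convex {z. Re z \<le> c}" by (rule convex_halfspace_Re_le)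
  show "(exp has_field_derivative exp z) (at z within {z. Re z \<le> c})" for z
    by (rule DERIV_exp[THEN has_field_derivative_at_within])
qed (use assms in auto)

lemma norm_exp_minus_one_le:
  fixes w :: complex
  assumes "norm w \<le> c" "c \<le> 1/2"
  shows "norm (exp w - 1) \<le> 2 * c"
proof -
  have c: "0 \<le> c" using assms norm_ge_zero order_trans by blast
  have "norm (exp w - exp 0) \<le> exp c * norm (w - 0)"
    by (rule norm_exp_diff_le) (use complex_Re_le_cmod[of w] assms c in auto)
  also have "\<dots> \<le> 2 * c"
  proof (rule mult_mono)
    have "exp c \<le> 1 + c + c\<^sup>2" using exp_bound[of c] c assms by simp
    also have "\<dots> \<le> 1 + 1/2 + (1/2)\<^sup>2" using assms c by (intro add_mono power_mono) auto
    finally show "exp c \<le> 2" by (simp add: power2_eq_square)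
  qed (use assms in auto)
  finally show ?thesis by simp
qed

text \<open>The rescaled point - w / sqrt L for w^2 = L (1 - i \<sigma>), where \<sigma> = 2 t / L;
  the saddle point is \<sigma> = 0.\<close>

definition csq :: "real \<Rightarrow> complex" where
  "csq \<sigma> = csqrt (Complex 1 (- \<sigma>))"

lemma csq_square: "(csq \<sigma>)\<^sup>2 = Complex 1 (- \<sigma>)"
  by (simp add: csq_def)

lemma Re_csq_ge_one: "1 \<le> Re (csq \<sigma>)"
  using Re_csqrt_ge[of 1 "- \<sigma>"] by (simp add: csq_def)

lemma norm_csq_ge_one: "1 \<le> norm (csq \<sigma>)"
  using Re_csq_ge_one[of \<sigma>] complex_Re_le_cmod[of "csq \<sigma>"] by linarith

lemma Re_csq_square: "(Re (csq \<sigma>))\<^sup>2 = (1 + sqrt (1 + \<sigma>\<^sup>2)) / 2"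
  by (simp add: csq_def csqrt.sel cmod_def)

lemma Im_csq_square: "(Im (csq \<sigma>))\<^sup>2 = (Re (csq \<sigma>))\<^sup>2 - 1"
  using arg_cong[OF csq_square[of \<sigma>], of Re] by (simp add: power2_eq_square)

lemma norm_csq_le: "norm (csq \<sigma>) \<le> 3/2 * Re (csq \<sigma>)"
proof -
  have "(norm (csq \<sigma>))\<^sup>2 \<le> 2 * (Re (csq \<sigma>))\<^sup>2"
    unfolding cmod_power2 Im_csq_square by simp
  also have "\<dots> \<le> (3/2 * Re (csq \<sigma>))\<^sup>2" by (simp add: power_mult_distrib power2_eq_square)
  finally show ?thesis
    using Re_csq_ge_one[of \<sigma>] by (intro power2_le_imp_le[of "norm (csq \<sigma>)"]) auto
qed

text \<open>All these points lie on the hyperbola Re (w^2) = 1, where Im^2 = Re^2 - 1, so the real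
  part of the phase becomes a decreasing function of Re w alone. The decay is thus global and not
  confined to a neighbourhood of the saddle.\<close>

lemma Re_csq_phase: "Re ((csq \<sigma>) ^ 3 / 3 - csq \<sigma>) = - 2 / 3 * (Re (csq \<sigma>)) ^ 3"
proof -
  let ?a = "Re (csq \<sigma>)" and ?b = "Im (csq \<sigma>)"
  have "Re ((csq \<sigma>) ^ 3) = ?a ^ 3 - 3 * ?a * ?b\<^sup>2"
    by (simp add: power3_eq_cube power2_eq_square algebra_simps)
  also have "\<dots> = 3 * ?a - 2 * ?a ^ 3"
    unfolding Im_csq_square by (simp add: power3_eq_cube power2_eq_square algebra_simps)
  finally show ?thesis by (simp add: field_simps)
qed

text \<open>With a = Re w the claim is (2 / 3) (a^3 - 1) >= a^2 - 1, which follows from (a - 1)^2 (a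
  + 1 / 2) >= 0.\<close>

lemma Re_csq_cube_ge: "(sqrt (1 + \<sigma>\<^sup>2) - 1) / 2 \<le> 2 / 3 * ((Re (csq \<sigma>)) ^ 3 - 1)"
proof -
  let ?a = "Re (csq \<sigma>)"
  have "0 \<le> (?a - 1)\<^sup>2 * (?a + 1/2)" using Re_csq_ge_one[of \<sigma>] by simp
  also have "\<dots> = ?a ^ 3 - 1 - 3/2 * (?a\<^sup>2 - 1)"
    by (simp add: power3_eq_cube power2_eq_square algebra_simps)
  finally show ?thesis unfolding Re_csq_square by (simp add: field_simps)
qed

text \<open>The right-hand side behaves like s^2 for small \<sigma> and like sqrt \<kappa> |s| for
  large \<sigma>. The linear bound |s| - 1 serves both ranges, uniformly in \<kappa> >= 1.\<close>

lemma sqrt_excess_ge: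
  fixes \<kappa> s \<sigma> :: real
  assumes "\<kappa> \<ge> 1" "\<kappa> * \<sigma>\<^sup>2 = 4 * s\<^sup>2"
  shows "\<bar>s\<bar> - 1 \<le> \<kappa> * ((sqrt (1 + \<sigma>\<^sup>2) - 1) / 2)"
proof (cases "\<bar>s\<bar> \<le> 1")
  case True
  have "0 \<le> \<kappa> * ((sqrt (1 + \<sigma>\<^sup>2) - 1) / 2)" using assms by simp
  then show ?thesis using True by linarith
next
  case False
  define v where "v = \<bar>s\<bar> - 1"
  have v: "v > 0" using False by (simp add: v_def)
  have s2: "s\<^sup>2 = (v + 1)\<^sup>2" by (simp add: v_def)
  have "v * v \<le> \<kappa> * (v * v)" using assms v by simp
  moreover have "0 \<le> \<kappa> * v" using assms v by simp
  ultimately have "4 * (v * v) + 4 * (\<kappa> * v) \<le> \<kappa> * (4 * (v + 1)\<^sup>2)"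
    using assms by (simp add: power2_eq_square algebra_simps)
  also have "\<dots> = \<kappa> * (\<kappa> * \<sigma>\<^sup>2)" using assms(2) s2 by simp
  finally have "(\<kappa> + 2 * v)\<^sup>2 \<le> (\<kappa>)\<^sup>2 * (1 + \<sigma>\<^sup>2)" by (simp add: power2_eq_square algebra_simps)
  then have "sqrt ((\<kappa> + 2 * v)\<^sup>2) \<le> sqrt ((\<kappa>)\<^sup>2 * (1 + \<sigma>\<^sup>2))" by (rule real_sqrt_le_mono)
  then have "\<kappa> + 2 * v \<le> \<kappa> * sqrt (1 + \<sigma>\<^sup>2)" using assms v by (simp add: real_sqrt_mult)
  then show ?thesis by (simp add: v_def algebra_simps)
qed

lemma phase_cube_ge:
  assumes "\<kappa> \<ge> 1" "\<kappa> * \<sigma>\<^sup>2 = 4 * s\<^sup>2"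
  shows "\<bar>s\<bar> - 1 \<le> 2 / 3 * \<kappa> * ((Re (csq \<sigma>)) ^ 3 - 1)"
proof -
  have "\<kappa> * ((sqrt (1 + \<sigma>\<^sup>2) - 1) / 2) \<le> \<kappa> * (2 / 3 * ((Re (csq \<sigma>)) ^ 3 - 1))"
    by (intro mult_left_mono Re_csq_cube_ge) (use assms in auto)
  also have "\<dots> = 2 / 3 * \<kappa> * ((Re (csq \<sigma>)) ^ 3 - 1)" by simp
  finally show ?thesis using sqrt_excess_ge[OF assms] by linarith
qed

lemma csq_minus_one: "(csq \<sigma> - 1) * (csq \<sigma> + 1) = - \<i> * of_real \<sigma>"
  using csq_square[of \<sigma>] by (simp add: power2_eq_square algebra_simps complex_eq_iff)

lemma norm_csq_plus_one_ge: "2 \<le> norm (csq \<sigma> + 1)"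
  using Re_csq_ge_one[of \<sigma>] complex_Re_le_cmod[of "csq \<sigma> + 1"] by simp

lemma norm_csq_minus_one: "norm (csq \<sigma> - 1) * norm (csq \<sigma> + 1) = \<bar>\<sigma>\<bar>"
  unfolding norm_mult[symmetric] csq_minus_one by (simp add: norm_mult)

lemma norm_csq_minus_one_le: "norm (csq \<sigma> - 1) \<le> \<bar>\<sigma>\<bar> / 2"
  using mult_left_mono[OF norm_csq_plus_one_ge[of \<sigma>], of "norm (csq \<sigma> - 1)"] norm_csq_minus_one[of \<sigma>] by simp

text \<open>An identity replaces Taylor's theorem: since \<sigma>^2 = - (w^2 - 1)^2, the remainder
  equals - (w - 1)^3 (3 w + 5) / 12. Now |w - 1| = |\<sigma>| / |w + 1|, |w + 1| >= 2 and |3 w + 5|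
  <= 4 |w + 1|.\<close>

lemma norm_phase_remainder_le:
  "norm ((csq \<sigma>) ^ 3 / 3 - csq \<sigma> + 2 / 3 + of_real (\<sigma>\<^sup>2 / 4)) \<le> \<bar>\<sigma>\<bar> ^ 3 / 12"
proof -
  let ?w = "csq \<sigma>"
  have s: "of_real (\<sigma>\<^sup>2) = - ((?w - 1) * (?w + 1))\<^sup>2" unfolding csq_minus_one by (simp add: power_mult_distrib)
  have "?w ^ 3 / 3 - ?w + 2 / 3 + of_real (\<sigma>\<^sup>2 / 4) = ?w ^ 3 / 3 - ?w + 2 / 3 - ((?w - 1) * (?w + 1))\<^sup>2 / 4"
    using s by simp
  also have "\<dots> = - ((?w - 1) ^ 3 * (3 * ?w + 5)) / 12"
    by (simp add: power3_eq_cube power2_eq_square field_simps)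
  finally have "norm (?w ^ 3 / 3 - ?w + 2 / 3 + of_real (\<sigma>\<^sup>2 / 4)) = norm (?w - 1) ^ 3 * norm (3 * ?w + 5) / 12"
    by (simp add: norm_mult norm_divide norm_power)
  moreover have "norm (3 * ?w + 5) \<le> 4 * norm (?w + 1)"
  proof -
    have "3 * ?w + 5 = 3 * (?w + 1) + 2" by simp
    then have "norm (3 * ?w + 5) \<le> norm (3 * (?w + 1)) + norm (2::complex)" by (metis norm_triangle_ineq)
    moreover have "norm (3 * (?w + 1)) = 3 * norm (?w + 1)" by (simp only: norm_mult) simp
    ultimately show ?thesis using norm_csq_plus_one_ge[of \<sigma>] by simp
  qed
  moreover have "norm (?w - 1) ^ 3 * (4 * norm (?w + 1)) \<le> \<bar>\<sigma>\<bar> ^ 3"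
  proof -
    let ?n = "norm (?w + 1)"
    have "norm (?w - 1) ^ 3 * (2 * 2) * ?n \<le> norm (?w - 1) ^ 3 * (?n * ?n) * ?n"
      by (intro mult_right_mono mult_left_mono mult_mono) (use norm_csq_plus_one_ge[of \<sigma>] in auto)
    also have "\<dots> = \<bar>\<sigma>\<bar> ^ 3" unfolding norm_csq_minus_one[symmetric] by (simp add: power3_eq_cube mult_ac)
    finally show ?thesis by (simp add: mult_ac)
  qed
  ultimately show ?thesis
    using mult_left_mono[of "norm (3 * ?w + 5)" "4 * norm (?w + 1)" "norm (?w - 1) ^ 3"] by simp
qed

lemma cube_le_exp:
  fixes x :: real
  assumes "x \<ge> 0"
  shows "x ^ 3 \<le> 27 * exp x"
proof -
  have "x / 3 \<le> exp (x / 3)" using exp_ge_add_one_self[of "x / 3"] by linarith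
  then have "(x / 3) ^ 3 \<le> exp (x / 3) ^ 3"
    using assms by (intro power_mono) auto
  then show ?thesis by (simp add: power_divide flip: exp_of_nat_mult)
qed

section \<open>The phase in the Gaussian variable s = sqrt \<kappa> \<sigma> / 2\<close>

context
  fixes \<kappa> \<sigma> s :: real
  assumes \<kappa>: "\<kappa> \<ge> 1" and s: "sqrt \<kappa> * \<sigma> = 2 * s"
begin

lemma scaled_square: "\<kappa> * \<sigma>\<^sup>2 = 4 * s\<^sup>2"
proof -
  have "(sqrt \<kappa> * \<sigma>)\<^sup>2 = (2 * s)\<^sup>2" by (simp only: s)
  then show ?thesis using \<kappa> by (simp add: power_mult_distrib)
qed

lemma Re_phase_le: "Re (of_real \<kappa> * ((csq \<sigma>) ^ 3 / 3 - csq \<sigma>) + of_real (2 / 3 * \<kappa>)) \<le> 1 - \<bar>s\<bar>"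
proof -
  have "Re (of_real \<kappa> * ((csq \<sigma>) ^ 3 / 3 - csq \<sigma>) + of_real (2 / 3 * \<kappa>)) = - (2 / 3 * \<kappa> * ((Re (csq \<sigma>)) ^ 3 - 1))"
    unfolding plus_complex.sel Re_complex_of_real times_complex.sel Im_complex_of_real Re_csq_phase by (simp add: field_simps)
  then show ?thesis using phase_cube_ge[OF \<kappa> scaled_square] by linarith
qed

lemma norm_saddle_exp_le:
  "norm (exp (of_real \<kappa> * ((csq \<sigma>) ^ 3 / 3 - csq \<sigma>) + of_real (2 / 3 * \<kappa>))) \<le> 3 * exp (- \<bar>s\<bar>)"
proof -
  have "norm (exp (of_real \<kappa> * ((csq \<sigma>) ^ 3 / 3 - csq \<sigma>) + of_real (2 / 3 * \<kappa>))) \<le> exp (1 - \<bar>s\<bar>)"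
    using Re_phase_le by simp
  also have "\<dots> = exp 1 * exp (- \<bar>s\<bar>)" by (simp flip: exp_add)
  also have "\<dots> \<le> 3 * exp (- \<bar>s\<bar>)" by (intro mult_right_mono exp_le) auto
  finally show ?thesis .
qed

lemma exp_neg_square_le: "exp (- s\<^sup>2) \<le> 3 * exp (- \<bar>s\<bar>)"
proof -
  have "0 \<le> (\<bar>s\<bar> - 1/2)\<^sup>2" by simp
  then have "- s\<^sup>2 \<le> 1 - \<bar>s\<bar>" by (simp add: power2_eq_square algebra_simps)
  then have "exp (- s\<^sup>2) \<le> exp 1 * exp (- \<bar>s\<bar>)" by (simp flip: exp_add)
  also have "\<dots> \<le> 3 * exp (- \<bar>s\<bar>)" by (intro mult_right_mono exp_le) auto
  finally show ?thesis .
qed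

text \<open>Both exponents have real part at most 1 - |s| and differ by at most \<kappa>
  |\<sigma>|^3 / 12 = (2 / 3) |s|^3 / sqrt \<kappa>. Half of the decay absorbs |s|^3 <= 216 exp (|s|
  / 2), which is why the envelope is exp (- |s| / 2); 432 = 3 * 216 * 2 / 3.\<close>

lemma norm_saddle_exp_diff_le:
  "norm (exp (of_real \<kappa> * ((csq \<sigma>) ^ 3 / 3 - csq \<sigma>) + of_real (2 / 3 * \<kappa>)) - of_real (exp (- s\<^sup>2)))
    \<le> 432 / sqrt \<kappa> * exp (- \<bar>s\<bar> / 2)"
proof -
  let ?a = "of_real \<kappa> * ((csq \<sigma>) ^ 3 / 3 - csq \<sigma>) + of_real (2 / 3 * \<kappa>)"
  have "0 \<le> (\<bar>s\<bar> - 1/2)\<^sup>2" by simp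
  then have s1: "- s\<^sup>2 \<le> 1 - \<bar>s\<bar>" by (simp add: power2_eq_square algebra_simps)
  have "norm (exp ?a - exp (of_real (- s\<^sup>2))) \<le> exp (1 - \<bar>s\<bar>) * norm (?a - of_real (- s\<^sup>2))"
    by (rule norm_exp_diff_le) (use Re_phase_le s1 in auto)
  also have "?a - of_real (- s\<^sup>2) = of_real \<kappa> * ((csq \<sigma>) ^ 3 / 3 - csq \<sigma> + 2 / 3 + of_real (\<sigma>\<^sup>2 / 4))"
  proof -
    have "complex_of_real (s\<^sup>2) = of_real \<kappa> * of_real (\<sigma>\<^sup>2 / 4)"
      using arg_cong[OF scaled_square, of "\<lambda>x. complex_of_real (x / 4)"] by simp
    then show ?thesis by (simp add: algebra_simps)
  qed
  also have "exp (1 - \<bar>s\<bar>) * norm (of_real \<kappa> * ((csq \<sigma>) ^ 3 / 3 - csq \<sigma> + 2 / 3 + of_real (\<sigma>\<^sup>2 / 4)))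
      \<le> exp (1 - \<bar>s\<bar>) * (\<kappa> * (\<bar>\<sigma>\<bar> ^ 3 / 12))"
    unfolding norm_mult using \<kappa> norm_phase_remainder_le[of \<sigma>] by (intro mult_left_mono) auto
  also have "\<kappa> * (\<bar>\<sigma>\<bar> ^ 3 / 12) = 2 / 3 * \<bar>s\<bar> ^ 3 / sqrt \<kappa>"
  proof -
    have "\<bar>sqrt \<kappa> * \<sigma>\<bar> ^ 3 = \<bar>2 * s\<bar> ^ 3" by (simp only: s)
    then have "sqrt \<kappa> ^ 3 * \<bar>\<sigma>\<bar> ^ 3 = 8 * \<bar>s\<bar> ^ 3" using \<kappa> by (simp add: abs_mult power_mult_distrib)
    moreover have "sqrt \<kappa> ^ 3 = \<kappa> * sqrt \<kappa>" using \<kappa> by (simp add: power3_eq_cube)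
    ultimately show ?thesis using \<kappa> by (simp add: field_simps)
  qed
  also have "exp (1 - \<bar>s\<bar>) * (2 / 3 * \<bar>s\<bar> ^ 3 / sqrt \<kappa>) \<le> 432 / sqrt \<kappa> * exp (- \<bar>s\<bar> / 2)"
  proof -
    have "\<bar>s\<bar> ^ 3 \<le> 216 * exp (\<bar>s\<bar> / 2)" using cube_le_exp[of "\<bar>s\<bar> / 2"] by (simp add: power_divide)
    then have "exp 1 * exp (- \<bar>s\<bar>) * (2 / 3 * \<bar>s\<bar> ^ 3 / sqrt \<kappa>) \<le> 3 * exp (- \<bar>s\<bar>) * (2 / 3 * (216 * exp (\<bar>s\<bar> / 2)) / sqrt \<kappa>)"
      using \<kappa> by (intro mult_mono divide_right_mono exp_le mult_left_mono) auto
    also have "\<dots> = 432 / sqrt \<kappa> * (exp (- \<bar>s\<bar>) * exp (\<bar>s\<bar> / 2))" by simp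
    also have "exp (- \<bar>s\<bar>) * exp (\<bar>s\<bar> / 2) = exp (- \<bar>s\<bar> / 2)" by (simp flip: exp_add)
    finally show ?thesis by (simp flip: exp_add)
  qed
  finally show ?thesis by (simp only: exp_of_real)
qed

lemma abs_sigma_exp_le: "\<bar>\<sigma>\<bar> * exp (- \<bar>s\<bar>) \<le> 4 / sqrt \<kappa> * exp (- \<bar>s\<bar> / 2)"
proof -
  have \<sigma>: "\<bar>\<sigma>\<bar> = 2 * \<bar>s\<bar> / sqrt \<kappa>"
    using arg_cong[OF s, of abs] \<kappa> by (simp add: abs_mult field_simps)
  have "\<bar>s\<bar> \<le> 2 * exp (\<bar>s\<bar> / 2)" using exp_ge_add_one_self[of "\<bar>s\<bar> / 2"] by linarith
  then have "\<bar>\<sigma>\<bar> * exp (- \<bar>s\<bar>) \<le> 2 * (2 * exp (\<bar>s\<bar> / 2)) / sqrt \<kappa> * exp (- \<bar>s\<bar>)"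
    unfolding \<sigma> using \<kappa> by (intro mult_right_mono divide_right_mono mult_left_mono) auto
  also have "\<dots> = 4 / sqrt \<kappa> * (exp (\<bar>s\<bar> / 2) * exp (- \<bar>s\<bar>))" by simp
  also have "exp (\<bar>s\<bar> / 2) * exp (- \<bar>s\<bar>) = exp (- \<bar>s\<bar> / 2)" by (simp flip: exp_add)
  finally show ?thesis .
qed

end

text \<open>This is the algebraic factor of the differentiated one-particle kernel. Each of 1 / u, 1
  / v and 2 / (u + v) is at most 1 in modulus and equals 1 at the saddle point, so the deviation of
  the product from 1 is at most the sum of the three deviations.\<close>

lemma norm_csq_product_le:
  "norm (2 / (csq \<sigma> * csq \<sigma>' * (csq \<sigma> + csq \<sigma>'))) \<le> 1"
  "norm (2 / (csq \<sigma> * csq \<sigma>' * (csq \<sigma> + csq \<sigma>')) - 1) \<le> \<bar>\<sigma>\<bar> + \<bar>\<sigma>'\<bar>"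
proof -
  let ?u = "csq \<sigma>" and ?v = "csq \<sigma>'"
  have nz: "?u \<noteq> 0" "?v \<noteq> 0" using norm_csq_ge_one[of \<sigma>] norm_csq_ge_one[of \<sigma>'] by auto
  have uv: "2 \<le> norm (?u + ?v)"
    using Re_csq_ge_one[of \<sigma>] Re_csq_ge_one[of \<sigma>'] complex_Re_le_cmod[of "?u + ?v"] by simp
  then have nz': "?u + ?v \<noteq> 0" by auto
  have a: "norm (1 / ?u) \<le> 1" "norm (1 / ?v) \<le> 1" "norm (2 / (?u + ?v)) \<le> 1"
    using norm_csq_ge_one[of \<sigma>] norm_csq_ge_one[of \<sigma>'] uv by (auto simp: norm_divide divide_simps)
  have eq: "2 / (?u * ?v * (?u + ?v)) = (1 / ?u) * (1 / ?v) * (2 / (?u + ?v))" by simp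
  show "norm (2 / (?u * ?v * (?u + ?v))) \<le> 1"
    unfolding eq norm_mult using a by (intro mult_le_one) auto
  have d1: "norm (1 / w - 1) \<le> norm (w - 1)" if "1 \<le> norm w" for w :: complex
  proof -
    have "w \<noteq> 0" using that by auto
    then have "norm (1 / w - 1) = norm (w - 1) / norm w"
      by (simp add: diff_divide_distrib norm_minus_commute flip: norm_divide)
    also have "\<dots> \<le> norm (w - 1) / 1" using that by (intro divide_left_mono) auto
    finally show ?thesis by simp
  qed
  have d2: "norm (2 / (?u + ?v) - 1) \<le> (norm (?u - 1) + norm (?v - 1)) / 2"
  proof -
    have "2 / (?u + ?v) - 1 = - ((?u - 1) + (?v - 1)) / (?u + ?v)" using nz' by (simp add: field_simps)
    then have "norm (2 / (?u + ?v) - 1) = norm ((?u - 1) + (?v - 1)) / norm (?u + ?v)"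
      by (simp only: norm_divide norm_minus_cancel)
    also have "\<dots> \<le> (norm (?u - 1) + norm (?v - 1)) / 2"
      using uv by (intro frac_le norm_triangle_ineq) auto
    finally show ?thesis .
  qed
  have "2 / (?u * ?v * (?u + ?v)) - 1 = (1 / ?u - 1) * ((1 / ?v) * (2 / (?u + ?v))) + ((1 / ?v - 1) * (2 / (?u + ?v)) + (2 / (?u + ?v) - 1))"
  proof -
    have "a * b * c - 1 = (a - 1) * (b * c) + ((b - 1) * c + (c - 1))" for a b c :: complex
      by (simp add: algebra_simps)
    then show ?thesis unfolding eq .
  qed
  then have "norm (2 / (?u * ?v * (?u + ?v)) - 1) \<le> norm (1 / ?u - 1) * (norm (1 / ?v) * norm (2 / (?u + ?v)))
      + (norm (1 / ?v - 1) * norm (2 / (?u + ?v)) + norm (2 / (?u + ?v) - 1))"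
    by (metis (no_types, lifting) norm_mult norm_triangle_mono order_refl)
  also have "\<dots> \<le> norm (1 / ?u - 1) * (1 * 1) + (norm (1 / ?v - 1) * 1 + norm (2 / (?u + ?v) - 1))"
    using a by (intro add_mono mult_left_mono mult_mono) auto
  also have "\<dots> \<le> norm (?u - 1) + (norm (?v - 1) + (norm (?u - 1) + norm (?v - 1)) / 2)"
    using d1[OF norm_csq_ge_one[of \<sigma>]] d1[OF norm_csq_ge_one[of \<sigma>']] d2 by linarith
  also have "\<dots> \<le> \<bar>\<sigma>\<bar> + \<bar>\<sigma>'\<bar>"
    using norm_csq_minus_one_le[of \<sigma>] norm_csq_minus_one_le[of \<sigma>']
      abs_ge_zero[of \<sigma>] abs_ge_zero[of \<sigma>'] by argo
  finally show "norm (2 / (?u * ?v * (?u + ?v)) - 1) \<le> \<bar>\<sigma>\<bar> + \<bar>\<sigma>'\<bar>" .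
qed

section \<open>Determinants and sums over tuples\<close>

lemma det_mat_expand:
  fixes f :: "nat \<Rightarrow> nat \<Rightarrow> complex"
  shows "Determinant.det (Matrix.mat n n (\<lambda>(i, j). f i j)) =
    (\<Sum>\<pi> | \<pi> permutes {0..<n}. signof \<pi> * (\<Prod>i=0..<n. f i (\<pi> i)))"
proof -
  have "(\<Prod>i=0..<n. Matrix.mat n n (\<lambda>(i, j). f i j) $$ (i, \<pi> i)) = (\<Prod>i=0..<n. f i (\<pi> i))"
    if "\<pi> permutes {0..<n}" for \<pi>
    by (intro prod.cong refl) (use permutes_in_image[OF that] in auto)
  then show ?thesis by (subst det_def'[of _ n]) (auto intro!: sum.cong)
qed

lemma continuous_on_det_mat:
  fixes f :: "nat \<Rightarrow> nat \<Rightarrow> 'a::topological_space \<Rightarrow> complex"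
  assumes "\<And>i j. i < n \<Longrightarrow> j < n \<Longrightarrow> continuous_on S (f i j)"
  shows "continuous_on S (\<lambda>x. Determinant.det (Matrix.mat n n (\<lambda>(i, j). f i j x)))"
  unfolding det_mat_expand
  by (intro continuous_intros assms) (auto dest: permutes_in_image)

text \<open>The Leibniz bound is good enough: the two determinants in D contribute (n!)^2, which
  cancels against 1 / (n!)^2 and leaves a geometric series in n.\<close>

lemma norm_det_mat_le:
  fixes f :: "nat \<Rightarrow> nat \<Rightarrow> complex"
  assumes "\<And>i j. i < n \<Longrightarrow> j < n \<Longrightarrow> norm (f i j) \<le> c"
  shows "norm (Determinant.det (Matrix.mat n n (\<lambda>(i, j). f i j))) \<le> fact n * c ^ n"
proof -
  have "norm (Determinant.det (Matrix.mat n n (\<lambda>(i, j). f i j))) \<le> (\<Sum>\<pi> | \<pi> permutes {0..<n}. c ^ n)"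
    unfolding det_mat_expand
  proof (rule sum_norm_le)
    fix \<pi> assume "\<pi> \<in> {\<pi>. \<pi> permutes {0..<n}}"
    then have \<pi>: "\<pi> permutes {0..<n}" by simp
    have "norm (\<Prod>i=0..<n. f i (\<pi> i)) \<le> (\<Prod>i=0..<n. c)"
      unfolding prod_norm[symmetric] by (rule prod_mono) (use assms permutes_in_image[OF \<pi>] in auto)
    moreover have "norm (signof \<pi> :: complex) = 1" by (simp add: sign_def)
    ultimately show "norm (signof \<pi> * (\<Prod>i=0..<n. f i (\<pi> i))) \<le> c ^ n"
      by (simp add: norm_mult)
  qed
  also have "\<dots> = fact n * c ^ n" by (simp add: card_permutations[of _ n])
  finally show ?thesis .
qed

lemma has_sum_prod_PiE:
  fixes f :: "int \<Rightarrow> real"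
  assumes "(f has_sum s) UNIV" "\<And>k. f k > 0"
  shows "((\<lambda>g. \<Prod>j<n. f (g j)) has_sum s ^ n) ({..<n::nat} \<rightarrow>\<^sub>E UNIV)"
proof -
  have sm: "f summable_on UNIV" and s: "infsum f UNIV = s"
    using assms(1) by (auto simp: has_sum_imp_summable infsumI)
  have "infsum (\<lambda>g. \<Prod>j\<in>{..<n}. f (g j)) ({..<n} \<rightarrow>\<^sub>E UNIV) = (\<Prod>j\<in>{..<n}. infsum f UNIV)"
    by (rule infsum_prod_PiE_abs) (use sm assms(2) in \<open>auto simp: less_imp_le\<close>)
  then have eq: "infsum (\<lambda>g. \<Prod>j<n. f (g j)) ({..<n} \<rightarrow>\<^sub>E UNIV) = s ^ n" by (simp add: s)
  have "f 0 \<le> s" using finite_sum_le_infsum[OF sm, of "{0}"] assms(2) s by (simp add: less_imp_le)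
  then have "s ^ n \<noteq> 0" using assms(2)[of 0] by simp
  \<comment> \<open>A family that is not summable has \<open>infsum\<close> 0, so the nonzero value
    s^n forces summability.\<close>
  then have "(\<lambda>g. \<Prod>j<n. f (g j)) summable_on ({..<n} \<rightarrow>\<^sub>E UNIV)"
    using eq infsum_not_exists by fastforce
  then show ?thesis using eq by (simp add: has_sum_iff)
qed

lemma suminf_eq_infsum:
  fixes f :: "nat \<Rightarrow> 'b::banach"
  assumes "\<And>n. norm (f n) \<le> M n" "M summable_on UNIV"
  shows "suminf f = (\<Sum>\<^sub>\<infinity>n. f n)"
  using sums_unique[OF has_sum_imp_sums[OF has_sum_infsum[OF norm_infsum_le_bound(1)[OF assms(1,2)]]]] by simp

lemma bij_betw_PiE:
  assumes "bij_betw f A B"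
  shows "bij_betw (\<lambda>g. restrict (\<lambda>j. f (g j)) I) (I \<rightarrow>\<^sub>E A) (I \<rightarrow>\<^sub>E B)"
proof (rule bij_betwI[where g = "\<lambda>g. restrict (\<lambda>j. the_inv_into A f (g j)) I"])
  have inj: "inj_on f A" and im: "f ` A = B" using assms by (auto simp: bij_betw_def)
  show "(\<lambda>g. restrict (\<lambda>j. f (g j)) I) \<in> (I \<rightarrow>\<^sub>E A) \<rightarrow> (I \<rightarrow>\<^sub>E B)"
    using im by (auto simp: PiE_iff)
  show "(\<lambda>g. restrict (\<lambda>j. the_inv_into A f (g j)) I) \<in> (I \<rightarrow>\<^sub>E B) \<rightarrow> (I \<rightarrow>\<^sub>E A)"
    using inj im by (auto simp: PiE_iff intro!: the_inv_into_into)
  show "restrict (\<lambda>j. the_inv_into A f (restrict (\<lambda>j. f (g j)) I j)) I = g" if "g \<in> I \<rightarrow>\<^sub>E A" for g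
    using that inj by (intro ext) (auto simp: restrict_def PiE_iff extensional_def the_inv_into_f_f)
  show "restrict (\<lambda>j. f (restrict (\<lambda>j. the_inv_into A f (g j)) I j)) I = g" if "g \<in> I \<rightarrow>\<^sub>E B" for g
    using that inj im by (intro ext) (auto simp: restrict_def PiE_iff extensional_def f_the_inv_into_f)
qed

section \<open>The density at fixed p and l\<close>

text \<open>The numerical thresholds: p l >= 2 puts the points where Re w <= -1 and Re (w^2) >= 2,
  as the bounds on h require, and gives 1 / p <= l; l >= 12 lets a change of b by 1 be absorbed by
  the phase and makes the series over n geometric with a small ratio; \<open>small\<close> says
  \<kappa> \<rho> <= 1 / 100, which controls C and h.\<close>

locale tail =
  fixes p l :: real
  assumes p_pos: "0 < p" and l_ge: "12 \<le> l" and pl_ge: "2 \<le> p * l"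
    and small: "l powr (3/2) * exp (- (p * l) / 2) \<le> 1 / 100"
begin

text \<open>
  The points of L_z for z = Z t are W (t + 2 pi k). The factors V, the summands and the terms of D are
  extended from b = beta to complex b near l by the factor exp ((b - l) w / sqrt p), so that derivatives
  in b can be bounded by Cauchy's inequality. G is the factor E normalised by its value at the saddle
  point, and A is an envelope of G and of its Gaussian approximation.
\<close>

definition "L = p * l"
definition "\<kappa> = l powr (3/2)"
definition "r = p * l powr (1/4)"
definition "\<rho> = exp (- L / 2)"
definition Z :: "real \<Rightarrow> complex" where "Z t = of_real \<rho> * cis t"
definition W :: "real \<Rightarrow> complex" where "W = saddle_point L"
definition A :: "real \<Rightarrow> real" where "A t = exp (- \<bar>t / r\<bar> / 2)"
definition G :: "real \<Rightarrow> complex" where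
  "G t = exp (of_real \<kappa> * ((csq (2 * t / L)) ^ 3 / 3 - csq (2 * t / L)) + of_real (2 / 3 * \<kappa>))"
definition H :: "real \<Rightarrow> complex" where "H t = h_fun (W t) (Z t)"
definition V :: "complex \<Rightarrow> real \<Rightarrow> complex" where
  "V b t = exp (2 * H t) * (of_real (exp (- 2 / 3 * \<kappa>)) * G t) * exp ((b - of_real l) * W t / of_real (sqrt p)) / W t"

abbreviation shift :: "real \<Rightarrow> int \<Rightarrow> real" where
  "shift t k \<equiv> t + 2 * pi * of_int k"

section \<open>Elementary bounds on the parameters, the points and the factors V\<close>

lemma l_pos: "0 < l" using l_ge by simp
lemma L_ge: "2 \<le> L" using pl_ge by (simp add: L_def)
lemma L_pos: "0 < L" using L_ge by simp
lemma r_pos: "0 < r" using p_pos l_pos by (simp add: r_def)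
lemma \<rho>_pos: "0 < \<rho>" by (simp add: \<rho>_def)

lemma \<kappa>_eq: "\<kappa> = l * sqrt l"
proof -
  have "l powr (1 + 1/2) = l powr 1 * l powr (1/2)" by (rule powr_add)
  then show ?thesis using l_pos by (simp add: \<kappa>_def powr_half_sqrt)
qed

lemma \<kappa>_ge: "12 \<le> \<kappa>" "1 \<le> \<kappa>"
proof -
  have "1 \<le> sqrt l" using l_ge by simp
  then have "12 * 1 \<le> l * sqrt l" using l_ge by (intro mult_mono) auto
  then show "12 \<le> \<kappa>" "1 \<le> \<kappa>" by (auto simp: \<kappa>_eq)
qed

lemma \<rho>_small: "\<kappa> * \<rho> \<le> 1 / 100" "\<rho> \<le> \<kappa> * \<rho>" "\<rho> \<le> 1 / 100"
proof -
  show 1: "\<kappa> * \<rho> \<le> 1 / 100" using small by (simp add: \<kappa>_def \<rho>_def L_def)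
  show 2: "\<rho> \<le> \<kappa> * \<rho>" using \<kappa>_ge \<rho>_pos by simp
  show "\<rho> \<le> 1 / 100" using 1 2 by simp
qed

text \<open>The reason for r = p l^(1/4): L / r = l^(3/4) = sqrt \<kappa>, so t / r is the Gaussian
  variable s that belongs to \<sigma> = 2 t / L.\<close>

lemma scale: "sqrt \<kappa> * (2 * t / L) = 2 * (t / r)"
proof -
  have "sqrt \<kappa> = l powr (3/4)"
    using l_pos by (simp add: \<kappa>_def powr_half_sqrt[symmetric] powr_powr)
  moreover have "l powr (3/4) * l powr (1/4) = l"
    using l_pos by (simp flip: powr_add)
  ultimately show ?thesis using p_pos l_pos unfolding r_def L_def
    by (simp add: field_simps)
qed

lemma W_eq: "W t = - (of_real (sqrt L) * csq (2 * t / L))"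
proof -
  have "csqrt (Complex L (- 2 * t)) = of_real (sqrt L) * csq (2 * t / L)"
  proof (rule csqrt_unique)
    have "(of_real (sqrt L) * csq (2 * t / L))\<^sup>2 = of_real L * Complex 1 (- (2 * t / L))"
      using L_pos by (simp add: power_mult_distrib csq_square flip: of_real_power)
    then show "(of_real (sqrt L) * csq (2 * t / L))\<^sup>2 = Complex L (- 2 * t)"
      using L_pos by (simp add: complex_eq_iff)
    show "0 < Re (of_real (sqrt L) * csq (2 * t / L)) \<or>
      Re (of_real (sqrt L) * csq (2 * t / L)) = 0 \<and> 0 \<le> Im (of_real (sqrt L) * csq (2 * t / L))"
      using Re_csq_ge_one[of "2 * t / L"] L_pos by simp
  qed
  then show ?thesis by (simp add: W_def saddle_point_def)
qed

lemma Re_W_le: "Re (W t) \<le> - sqrt L" unfolding W_def by (rule Re_saddle_point_le[OF L_pos])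

lemma sqrt_L_ge_one: "1 \<le> sqrt L" using L_ge by simp

lemma Re_W_le_minus_one: "Re (W t) \<le> -1"
  using Re_W_le[of t] sqrt_L_ge_one by linarith

lemma norm_W_ge: "sqrt L \<le> norm (W t)"
  using Re_W_le[of t] abs_Re_le_cmod[of "W t"] by linarith

lemma norm_W_add_ge: "2 * sqrt L \<le> norm (W t + W t')"
  using Re_W_le[of t] Re_W_le[of t'] abs_Re_le_cmod[of "W t + W t'"] by simp

lemma W_nonzero: "W t \<noteq> 0" "W t + W t' \<noteq> 0" "- W t - W t' \<noteq> 0"
proof -
  show 1: "W t + W t' \<noteq> 0" for t' using norm_W_add_ge[of t t'] sqrt_L_ge_one by auto
  show "W t \<noteq> 0" using 1[of t] by auto
  show "- W t - W t' \<noteq> 0" using 1[of t'] by (metis add.inverse_inverse minus_add_distrib neg_0_equal_iff_equal uminus_add_conv_diff diff_minus_eq_add add.commute)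
qed

lemma continuous_on_W: "continuous_on S W"
  unfolding W_def by (rule continuous_on_saddle_point[OF L_pos])

lemma exp_W: "exp (- ((W t)\<^sup>2) / 2) = Z t"
  unfolding W_def Z_def \<rho>_def by (rule exp_saddle_point)

lemma Z_periodic: "Z (shift t k) = Z t"
  by (simp add: Z_def cis_mult[symmetric] cis_multiple_2pi)

lemma norm_Z: "norm (Z t) = \<rho>" using \<rho>_pos by (simp add: Z_def norm_mult)

lemma continuous_on_Z: "continuous_on S Z" unfolding Z_def by (intro continuous_intros)

lemma Re_W_square: "Re ((W t)\<^sup>2) = L" by (simp add: W_def saddle_point_square)

lemma norm_H_le: "norm (H t) \<le> \<rho>"
  unfolding H_def norm_Z[symmetric, of t]
  by (rule norm_h_fun_le[OF exp_W]) (use Re_W_le_minus_one L_ge in \<open>auto simp: Re_W_square\<close>)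

lemma continuous_on_H: "continuous_on S H"
proof -
  have "H = (\<lambda>t. - (1 / of_real (sqrt (2 * pi))) * h_integral (W t))"
    by (intro ext) (simp add: H_def h_fun_eq_h_integral[OF exp_W])
  moreover have "continuous_on S (\<lambda>t. h_integral (W t))"
    by (rule continuous_on_compose2[OF continuous_on_h_integral continuous_on_W])
      (use Re_W_le_minus_one L_ge in \<open>auto simp: Re_W_square\<close>)
  ultimately show ?thesis by (simp add: continuous_intros)
qed

lemma continuous_on_csq: "continuous_on S (\<lambda>t. csq (2 * t / L))"
proof -
  have *: "csq (2 * t / L) = - (W t / of_real (sqrt L))" for t
    using L_pos by (simp add: W_eq)
  have "continuous_on S (\<lambda>t. - (W t / of_real (sqrt L)))"
    using L_pos by (intro continuous_intros continuous_on_W) auto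
  then show ?thesis unfolding * .
qed

lemma continuous_on_G: "continuous_on S G"
  unfolding G_def by (intro continuous_intros continuous_on_csq) auto

lemma continuous_on_V: "continuous_on S (V b)"
  unfolding V_def using p_pos W_nonzero
  by (intro continuous_intros continuous_on_H continuous_on_G continuous_on_W) auto

text \<open>For gamma = 0 both signs give the same function. Since L = p l, the powers of p cancel:
  (L / p)^(3/2) = l sqrt (L / p) = \<kappa>.\<close>

lemma E_fun_eq: "E_fun sg p 0 1 l (W t) = of_real (exp (- 2 / 3 * \<kappa>)) * G t"
proof -
  have sp: "p powr (3/2) = p * sqrt p"
  proof -
    have "p powr (1 + 1/2) = p powr 1 * p powr (1/2)" by (rule powr_add)
    then show ?thesis using p_pos by (simp add: powr_half_sqrt)
  qed
  have sL: "sqrt L = sqrt p * sqrt l" by (simp add: L_def real_sqrt_mult)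
  have c3: "of_real (1 / (3 * p powr (3/2))) * (- (of_real (sqrt L) * x)) ^ 3 = - (of_real \<kappa> * (x ^ 3 / 3))" for x :: complex
  proof -
    have "sqrt L ^ 3 / (3 * (p * sqrt p)) = \<kappa> / 3"
    proof -
      have "sqrt x ^ 3 = x * sqrt x" if "x > 0" for x :: real using that by (simp add: power3_eq_cube)
      then show ?thesis using p_pos l_pos unfolding sL \<kappa>_eq by (simp add: power_mult_distrib)
    qed
    then have e: "1 / (3 * p powr (3/2)) * sqrt L ^ 3 = \<kappa> / 3" unfolding sp by simp
    have "of_real (1 / (3 * p powr (3/2))) * (- (of_real (sqrt L) * x)) ^ 3 = - (of_real (1 / (3 * p powr (3/2)) * sqrt L ^ 3) * x ^ 3)"
      by (simp add: power_mult_distrib power_minus_odd)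
    then show ?thesis unfolding e by simp
  qed
  have c1: "of_real (l / p powr (1/2)) * (- (of_real (sqrt L) * x)) = - (of_real \<kappa> * x)" for x :: complex
  proof -
    have e: "l / p powr (1/2) * sqrt L = \<kappa>"
      using p_pos l_pos unfolding sL \<kappa>_eq by (simp add: powr_half_sqrt)
    have "of_real (l / p powr (1/2)) * (- (of_real (sqrt L) * x)) = - (of_real (l / p powr (1/2) * sqrt L) * x)"
      by simp
    then show ?thesis unfolding e .
  qed
  have "E_fun sg p 0 1 l (W t) = exp (of_real \<kappa> * ((csq (2 * t / L)) ^ 3 / 3) - of_real \<kappa> * csq (2 * t / L))"
    unfolding E_fun_def W_eq minus_mult_left[symmetric] c3 c1 by simp
  also have "\<dots> = exp (of_real (- 2 / 3 * \<kappa>)) * G t"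
    unfolding G_def exp_add[symmetric] by (simp add: algebra_simps)
  finally show ?thesis by (simp only: exp_of_real)
qed

lemma E_fun_shift:
  "E_fun sg p 0 1 b w = E_fun sg p 0 1 l w * exp ((of_real b - of_real l) * w / of_real (sqrt p))"
  using p_pos unfolding E_fun_def exp_add[symmetric]
  by (simp add: powr_half_sqrt algebra_simps diff_divide_distrib)

lemma norm_G_le: "norm (G t) \<le> 3 * exp (- \<bar>t / r\<bar>)"
  unfolding G_def by (rule norm_saddle_exp_le[OF \<kappa>_ge(2) scale])

lemma norm_exp_2H_le: "norm (exp (2 * H t)) \<le> 2"
proof -
  have "norm (exp (2 * H t) - 1) \<le> 2 * (1 / 50)"
    by (rule norm_exp_minus_one_le) (use norm_H_le[of t] \<rho>_small(3) in \<open>auto simp: norm_mult\<close>)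
  then show ?thesis using norm_triangle_ineq2[of "exp (2 * H t)" 1] by simp
qed

text \<open>At b = l the decay is exp (- 2 \<kappa> / 3); giving up part of it for the complex
  neighbourhood is harmless. This bound is used for summability and for n >= 2, where at least four
  factors yield exp (- 2 \<kappa>), still below the main order exp (- 4 \<kappa> / 3).\<close>

lemma norm_E_shift_le:
  assumes "b \<in> ball (of_real l) 1"
  shows "norm (of_real (exp (- 2 / 3 * \<kappa>)) * G t * exp ((b - of_real l) * W t / of_real (sqrt p)))
    \<le> 3 * exp (- \<kappa> / 2) * A t"
proof -
  let ?w = "csq (2 * t / L)" let ?a = "Re ?w"
  have bn: "norm (b - of_real l) \<le> 1" using assms by (simp add: dist_norm norm_minus_commute)
  have a1: "1 \<le> ?a" by (rule Re_csq_ge_one)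
  have nG: "norm (of_real (exp (- 2 / 3 * \<kappa>)) * G t) = exp (- (2 / 3 * \<kappa> * ?a ^ 3))"
  proof -
    have "Re (of_real \<kappa> * (?w ^ 3 / 3 - ?w) + of_real (2 / 3 * \<kappa>)) = - (2 / 3 * \<kappa> * ?a ^ 3) + 2 / 3 * \<kappa>"
      unfolding plus_complex.sel Re_complex_of_real times_complex.sel Im_complex_of_real Re_csq_phase by (simp add: field_simps)
    then have "norm (G t) = exp (- (2 / 3 * \<kappa> * ?a ^ 3) + 2 / 3 * \<kappa>)"
      unfolding G_def norm_exp_eq_Re by (simp only:)
    then have "norm (of_real (exp (- 2 / 3 * \<kappa>)) * G t) = exp (- 2 / 3 * \<kappa>) * exp (- (2 / 3 * \<kappa> * ?a ^ 3) + 2 / 3 * \<kappa>)"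
      by (simp add: norm_mult)
    then show ?thesis by (simp flip: exp_add)
  qed
  have "norm ((b - of_real l) * W t / of_real (sqrt p)) \<le> 1 * (sqrt l * norm ?w)"
  proof -
    have "norm (W t) / sqrt p = sqrt l * norm ?w"
      using p_pos l_pos unfolding W_eq L_def by (simp add: norm_mult real_sqrt_mult)
    moreover have "norm ((b - of_real l) * W t / of_real (sqrt p)) = norm (b - of_real l) * (norm (W t) / sqrt p)"
      using p_pos by (simp add: norm_mult norm_divide)
    moreover have "norm (b - of_real l) * (norm (W t) / sqrt p) \<le> 1 * (norm (W t) / sqrt p)"
      using bn p_pos by (intro mult_right_mono) auto
    ultimately show ?thesis by simp
  qed
  also have "\<dots> \<le> 3 / 2 * sqrt l * ?a"
    using mult_left_mono[OF norm_csq_le[of "2 * t / L"], of "sqrt l"] l_pos by simp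
  finally have sh: "norm (exp ((b - of_real l) * W t / of_real (sqrt p))) \<le> exp (3 / 2 * sqrt l * ?a)"
    using norm_exp[of "(b - of_real l) * W t / of_real (sqrt p)"] by (meson exp_le_cancel_iff order_trans)
  \<comment> \<open>The shift costs at most (3 / 2) sqrt l a <= \<kappa> a^3 / 6, a quarter of the
    exponent (2 / 3) \<kappa> a^3. The remaining three quarters are at least \<kappa> / 2 + (3 / 4)
    (|t / r| - 1), which covers the envelope.\<close>
  have "9 * (sqrt l * ?a) \<le> \<kappa> * ?a ^ 3"
  proof -
    have "9 * 1 \<le> l * ?a\<^sup>2" using l_ge a1 by (intro mult_mono) auto
    then have "9 * (sqrt l * ?a) \<le> (l * ?a\<^sup>2) * (sqrt l * ?a)"
      using l_pos a1 by (intro mult_right_mono) auto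
    then show ?thesis by (simp add: \<kappa>_eq power2_eq_square power3_eq_cube mult_ac)
  qed
  moreover have "\<bar>t / r\<bar> - 1 \<le> 2 / 3 * (\<kappa> * ?a ^ 3) - 2 / 3 * \<kappa>"
    using Re_phase_le[OF \<kappa>_ge(2) scale, of t] \<kappa>_ge phase_cube_ge[OF \<kappa>_ge(2) scaled_square[OF \<kappa>_ge(2) scale], of t]
    by (simp add: algebra_simps)
  ultimately have "- (2 / 3 * \<kappa> * ?a ^ 3) + 3 / 2 * sqrt l * ?a \<le> 1 - \<kappa> / 2 - \<bar>t / r\<bar> / 2"
    using abs_ge_zero[of "t / r"] by argo
  then have "exp (- (2 / 3 * \<kappa> * ?a ^ 3)) * exp (3 / 2 * sqrt l * ?a) \<le> exp 1 * (exp (- \<kappa> / 2) * A t)"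
    unfolding A_def exp_add[symmetric] by simp
  also have "\<dots> \<le> 3 * (exp (- \<kappa> / 2) * A t)" by (intro mult_right_mono exp_le) (simp add: A_def)
  finally have "exp (- (2 / 3 * \<kappa> * ?a ^ 3)) * exp (3 / 2 * sqrt l * ?a) \<le> 3 * exp (- \<kappa> / 2) * A t" by simp
  moreover have "norm (of_real (exp (- 2 / 3 * \<kappa>)) * G t * exp ((b - of_real l) * W t / of_real (sqrt p)))
      \<le> exp (- (2 / 3 * \<kappa> * ?a ^ 3)) * exp (3 / 2 * sqrt l * ?a)"
    unfolding norm_mult[of "of_real (exp (- 2 / 3 * \<kappa>)) * G t"] nG using sh by (intro mult_left_mono) auto
  ultimately show ?thesis by linarith
qed

lemma norm_V_le:
  assumes "b \<in> ball (of_real l) 1"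
  shows "norm (V b t) \<le> 6 * exp (- \<kappa> / 2) * A t / sqrt L"
proof -
  have "norm (V b t) = norm (exp (2 * H t)) * norm (of_real (exp (- 2 / 3 * \<kappa>)) * G t * exp ((b - of_real l) * W t / of_real (sqrt p))) / norm (W t)"
    unfolding V_def norm_mult norm_divide by simp
  also have "\<dots> \<le> 2 * (3 * exp (- \<kappa> / 2) * A t) / sqrt L"
    using norm_exp_2H_le[of t] norm_E_shift_le[OF assms, of t] norm_W_ge[of t] L_pos
    by (intro frac_le mult_mono) (auto simp: A_def)
  finally show ?thesis by simp
qed

text \<open>Independent of t in [0, 2 pi], as a Weierstrass majorant must be. The ratio exp (- (pi /
  r)) is the value of \<open>A\<close> at distance 2 pi, one step of \<open>shift\<close>.\<close>

definition A_sup :: "int \<Rightarrow> real" where "A_sup k = two_sided_power (exp (- (pi / r))) k"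

lemma A_sup_pos: "0 < A_sup k" by (simp add: A_sup_def two_sided_power_def)

lemma A_le_A_sup:
  assumes "t \<in> {0..2 * pi}"
  shows "A (shift t k) \<le> A_sup k"
proof -
  define m where "m = (if k \<ge> 0 then nat k else nat (- k - 1))"
  have "2 * pi * real m \<le> \<bar>shift t k\<bar>"
  proof (cases "k \<ge> 0")
    case True then show ?thesis using assms by (simp add: m_def)
  next
    case False
    then have "real m = - of_int k - 1" by (simp add: m_def)
    then have "2 * pi * real m = 2 * pi * (- of_int k - 1)" by (simp only:)
    also have "\<dots> = - (2 * pi * of_int k) - 2 * pi" by (simp add: algebra_simps)
    finally have "2 * pi * real m = - (2 * pi * of_int k) - 2 * pi" .
    then show ?thesis using assms by auto
  qed
  then have "2 * pi * real m / r \<le> \<bar>shift t k\<bar> / r" using r_pos by (intro divide_right_mono) auto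
  then have "A (shift t k) \<le> exp (real m * (- (pi / r)))"
    unfolding A_def using r_pos by (simp add: abs_divide field_simps)
  also have "\<dots> = A_sup k" unfolding exp_of_nat_mult by (simp add: A_sup_def two_sided_power_def m_def)
  finally show ?thesis .
qed

lemma exp_pi_r_less_one: "exp (- (pi / r)) < 1" using r_pos by simp

lemma has_sum_A_sup: "(A_sup has_sum (2 / (1 - exp (- (pi / r))))) UNIV"
  unfolding A_sup_def by (rule has_sum_two_sided_power) (use exp_pi_r_less_one in auto)

text \<open>Since 1 - exp (- x) >= x / (1 + x), summing an envelope over the points costs a factor
  O(1 + r), uniformly for small and large r.\<close>

lemma geometric_bound: "2 / (1 - exp (- (pi / r))) \<le> 2 * (1 + r / pi)"
proof -
  define x where "x = pi / r"
  have x: "x > 0" using r_pos by (simp add: x_def)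
  have "exp (- x) \<le> 1 / (1 + x)"
    using exp_ge_add_one_self[of x] x by (simp add: exp_minus divide_simps)
  then have "x / (1 + x) \<le> 1 - exp (- x)" using x by (simp add: field_simps)
  then have "2 / (1 - exp (- x)) \<le> 2 / (x / (1 + x))"
    using x by (intro divide_left_mono mult_pos_pos) auto
  also have "\<dots> = 2 * (1 + 1 / x)" using x by (simp add: field_simps)
  finally show ?thesis by (simp add: x_def)
qed

text \<open>The bound 6 exp (- \<kappa> / 2) / sqrt L for one factor V times the bound 1 / (2 sqrt
  L) for one determinant entry. There are 2 n factors V and two determinants of size n, so each V is
  paired with one entry.\<close>

definition "weight = 3 * exp (- \<kappa> / 2) / L"
definition "weight_sum = weight * (2 / (1 - exp (- (pi / r))))"

lemma weight_pos: "0 < weight" using L_pos by (simp add: weight_def)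

lemma has_sum_weight_A_sup: "((\<lambda>k. weight * A_sup k) has_sum weight_sum) UNIV"
  unfolding weight_sum_def by (rule has_sum_cmult_right[OF has_sum_A_sup])

lemma weight_sum_nonneg: "0 \<le> weight_sum"
  unfolding weight_sum_def using weight_pos exp_pi_r_less_one by simp

lemma r_le_L: "r \<le> L"
proof -
  have "l powr (1/4) \<le> l powr 1" using l_ge by (intro powr_mono) auto
  then show ?thesis using p_pos l_pos by (simp add: r_def L_def)
qed

text \<open>The factor O(1 + r) from the sum over points is paid for by the denominator L, because r
  <= L and L >= 2; this removes p from the bound.\<close>

lemma weight_sum_le: "weight_sum \<le> 9 * exp (- \<kappa> / 2)"
proof -
  have "weight_sum \<le> weight * (2 * (1 + r / pi))" unfolding weight_sum_def
    using geometric_bound weight_pos by (intro mult_left_mono) auto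
  also have "\<dots> = exp (- \<kappa> / 2) * (6 / L + 6 * (r / L) / pi)"
    using L_pos by (simp add: weight_def field_simps)
  also have "\<dots> \<le> exp (- \<kappa> / 2) * (6 / 2 + 6 * 1 / 1)"
  proof (intro mult_left_mono add_mono)
    show "6 / L \<le> 6 / 2" using L_ge by (intro divide_left_mono) auto
    have "r / L \<le> 1" using r_le_L L_pos by simp
    then show "6 * (r / L) / pi \<le> 6 * 1 / 1" using pi_gt3 r_pos L_pos by (intro frac_le mult_mono) auto
  qed auto
  finally show ?thesis by simp
qed

section \<open>The terms of D as series over tuples of integers\<close>

definition int_tuples :: "nat \<Rightarrow> (nat \<Rightarrow> int) set" where "int_tuples n = ({..<n} \<rightarrow>\<^sub>E UNIV)"

definition Term :: "complex \<Rightarrow> real \<Rightarrow> nat \<Rightarrow> (nat \<Rightarrow> int) \<times> (nat \<Rightarrow> int) \<Rightarrow> complex" where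
  "Term b t n x = (case x of (k, k') \<Rightarrow> 1 / (of_nat (fact n))\<^sup>2 *
     ((\<Prod>j<n. V b (shift t (k j)) * V b (shift t (k' j)))
     * Determinant.det (Matrix.mat n n (\<lambda>(i, j). 1 / (- W (shift t (k' i)) - W (shift t (k j)))))
     * Determinant.det (Matrix.mat n n (\<lambda>(i, j). 1 / (W (shift t (k i)) + W (shift t (k' j)))))))"

definition Term_bound :: "nat \<Rightarrow> (nat \<Rightarrow> int) \<times> (nat \<Rightarrow> int) \<Rightarrow> real" where
  "Term_bound n x = (case x of (k, k') \<Rightarrow> (\<Prod>j<n. weight * A_sup (k j)) * (\<Prod>j<n. weight * A_sup (k' j)))"

lemma norm_inverse_W_add_le: "norm (1 / (W t + W t')) \<le> 1 / (2 * sqrt L)"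
  using norm_W_add_ge[of t t'] L_pos unfolding norm_divide by (intro frac_le) auto

lemma norm_inverse_W_add_le': "norm (1 / (- W t - W t')) \<le> 1 / (2 * sqrt L)"
proof -
  have "1 / (- W t - W t') = - (1 / (W t + W t'))" by (metis minus_add_distrib minus_divide_right uminus_add_conv_diff diff_conv_add_uminus)
  then show ?thesis using norm_inverse_W_add_le[of t t'] by simp
qed

lemma norm_Term_le:
  assumes "b \<in> ball (of_real l) 1" "t \<in> {0..2 * pi}"
  shows "norm (Term b t n x) \<le> Term_bound n x"
proof -
  obtain k k' where x: "x = (k, k')" by (cases x)
  let ?c = "1 / (2 * sqrt L)"
  let ?P = "\<Prod>j<n. V b (shift t (k j)) * V b (shift t (k' j))"
  let ?D1 = "Determinant.det (Matrix.mat n n (\<lambda>(i, j). 1 / (- W (shift t (k' i)) - W (shift t (k j)))))"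
  let ?D2 = "Determinant.det (Matrix.mat n n (\<lambda>(i, j). 1 / (W (shift t (k i)) + W (shift t (k' j)))))"
  have c: "?c > 0" using L_pos by simp
  have d: "norm ?D1 \<le> fact n * ?c ^ n" "norm ?D2 \<le> fact n * ?c ^ n"
    using norm_inverse_W_add_le' norm_inverse_W_add_le by (intro norm_det_mat_le; blast)+
  have Vb: "norm (V b (shift t i)) \<le> 6 * exp (- \<kappa> / 2) / sqrt L * A_sup i" for i
  proof -
    have "norm (V b (shift t i)) \<le> 6 * exp (- \<kappa> / 2) / sqrt L * A (shift t i)"
      using norm_V_le[OF assms(1), of "shift t i"] by simp
    also have "\<dots> \<le> 6 * exp (- \<kappa> / 2) / sqrt L * A_sup i"
      using A_le_A_sup[OF assms(2)] L_pos by (intro mult_left_mono) auto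
    finally show ?thesis .
  qed
  have m: "6 * exp (- \<kappa> / 2) / sqrt L * a * ?c = weight * a" for a
  proof -
    have "sqrt L * sqrt L = L" using L_pos by simp
    then show ?thesis by (simp add: weight_def mult_ac)
  qed
  let ?B = "\<Prod>j<n. (6 * exp (- \<kappa> / 2) / sqrt L * A_sup (k j)) * (6 * exp (- \<kappa> / 2) / sqrt L * A_sup (k' j))"
  have "norm ?P \<le> (\<Prod>j<n. (6 * exp (- \<kappa> / 2) / sqrt L * A_sup (k j)) * (6 * exp (- \<kappa> / 2) / sqrt L * A_sup (k' j)))"
    unfolding prod_norm[symmetric] norm_mult
    by (intro prod_mono conjI mult_mono Vb) (use L_pos A_sup_pos in \<open>auto simp: less_imp_le\<close>)
  then have "norm (Term b t n x) \<le> 1 / (fact n)\<^sup>2 *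
      ((\<Prod>j<n. (6 * exp (- \<kappa> / 2) / sqrt L * A_sup (k j)) * (6 * exp (- \<kappa> / 2) / sqrt L * A_sup (k' j)))
        * (fact n * ?c ^ n) * (fact n * ?c ^ n))"
  proof -
    assume P: "norm ?P \<le> ?B"
    have B: "0 \<le> ?B" using P norm_ge_zero order_trans by blast
    have F: "0 \<le> (fact n * ?c ^ n :: real)" using c by (intro mult_nonneg_nonneg) auto
    have "norm ?P * norm ?D1 * norm ?D2 \<le> ?B * (fact n * ?c ^ n) * (fact n * ?c ^ n)"
      by (intro mult_mono P d B F mult_nonneg_nonneg norm_ge_zero)
    then have "1 / (fact n)\<^sup>2 * (norm ?P * norm ?D1 * norm ?D2) \<le> 1 / (fact n)\<^sup>2 * (?B * (fact n * ?c ^ n) * (fact n * ?c ^ n))"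
      by (rule mult_left_mono) simp
    moreover have "norm (Term b t n x) = 1 / (fact n)\<^sup>2 * (norm ?P * norm ?D1 * norm ?D2)"
      unfolding Term_def x prod.case by (simp only: norm_mult norm_divide norm_power norm_one norm_of_nat of_nat_fact norm_fact)
    ultimately show ?thesis by simp
  qed
  also have "\<dots> = (\<Prod>j<n. (6 * exp (- \<kappa> / 2) / sqrt L * A_sup (k j)) * (6 * exp (- \<kappa> / 2) / sqrt L * A_sup (k' j))) * ?c ^ n * ?c ^ n"
    by (simp add: power2_eq_square)
  also have "\<dots> = (\<Prod>j<n. (6 * exp (- \<kappa> / 2) / sqrt L * A_sup (k j) * ?c) * (6 * exp (- \<kappa> / 2) / sqrt L * A_sup (k' j) * ?c))"
    by (simp only: prod.distrib prod_constant card_lessThan mult_ac)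
  also have "\<dots> = Term_bound n x" unfolding m Term_bound_def x by (simp add: prod.distrib)
  finally show ?thesis .
qed

lemma has_sum_Term_bound: "(Term_bound n has_sum (weight_sum\<^sup>2) ^ n) (int_tuples n \<times> int_tuples n)"
proof -
  have 1: "((\<lambda>g. \<Prod>j<n. weight * A_sup (g j)) has_sum weight_sum ^ n) (int_tuples n)"
    unfolding int_tuples_def by (rule has_sum_prod_PiE[OF has_sum_weight_A_sup]) (use weight_pos A_sup_pos in auto)
  have nn: "0 \<le> (\<Prod>j<n. weight * A_sup (g j))" for g
    by (intro prod_nonneg) (use weight_pos A_sup_pos in \<open>auto simp: less_imp_le\<close>)
  have "((\<lambda>(k, k'). (\<Prod>j<n. weight * A_sup (k j)) * (\<Prod>j<n. weight * A_sup (k' j))) has_sum weight_sum ^ n * weight_sum ^ n) (int_tuples n \<times> int_tuples n)"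
    by (rule has_sum_times_nonneg[OF 1 1 nn nn])
  then show ?thesis by (simp add: Term_bound_def[abs_def] power2_eq_square power_mult_distrib)
qed

definition D_term :: "complex \<Rightarrow> real \<Rightarrow> nat \<Rightarrow> complex" where
  "D_term b t n = (\<Sum>\<^sub>\<infinity>x\<in>int_tuples n \<times> int_tuples n. Term b t n x)"

lemma norm_D_term_le:
  assumes "b \<in> ball (of_real l) 1" "t \<in> {0..2 * pi}"
  shows "norm (D_term b t n) \<le> (weight_sum\<^sup>2) ^ n"
  using norm_infsum_le_bound(2)[OF norm_Term_le[OF assms] has_sum_imp_summable[OF has_sum_Term_bound]]
    infsumI[OF has_sum_Term_bound] by (simp add: D_term_def)

lemma continuous_on_Term: "continuous_on S (\<lambda>t. Term b t n x)"
proof -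
  have "continuous_on S (\<lambda>t. V b (t + a))" "continuous_on S (\<lambda>t. W (t + a))" for a
    by (rule continuous_on_compose2[OF continuous_on_V[of UNIV]] continuous_on_compose2[OF continuous_on_W[of UNIV]];
        auto intro!: continuous_intros)+
  then show ?thesis
    unfolding Term_def case_prod_unfold
    by (intro continuous_intros continuous_on_det_mat[unfolded case_prod_unfold]) (use W_nonzero in auto)
qed

lemma continuous_on_D_term:
  assumes "b \<in> ball (of_real l) 1"
  shows "continuous_on {0..2 * pi} (\<lambda>t. D_term b t n)"
  unfolding D_term_def
  by (rule continuous_on_infsum[OF continuous_on_Term norm_Term_le[OF assms] has_sum_imp_summable[OF has_sum_Term_bound]])

lemma holomorphic_on_Term: "(\<lambda>b. Term b t n x) holomorphic_on S"
  unfolding Term_def case_prod_unfold V_def using W_nonzero p_pos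
  by (intro holomorphic_intros) auto

lemma holomorphic_on_D_term:
  assumes "t \<in> {0..2 * pi}"
  shows "(\<lambda>b. D_term b t n) holomorphic_on ball (of_real l) 1"
  unfolding D_term_def
  by (rule holomorphic_on_infsum[OF _ holomorphic_on_Term norm_Term_le[OF _ assms] has_sum_imp_summable[OF has_sum_Term_bound]]) auto

section \<open>The factor C on the contour\<close>

definition C_ext :: "complex \<Rightarrow> complex \<Rightarrow> complex" where
  "C_ext b z = exp (- (b / of_real (sqrt p * sqrt (2 * pi))) * polylog (3/2) z
     - of_real (1 / (p powr (3/2) * sqrt (2 * pi))) * polylog (5/2) z + 2 * B_fun z z)"

lemma C_fun_eq_C_ext: "C_fun p 1 b z = C_ext (of_real b) z"
  using p_pos by (simp add: C_fun_def C_ext_def powr_half_sqrt)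

lemma sqrt_2pi_ge: "2 \<le> sqrt (2 * pi)"
  using pi_gt3 by (intro real_le_rsqrt) auto

lemma inverse_sqrt_p_le: "1 / sqrt p \<le> sqrt l" "1 / p \<le> l"
proof -
  show 1: "1 / p \<le> l" using pl_ge p_pos by (simp add: field_simps)
  show "1 / sqrt p \<le> sqrt l"
    using real_sqrt_le_mono[OF 1] by (simp add: real_sqrt_divide)
qed

lemma norm_Z_le_half: "norm (Z t) \<le> 1/2" using norm_Z[of t] \<rho>_small(3) by simp

text \<open>Because 1 / p <= l, the coefficients of both polylogarithms are at most of order l^(3/2)
  = \<kappa>, while the polylogarithms and B are O(\<rho>). The exponent is therefore at most 4
  \<kappa> \<rho>.\<close>

lemma norm_C_ext_minus_one_le:
  assumes "b \<in> ball (of_real l) 1"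
  shows "norm (C_ext b (Z t) - 1) \<le> 8 * (\<kappa> * \<rho>)"
proof -
  let ?z = "Z t"
  have nb: "norm b \<le> 2 * l"
  proof -
    have "norm (b - of_real l) \<le> 1" using assms by (simp add: dist_norm norm_minus_commute)
    then have "norm b \<le> 1 + norm (of_real l :: complex)" using norm_triangle_sub[of b "of_real l"] by simp
    then show ?thesis using l_ge by simp
  qed
  have Li: "norm (polylog s ?z) \<le> 2 * \<rho>" if "s \<ge> 0" for s
    using norm_polylog_le_double[OF that norm_Z_le_half[of t]] norm_Z[of t] by simp
  have 1: "norm (b / of_real (sqrt p * sqrt (2 * pi)) * polylog (3/2) ?z) \<le> 2 * (\<kappa> * \<rho>)"
  proof -
    have "norm (b / of_real (sqrt p * sqrt (2 * pi))) = norm b * (1 / sqrt p) * (1 / sqrt (2 * pi))"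
      using p_pos by (simp add: norm_divide norm_mult)
    also have "\<dots> \<le> (2 * l) * sqrt l * (1 / 2)"
      using nb inverse_sqrt_p_le sqrt_2pi_ge l_pos p_pos by (intro mult_mono divide_left_mono) auto
    also have "\<dots> = \<kappa>" by (simp add: \<kappa>_eq)
    finally have "norm (b / of_real (sqrt p * sqrt (2 * pi))) * norm (polylog (3/2) ?z) \<le> \<kappa> * (2 * \<rho>)"
      using Li[of "3/2"] \<kappa>_ge by (intro mult_mono) auto
    also have "\<kappa> * (2 * \<rho>) = 2 * (\<kappa> * \<rho>)" by simp
    finally show ?thesis unfolding norm_mult .
  qed
  have 2: "norm (of_real (1 / (p powr (3/2) * sqrt (2 * pi))) * polylog (5/2) ?z) \<le> \<kappa> * \<rho>"
  proof -
    have "p powr (1 + 1/2) = p powr 1 * p powr (1/2)" by (rule powr_add)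
    then have "p powr (3/2) = p * sqrt p" using p_pos by (simp add: powr_half_sqrt)
    then have "1 / (p powr (3/2) * sqrt (2 * pi)) = (1 / p) * (1 / sqrt p) * (1 / sqrt (2 * pi))" by simp
    also have "\<dots> \<le> l * sqrt l * (1 / 2)"
      using inverse_sqrt_p_le sqrt_2pi_ge l_pos p_pos by (intro mult_mono divide_left_mono) auto
    finally have "1 / (p powr (3/2) * sqrt (2 * pi)) \<le> \<kappa> / 2" by (simp add: \<kappa>_eq)
    moreover have "0 \<le> 1 / (p powr (3/2) * sqrt (2 * pi))" by simp
    ultimately have "norm (complex_of_real (1 / (p powr (3/2) * sqrt (2 * pi)))) \<le> \<kappa> / 2"
      unfolding norm_of_real by linarith
    then have "norm (complex_of_real (1 / (p powr (3/2) * sqrt (2 * pi)))) * norm (polylog (5/2) ?z) \<le> \<kappa> / 2 * (2 * \<rho>)"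
      using Li[of "5/2"] \<kappa>_ge by (intro mult_mono) auto
    also have "\<kappa> / 2 * (2 * \<rho>) = \<kappa> * \<rho>" by simp
    finally show ?thesis unfolding norm_mult .
  qed
  have 3: "norm (2 * B_fun ?z ?z) \<le> \<kappa> * \<rho>"
    using norm_B_fun_le[OF norm_Z_le_half[of t]] norm_Z[of t] \<rho>_small(2) by (simp add: norm_mult)
  have "norm (- (b / of_real (sqrt p * sqrt (2 * pi))) * polylog (3/2) ?z
     - of_real (1 / (p powr (3/2) * sqrt (2 * pi))) * polylog (5/2) ?z + 2 * B_fun ?z ?z)
    \<le> norm (- (b / of_real (sqrt p * sqrt (2 * pi))) * polylog (3/2) ?z)
      + norm (of_real (1 / (p powr (3/2) * sqrt (2 * pi))) * polylog (5/2) ?z) + norm (2 * B_fun ?z ?z)"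
    by (intro norm_triangle_le add_right_mono norm_triangle_ineq4)
  also have "\<dots> \<le> 4 * (\<kappa> * \<rho>)" using 1 2 3 by (simp add: norm_mult)
  finally show ?thesis
    unfolding C_ext_def using norm_exp_minus_one_le[of _ "4 * (\<kappa> * \<rho>)"] \<rho>_small(1) by simp
qed

lemma norm_C_ext_le:
  assumes "b \<in> ball (of_real l) 1"
  shows "norm (C_ext b (Z t)) \<le> 2"
  using norm_triangle_ineq2[of "C_ext b (Z t)" 1] norm_C_ext_minus_one_le[OF assms, of t] \<rho>_small(1) by simp

lemma holomorphic_on_C_ext: "(\<lambda>b. C_ext b z) holomorphic_on S"
  unfolding C_ext_def by (intro holomorphic_intros) (use p_pos in auto)

lemma holomorphic_on_C_ext_z: "C_ext b holomorphic_on ball 0 (1/2)"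
  unfolding C_ext_def
  by (intro holomorphic_intros holomorphic_on_subset[OF holomorphic_on_polylog] holomorphic_on_B_fun)
    (use p_pos in auto)

lemma continuous_on_C_ext: "continuous_on S (\<lambda>t. C_ext b (Z t))"
  by (rule continuous_on_compose2[OF holomorphic_on_imp_continuous_on[OF holomorphic_on_C_ext_z] continuous_on_Z])
    (use norm_Z \<rho>_small(3) in auto)

lemma C_ext_0: "C_ext b 0 = 1"
proof -
  have "B_fun 0 0 = 0" using norm_B_fun_le[of 0] by simp
  then show ?thesis by (simp add: C_ext_def)
qed

section \<open>The distribution function as an integral over the angle t\<close>

lemma contour_integral_Z:
  "contour_integral (circlepath 0 \<rho>) (\<lambda>z. F z / z) = \<i> * integral {0..2 * pi} (\<lambda>t. F (Z t))"
proof -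
  have "contour_integral (circlepath 0 \<rho>) (\<lambda>z. F z / z) =
      integral {0..2 * pi} (\<lambda>t. F (0 + of_real \<rho> * cis t) / (0 + of_real \<rho> * cis t) * of_real \<rho> * \<i> * cis t)"
    unfolding circlepath_def by (rule contour_integral_part_circlepath_eq) simp
  also have "\<dots> = integral {0..2 * pi} (\<lambda>t. \<i> * F (Z t))"
    using \<rho>_pos by (simp add: Z_def mult_ac)
  finally show ?thesis by simp
qed

lemma integral_C_ext: "integral {0..2 * pi} (\<lambda>t. C_ext b (Z t)) = 2 * of_real pi"
proof -
  have "((\<lambda>u. C_ext b u / (u - 0)) has_contour_integral 2 * of_real pi * \<i> * C_ext b 0) (circlepath 0 \<rho>)"
    by (rule Cauchy_integral_circlepath_simple[OF holomorphic_on_subset[OF holomorphic_on_C_ext_z]])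
      (use \<rho>_pos \<rho>_small(3) in auto)
  then have "contour_integral (circlepath 0 \<rho>) (\<lambda>u. C_ext b u / u) = 2 * of_real pi * \<i>"
    by (simp add: C_ext_0 contour_integral_unique)
  then show ?thesis unfolding contour_integral_Z by simp
qed

lemma h_fun_shift: "h_fun (W (shift t k)) (Z t) = H (shift t k)"
  by (simp add: H_def Z_periodic)

lemma V_of_real:
  "exp (2 * h_fun (W (shift t k)) (Z t)) * E_fun sg p 0 1 b (W (shift t k)) / W (shift t k)
    = V (of_real b) (shift t k)"
  unfolding h_fun_shift E_fun_shift[of sg b] E_fun_eq V_def by simp

lemma D_summand_eq_Term:
  "1 / (of_nat (fact n))\<^sup>2 * D_summand p 0 1 b (Z t) n
     (restrict (\<lambda>j. W (shift t (k j))) {..<n}) (restrict (\<lambda>j. W (shift t (k' j))) {..<n})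
   = Term (of_real b) t n (k, k')"
proof -
  let ?u = "restrict (\<lambda>j. W (shift t (k j))) {..<n}"
  let ?v = "restrict (\<lambda>j. W (shift t (k' j))) {..<n}"
  have "(\<Prod>j<n. exp (2 * h_fun (?u j) (Z t) + 2 * h_fun (?v j) (Z t))
             * E_fun 1 p 0 1 b (?u j) * E_fun (-1) p 0 1 b (?v j) / (?u j * ?v j))
      = (\<Prod>j<n. V (of_real b) (shift t (k j)) * V (of_real b) (shift t (k' j)))"
  proof (rule prod.cong[OF refl])
    fix j assume "j \<in> {..<n}"
    then show "exp (2 * h_fun (?u j) (Z t) + 2 * h_fun (?v j) (Z t))
             * E_fun 1 p 0 1 b (?u j) * E_fun (-1) p 0 1 b (?v j) / (?u j * ?v j)
        = V (of_real b) (shift t (k j)) * V (of_real b) (shift t (k' j))"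
      unfolding V_of_real[of t "k j" 1 b, symmetric] V_of_real[of t "k' j" "-1" b, symmetric]
      by (simp add: exp_add)
  qed
  moreover have "Matrix.mat n n (\<lambda>(i, j). 1 / (- ?v i - ?u j)) =
     Matrix.mat n n (\<lambda>(i, j). 1 / (- W (shift t (k' i)) - W (shift t (k j))))"
    by (rule eq_matI) auto
  moreover have "Matrix.mat n n (\<lambda>(i, j). 1 / (?u i + ?v j)) =
     Matrix.mat n n (\<lambda>(i, j). 1 / (W (shift t (k i)) + W (shift t (k' j))))"
    by (rule eq_matI) auto
  ultimately show ?thesis unfolding D_summand_def Term_def prod.case by simp
qed

lemma infsum_D_summand:
  "1 / (of_nat (fact n))\<^sup>2 *
        (\<Sum>\<^sub>\<infinity>(u, v)\<in>({..<n} \<rightarrow>\<^sub>E L_set (Z t)) \<times> ({..<n} \<rightarrow>\<^sub>E L_set (Z t)). D_summand p 0 1 b (Z t) n u v)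
   = D_term (of_real b) t n"
proof -
  let ?f = "\<lambda>k::int. W (shift t k)"
  let ?g = "\<lambda>k. restrict (\<lambda>j. ?f (k j)) {..<n}"
  have "bij_betw ?f UNIV (L_set (Z t))"
    unfolding W_def Z_def \<rho>_def by (rule bij_betw_saddle_point[OF L_pos])
  then have g: "bij_betw ?g (int_tuples n) ({..<n} \<rightarrow>\<^sub>E L_set (Z t))"
    unfolding int_tuples_def by (rule bij_betw_PiE)
  have "bij_betw (map_prod ?g ?g) (int_tuples n \<times> int_tuples n) (({..<n} \<rightarrow>\<^sub>E L_set (Z t)) \<times> ({..<n} \<rightarrow>\<^sub>E L_set (Z t)))"
    by (rule bij_betw_map_prod[OF g g])
  note reindex = infsum_reindex_bij_betw[OF this]
  let ?c = "1 / (of_nat (fact n))\<^sup>2 :: complex"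
  let ?D = "\<lambda>(u, v). D_summand p 0 1 b (Z t) n u v"
  have "?c * infsum ?D (({..<n} \<rightarrow>\<^sub>E L_set (Z t)) \<times> ({..<n} \<rightarrow>\<^sub>E L_set (Z t)))
      = ?c * (\<Sum>\<^sub>\<infinity>x\<in>int_tuples n \<times> int_tuples n. ?D (map_prod ?g ?g x))"
    by (simp only: reindex)
  also have "\<dots> = (\<Sum>\<^sub>\<infinity>x\<in>int_tuples n \<times> int_tuples n. ?c * ?D (map_prod ?g ?g x))"
    by (rule infsum_cmult_right'[symmetric])
  also have "\<dots> = (\<Sum>\<^sub>\<infinity>x\<in>int_tuples n \<times> int_tuples n. Term (of_real b) t n x)"
  proof (rule infsum_cong)
    fix x :: "(nat \<Rightarrow> int) \<times> (nat \<Rightarrow> int)"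
    obtain k k' where x: "x = (k, k')" by (cases x)
    show "?c * ?D (map_prod ?g ?g x) = Term (of_real b) t n x"
      unfolding x map_prod_simp prod.case by (rule D_summand_eq_Term)
  qed
  finally show ?thesis unfolding D_term_def .
qed

lemma weight_sum_square_le: "weight_sum \<le> 1/2" "weight_sum\<^sup>2 \<le> 1/4"
proof -
  \<comment> \<open>From \<kappa> >= 12 one gets exp (\<kappa> / 2) >= exp 6 >= 64, and 9 / 64 <= 1
    / 2.\<close>
  have "(2::real) ^ 6 \<le> exp 1 ^ 6"
    using exp_ge_add_one_self[of "1::real"] by (intro power_mono) auto
  then have "64 \<le> exp (6::real)" by (simp flip: exp_of_nat_mult)
  also have "\<dots> \<le> exp (\<kappa> / 2)" using \<kappa>_ge by simp
  finally have "9 * exp (- \<kappa> / 2) \<le> 1/2" by (simp add: exp_minus field_simps)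
  then show 1: "weight_sum \<le> 1/2" using weight_sum_le by simp
  show "weight_sum\<^sup>2 \<le> 1/4" using power_mono[OF 1 weight_sum_nonneg, of 2] by (simp add: power2_eq_square)
qed

lemma has_sum_weight_sum_powers: "((\<lambda>n. (weight_sum\<^sup>2) ^ n) has_sum ((weight_sum\<^sup>2)\<^sup>2 / (1 - weight_sum\<^sup>2))) {2..}"
proof -
  have "((\<lambda>n. (weight_sum\<^sup>2)\<^sup>2 * (weight_sum\<^sup>2) ^ n) has_sum ((weight_sum\<^sup>2)\<^sup>2 / (1 - weight_sum\<^sup>2))) UNIV"
    by (rule has_sum_geometric) (use weight_sum_square_le in auto)
  moreover have "bij_betw (\<lambda>n. n + 2) UNIV {2::nat..}"
    by (rule bij_betwI[of _ _ _ "\<lambda>n. n - 2"]) auto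
  ultimately show ?thesis
    using has_sum_reindex_bij_betw[of "\<lambda>n. n + 2" UNIV "{2..}" "\<lambda>n. (weight_sum\<^sup>2) ^ n"]
    by (simp add: power_add mult.commute)
qed

definition D_rest :: "complex \<Rightarrow> real \<Rightarrow> complex" where
  "D_rest b t = (\<Sum>\<^sub>\<infinity>n\<in>{2..}. D_term b t n)"

lemma norm_D_rest_le:
  assumes "b \<in> ball (of_real l) 1" "t \<in> {0..2 * pi}"
  shows "norm (D_rest b t) \<le> 2 * weight_sum ^ 4"
proof -
  have "norm (D_rest b t) \<le> (weight_sum\<^sup>2)\<^sup>2 / (1 - weight_sum\<^sup>2)"
    unfolding D_rest_def infsumI[OF has_sum_weight_sum_powers, symmetric]
    by (rule norm_infsum_le_bound(2)[OF norm_D_term_le[OF assms] has_sum_imp_summable[OF has_sum_weight_sum_powers]])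
  also have "\<dots> \<le> (weight_sum\<^sup>2)\<^sup>2 / (1/2)" using weight_sum_square_le by (intro divide_left_mono) auto
  finally show ?thesis by (simp flip: power_mult)
qed

lemma continuous_on_D_rest:
  assumes "b \<in> ball (of_real l) 1"
  shows "continuous_on {0..2 * pi} (D_rest b)"
  unfolding D_rest_def[abs_def]
  by (rule continuous_on_infsum[OF continuous_on_D_term[OF assms] norm_D_term_le[OF assms] has_sum_imp_summable[OF has_sum_weight_sum_powers]])

lemma holomorphic_on_D_rest:
  assumes "t \<in> {0..2 * pi}"
  shows "(\<lambda>b. D_rest b t) holomorphic_on ball (of_real l) 1"
  unfolding D_rest_def
  by (rule holomorphic_on_infsum[OF _ holomorphic_on_D_term[OF assms] norm_D_term_le[OF _ assms] has_sum_imp_summable[OF has_sum_weight_sum_powers]]) auto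

lemma D_term_0: "D_term b t 0 = 1"
  by (simp add: D_term_def int_tuples_def Term_def)

lemma D_fun_eq:
  assumes "of_real b \<in> ball (of_real l :: complex) 1" "t \<in> {0..2 * pi}"
  shows "D_fun p 0 1 b (Z t) = 1 + (D_term (of_real b) t 1 + D_rest (of_real b) t)"
proof -
  have sm: "(\<lambda>n. (weight_sum\<^sup>2) ^ n) summable_on (UNIV::nat set)"
    using has_sum_geometric[of "weight_sum\<^sup>2" 1] weight_sum_square_le has_sum_imp_summable by fastforce
  have "D_fun p 0 1 b (Z t) = (\<Sum>n. D_term (of_real b) t n)"
    unfolding D_fun_def infsum_D_summand ..
  also have "\<dots> = (\<Sum>\<^sub>\<infinity>n. D_term (of_real b) t n)"
    by (rule suminf_eq_infsum[OF norm_D_term_le[OF assms] sm])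
  also have "(UNIV :: nat set) = {0, 1} \<union> {2..}" by auto
  also have "(\<Sum>\<^sub>\<infinity>n\<in>{0, 1} \<union> {2..}. D_term (of_real b) t n) = (\<Sum>\<^sub>\<infinity>n\<in>{0, 1}. D_term (of_real b) t n) + D_rest (of_real b) t"
    unfolding D_rest_def
    by (rule infsum_Un_disjoint)
      (auto intro: norm_infsum_le_bound(1)[OF norm_D_term_le[OF assms] has_sum_imp_summable[OF has_sum_weight_sum_powers]])
  also have "(\<Sum>\<^sub>\<infinity>n\<in>{0, 1}. D_term (of_real b) t n) = 1 + D_term (of_real b) t 1"
    by (simp add: D_term_0)
  finally show ?thesis by (simp add: add.assoc)
qed

definition \<Psi> :: "complex \<Rightarrow> real \<Rightarrow> complex" where
  "\<Psi> b t = C_ext b (Z t) * D_term b t 1 + C_ext b (Z t) * D_rest b t"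

lemma continuous_on_\<Psi>:
  assumes "b \<in> ball (of_real l) 1"
  shows "continuous_on {0..2 * pi} (\<Psi> b)"
  unfolding \<Psi>_def[abs_def]
  by (intro continuous_intros continuous_on_C_ext continuous_on_D_term continuous_on_D_rest assms)

lemma cdf_eq:
  assumes "explicit_one_point_law M H'" "of_real b \<in> ball (of_real l :: complex) 1"
  shows "complex_of_real (one_point_cdf M H' p 0 1 b) = 1 + integral {0..2 * pi} (\<Psi> (of_real b)) / (2 * of_real pi)"
proof -
  have "0 < \<rho>" "\<rho> < 1" using \<rho>_pos \<rho>_small(3) by auto
  then have "complex_of_real (one_point_cdf M H' p 0 1 b) =
          1 / (2 * of_real pi * \<i>) *
          contour_integral (circlepath 0 \<rho>) (\<lambda>z. C_fun p 1 b z * D_fun p 0 1 b z / z)"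
    using assms(1) p_pos unfolding explicit_one_point_law_def by simp
  also have "contour_integral (circlepath 0 \<rho>) (\<lambda>z. C_fun p 1 b z * D_fun p 0 1 b z / z)
      = \<i> * integral {0..2 * pi} (\<lambda>t. C_fun p 1 b (Z t) * D_fun p 0 1 b (Z t))"
    by (rule contour_integral_Z)
  also have "integral {0..2 * pi} (\<lambda>t. C_fun p 1 b (Z t) * D_fun p 0 1 b (Z t))
      = integral {0..2 * pi} (\<lambda>t. C_ext (of_real b) (Z t) + \<Psi> (of_real b) t)"
    by (rule integral_cong) (simp add: C_fun_eq_C_ext D_fun_eq[OF assms(2)] \<Psi>_def algebra_simps)
  also have "\<dots> = integral {0..2 * pi} (\<lambda>t. C_ext (of_real b) (Z t)) + integral {0..2 * pi} (\<Psi> (of_real b))"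
    by (intro Henstock_Kurzweil_Integration.integral_add integrable_continuous_interval continuous_on_C_ext continuous_on_\<Psi> assms(2))
  finally have eq: "complex_of_real (one_point_cdf M H' p 0 1 b) =
      1 / (2 * of_real pi * \<i>) * (\<i> * (2 * of_real pi + integral {0..2 * pi} (\<Psi> (of_real b))))"
    unfolding integral_C_ext .
  have "1 / (2 * of_real pi * \<i>) * (\<i> * (2 * of_real pi + I)) = 1 + I / (2 * of_real pi)" for I
    by (simp add: field_simps)
  with eq show ?thesis by (simp only:)
qed

section \<open>The one-particle kernel and its derivative in b\<close>

definition K :: "complex \<Rightarrow> real \<Rightarrow> int \<times> int \<Rightarrow> complex" where
  "K b t x = C_ext b (Z t) * (V b (shift t (fst x)) * V b (shift t (snd x))
     * (1 / (- W (shift t (snd x)) - W (shift t (fst x))))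
     * (1 / (W (shift t (fst x)) + W (shift t (snd x)))))"

lemma Term_1:
  "Term b t 1 (k, k') = V b (shift t (k 0)) * V b (shift t (k' 0))
     * (1 / (- W (shift t (k' 0)) - W (shift t (k 0))))
     * (1 / (W (shift t (k 0)) + W (shift t (k' 0))))"
  unfolding Term_def prod.case det_mat_expand by simp

lemma bij_betw_int_tuples_1:
  "bij_betw (\<lambda>(a, b). (restrict (\<lambda>_. a) {..<1}, restrict (\<lambda>_. b) {..<1})) (UNIV \<times> UNIV) (int_tuples 1 \<times> int_tuples 1)"
proof (rule bij_betwI[where g = "\<lambda>(k, k'). (k 0, k' 0)"])
  have mem: "restrict (\<lambda>_. a) {..<1} \<in> int_tuples 1" for a by (simp add: int_tuples_def)
  have ev: "restrict (\<lambda>_. a) {..<1} (0::nat) = a" for a :: int by simp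
  show "(\<lambda>(a, b). (restrict (\<lambda>_. a) {..<1}, restrict (\<lambda>_. b) {..<1})) \<in> UNIV \<times> UNIV \<rightarrow> int_tuples 1 \<times> int_tuples 1"
    unfolding Pi_iff case_prod_unfold by (intro ballI SigmaI mem)
  show "(\<lambda>(k, k'). (k 0, k' 0)) \<in> int_tuples 1 \<times> int_tuples 1 \<rightarrow> UNIV \<times> UNIV"
    unfolding Pi_iff case_prod_unfold by (intro ballI SigmaI UNIV_I)
  fix x :: "int \<times> int"
  show "(case (case x of (a, b) \<Rightarrow> (restrict (\<lambda>_. a) {..<1::nat}, restrict (\<lambda>_. b) {..<1::nat})) of (k, k') \<Rightarrow> (k 0, k' 0)) = x"
    by (cases x) (simp only: prod.case ev)
next
  have inv: "restrict (\<lambda>_. k 0) {..<1} = k" if "k \<in> int_tuples 1" for k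
  proof
    fix j :: nat
    show "restrict (\<lambda>_. k 0) {..<1} j = k j"
      using PiE_arb[of k "{..<1}" "\<lambda>_. UNIV" j] that by (cases "j = 0") (auto simp: int_tuples_def)
  qed
  fix y assume y: "y \<in> int_tuples 1 \<times> int_tuples 1"
  then obtain k k' where k: "y = (k, k')" "k \<in> int_tuples 1" "k' \<in> int_tuples 1" by blast
  show "(case (case y of (k, k') \<Rightarrow> (k 0, k' 0)) of (a, b) \<Rightarrow> (restrict (\<lambda>_. a) {..<1}, restrict (\<lambda>_. b) {..<1})) = y"
    unfolding k(1) prod.case by (simp only: inv[OF k(2)] inv[OF k(3)])
qed

lemma K_eq_Term:
  "K b t (a, a') = C_ext b (Z t) * Term b t 1 (restrict (\<lambda>_. a) {..<1}, restrict (\<lambda>_. a') {..<1})"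
  unfolding Term_1 by (simp add: K_def)

lemma C_ext_D_term_1: "C_ext b (Z t) * D_term b t 1 = (\<Sum>\<^sub>\<infinity>x\<in>UNIV \<times> UNIV. K b t x)"
proof -
  have "C_ext b (Z t) * D_term b t 1 = (\<Sum>\<^sub>\<infinity>x\<in>int_tuples 1 \<times> int_tuples 1. C_ext b (Z t) * Term b t 1 x)"
    unfolding D_term_def by (rule infsum_cmult_right'[symmetric])
  also have "\<dots> = (\<Sum>\<^sub>\<infinity>x\<in>UNIV \<times> UNIV. C_ext b (Z t) * Term b t 1 (case x of (a, b) \<Rightarrow> (restrict (\<lambda>_. a) {..<1}, restrict (\<lambda>_. b) {..<1})))"
    by (rule infsum_reindex_bij_betw[OF bij_betw_int_tuples_1, symmetric])
  also have "\<dots> = (\<Sum>\<^sub>\<infinity>x\<in>UNIV \<times> UNIV. K b t x)"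
  proof (rule infsum_cong)
    fix x :: "int \<times> int"
    show "C_ext b (Z t) * Term b t 1 (case x of (a, b) \<Rightarrow> (restrict (\<lambda>_. a) {..<1}, restrict (\<lambda>_. b) {..<1})) = K b t x"
      by (cases x) (simp only: K_eq_Term prod.case)
  qed
  finally show ?thesis .
qed

definition K_bound :: "int \<times> int \<Rightarrow> real" where
  "K_bound x = 2 * Term_bound 1 (restrict (\<lambda>_. fst x) {..<1}, restrict (\<lambda>_. snd x) {..<1})"

lemma norm_K_le:
  assumes "b \<in> ball (of_real l) 1" "t \<in> {0..2 * pi}"
  shows "norm (K b t x) \<le> K_bound x"
proof (cases x)
  case (Pair a a')
  have "norm (C_ext b (Z t)) * norm (Term b t 1 (restrict (\<lambda>_. a) {..<1}, restrict (\<lambda>_. a') {..<1}))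
    \<le> 2 * Term_bound 1 (restrict (\<lambda>_. a) {..<1}, restrict (\<lambda>_. a') {..<1})"
    by (intro mult_mono norm_C_ext_le norm_Term_le assms) auto
  then show ?thesis by (simp only: Pair K_eq_Term norm_mult K_bound_def fst_conv snd_conv)
qed

lemma summable_K_bound: "K_bound summable_on (UNIV \<times> UNIV)"
proof -
  have "(\<lambda>x. Term_bound 1 (case x of (a, b) \<Rightarrow> (restrict (\<lambda>_. a) {..<1}, restrict (\<lambda>_. b) {..<1}))) summable_on (UNIV \<times> UNIV)"
    using summable_on_reindex_bij_betw[OF bij_betw_int_tuples_1, of "Term_bound 1"] has_sum_imp_summable[OF has_sum_Term_bound[of 1]] by blast
  then show ?thesis unfolding K_bound_def case_prod_unfold by (rule summable_on_cmult_right)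
qed

text \<open>The differentiated kernel at the saddle point w = w' = - sqrt L: the exponentials give
  exp (- 4 \<kappa> / 3), the factor 1 / (w w') is 1 / L, the determinants give - 1 / (4 L), and the
  derivative brings down - 2 sqrt L / sqrt p.\<close>

definition "prefactor = exp (- 4 / 3 * \<kappa>) / (2 * L * sqrt L * sqrt p)"
definition g :: "real \<Rightarrow> real" where "g t = exp (- (t / r)\<^sup>2)"
text \<open>A round bound for the constants 5328 and 171 that are collected in
  \<open>kernel_bound\<close>.\<close>

definition "\<epsilon> = 6000 * (1 / sqrt \<kappa> + \<kappa> * \<rho>)"

text \<open>With d = w1 + w2, the leading part d / s of the logarithmic derivative cancels one of
  the two Cauchy denominators, and the polylogarithm is left as the relative correction 1 - Li / (c
  d).\<close>

lemma kernel_algebra: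
  fixes w1 w2 d :: complex
  assumes "w1 \<noteq> 0" "w2 \<noteq> 0" "d \<noteq> 0" "s \<noteq> 0" "c \<noteq> 0"
  shows "C * ((E1 * (e * G1) / w1) * (E2 * (e * G2) / w2) * (1 / (- d)) * (1 / d)) * (d / s - Li / (s * c))
    = G1 * G2 * (C * (E1 * E2) * (1 - Li / (c * d))) * (e * e * (- 1 / (w1 * w2 * d * s)))"
  using assms by (simp add: field_simps)

lemma V_shift: "V b t = V (of_real l) t * exp ((b - of_real l) * (W t / of_real (sqrt p)))"
  by (simp add: V_def)

lemma C_ext_shift: "C_ext b z = C_ext (of_real l) z * exp ((b - of_real l) * (- polylog (3/2) z / of_real (sqrt p * sqrt (2 * pi))))"
  unfolding C_ext_def exp_add[symmetric] by (simp add: algebra_simps diff_divide_distrib)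

text \<open>C is included in K because it depends on b as well. All dependence on b is then one
  exponential of a linear function of b, so the derivative is K times the explicit slope
  \<Lambda>.\<close>

lemma deriv_K:
  "deriv (\<lambda>b. K b t x) (of_real l) = of_real prefactor *
     (G (shift t (fst x)) * G (shift t (snd x))
      * (2 / (csq (2 * (shift t (fst x)) / L) * csq (2 * (shift t (snd x)) / L)
          * (csq (2 * (shift t (fst x)) / L) + csq (2 * (shift t (snd x)) / L))))
      * (C_ext (of_real l) (Z t) * (exp (2 * H (shift t (fst x))) * exp (2 * H (shift t (snd x))))
         * (1 - polylog (3/2) (Z t) / (of_real (sqrt (2 * pi)) * (W (shift t (fst x)) + W (shift t (snd x)))))))"
proof -
  let ?t1 = "shift t (fst x)" and ?t2 = "shift t (snd x)"
  let ?s = "complex_of_real (sqrt p)" and ?c = "complex_of_real (sqrt (2 * pi))"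
  let ?d = "W ?t1 + W ?t2"
  let ?u = "csq (2 * ?t1 / L)" and ?v = "csq (2 * ?t2 / L)"
  let ?e = "complex_of_real (exp (- 2 / 3 * \<kappa>))"
  let ?Li = "polylog (3/2) (Z t)"
  define \<Lambda> where "\<Lambda> = ?d / ?s - ?Li / (?s * ?c)"
  have nz: "?s \<noteq> 0" "?c \<noteq> 0" using p_pos by auto
  have Kl: "K b t x = K (of_real l) t x * exp ((b - of_real l) * \<Lambda>)" for b
  proof -
    have e: "(b - of_real l) * \<Lambda> = (b - of_real l) * (W ?t1 / ?s) + (b - of_real l) * (W ?t2 / ?s)
        + (b - of_real l) * (- ?Li / of_real (sqrt p * sqrt (2 * pi)))"
      by (simp add: \<Lambda>_def algebra_simps add_divide_distrib)
    show ?thesis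
      unfolding e K_def V_shift[of b] C_ext_shift[of b] exp_add by (simp only: mult_ac)
  qed
  have "((\<lambda>b. K (of_real l) t x * exp ((b - of_real l) * \<Lambda>)) has_field_derivative K (of_real l) t x * \<Lambda>) (at (of_real l))"
    by (auto intro!: derivative_eq_intros)
  moreover have "(\<lambda>b. K b t x) = (\<lambda>b. K (of_real l) t x * exp ((b - of_real l) * \<Lambda>))"
    by (rule ext) (rule Kl)
  ultimately have "deriv (\<lambda>b. K b t x) (of_real l) = K (of_real l) t x * \<Lambda>"
    by (simp only: DERIV_imp_deriv)
  also have "\<dots> = C_ext (of_real l) (Z t) * ((exp (2 * H ?t1) * (?e * G ?t1) / W ?t1) * (exp (2 * H ?t2) * (?e * G ?t2) / W ?t2) * (1 / (- ?d)) * (1 / ?d)) * (?d / ?s - ?Li / (?s * ?c))"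
    by (simp add: K_def V_def \<Lambda>_def)
  also have "\<dots> = G ?t1 * G ?t2 * (C_ext (of_real l) (Z t) * (exp (2 * H ?t1) * exp (2 * H ?t2)) * (1 - ?Li / (?c * ?d))) * (?e * ?e * (- 1 / (W ?t1 * W ?t2 * ?d * ?s)))"
    by (rule kernel_algebra[OF W_nonzero(1) W_nonzero(1) W_nonzero(2) nz])
  also have "?e * ?e * (- 1 / (W ?t1 * W ?t2 * ?d * ?s)) = of_real prefactor * (2 / (?u * ?v * (?u + ?v)))"
  proof -
    let ?q = "complex_of_real (sqrt L)"
    have q: "?q * ?q = of_real L" using L_pos by (simp flip: of_real_mult)
    have "W ?t1 * W ?t2 * ?d * ?s = - (?q * ?q * ?q * ?s * (?u * ?v * (?u + ?v)))"
      unfolding W_eq by (simp add: algebra_simps)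
    then have "- 1 / (W ?t1 * W ?t2 * ?d * ?s) = 1 / (of_real L * ?q * ?s) * (1 / (?u * ?v * (?u + ?v)))"
      unfolding q by simp
    moreover have "?e * ?e = of_real (exp (- 4 / 3 * \<kappa>))"
      by (simp flip: of_real_mult exp_add)
    ultimately show ?thesis unfolding prefactor_def by simp
  qed
  finally show ?thesis by (simp only: mult_ac)
qed

text \<open>Up to \<open>prefactor\<close> the kernel is a product of two factors G, the algebraic
  factor Q1 and a factor \<eta> that collects C, h and the polylogarithm. Replacing the first three
  by their limits costs O(1 / sqrt \<kappa>), replacing \<eta> by 1 costs O(\<kappa> \<rho>). Every
  error keeps the envelope A A, so it can be summed over all pairs of points.\<close>

lemma kernel_bound:
  "norm (deriv (\<lambda>b. K b t x) (of_real l) - of_real (prefactor * (g (shift t (fst x)) * g (shift t (snd x)))))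
    \<le> prefactor * \<epsilon> * (A (shift t (fst x)) * A (shift t (snd x)))"
proof -
  let ?t1 = "shift t (fst x)" and ?t2 = "shift t (snd x)"
  define Q1 where "Q1 = 2 / (csq (2 * ?t1 / L) * csq (2 * ?t2 / L) * (csq (2 * ?t1 / L) + csq (2 * ?t2 / L)))"
  define P where "P = polylog (3/2) (Z t) / (of_real (sqrt (2 * pi)) * (W ?t1 + W ?t2))"
  define \<eta> where "\<eta> = C_ext (of_real l) (Z t) * (exp (2 * H ?t1) * exp (2 * H ?t2)) * (1 - P)"
  define \<sigma>1 where "\<sigma>1 = 2 * ?t1 / L" define \<sigma>2 where "\<sigma>2 = 2 * ?t2 / L"
  have lb: "complex_of_real l \<in> ball (of_real l) 1" by simp
  have P: "norm P \<le> \<kappa> * \<rho>"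
  proof -
    have "1 \<le> norm (W ?t1 + W ?t2)" using norm_W_add_ge[of ?t1 ?t2] sqrt_L_ge_one by linarith
    then have "2 * 1 \<le> sqrt (2 * pi) * norm (W ?t1 + W ?t2)"
      using sqrt_2pi_ge by (intro mult_mono) auto
    then have "norm P \<le> 2 * \<rho> / 2"
      unfolding P_def norm_divide norm_mult norm_of_real
      using norm_polylog_le_double[OF _ norm_Z_le_half[of t], of "3/2"] norm_Z[of t] \<rho>_pos
      by (intro frac_le) auto
    then show ?thesis using \<rho>_small(2) by simp
  qed
  have c: "norm (C_ext (of_real l) (Z t) - 1) \<le> 8 * (\<kappa> * \<rho>)" by (rule norm_C_ext_minus_one_le[OF lb])
  have e: "norm (exp (2 * H ?t1) * exp (2 * H ?t2) - 1) \<le> 8 * (\<kappa> * \<rho>)"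
  proof -
    have "norm (2 * H ?t1 + 2 * H ?t2) \<le> 4 * (\<kappa> * \<rho>)"
      using norm_triangle_ineq[of "2 * H ?t1" "2 * H ?t2"] norm_H_le[of ?t1] norm_H_le[of ?t2] \<rho>_small(2)
      by (simp add: norm_mult)
    then show ?thesis using norm_exp_minus_one_le[of "2 * H ?t1 + 2 * H ?t2" "4 * (\<kappa> * \<rho>)"] \<rho>_small(1)
      by (simp add: exp_add)
  qed
  have prod2: "norm (a * b - 1) \<le> norm (a - 1) * norm b + norm (b - 1)" for a b :: complex
  proof -
    have "a * b - 1 = (a - 1) * b + (b - 1)" by (simp add: algebra_simps)
    then show ?thesis by (metis norm_mult norm_triangle_ineq)
  qed
  have en: "norm (exp (2 * H ?t1) * exp (2 * H ?t2)) \<le> 1 + 8 / 100"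
    using norm_triangle_ineq2[of "exp (2 * H ?t1) * exp (2 * H ?t2)" 1] e \<rho>_small(1) by simp
  have Pn: "norm (1 - P) \<le> 1 + 1 / 100"
    using norm_triangle_ineq4[of 1 P] P \<rho>_small(1) by simp
  have y: "8 * (\<kappa> * \<rho>) * (1 + 8 / 100) + 8 * (\<kappa> * \<rho>) \<le> 17 * (\<kappa> * \<rho>)"
    "17 * (\<kappa> * \<rho>) * (1 + 1 / 100) + \<kappa> * \<rho> \<le> 19 * (\<kappa> * \<rho>)"
    using \<kappa>_ge \<rho>_pos by auto
  have nP: "norm (1 - P - 1) = norm P" by simp
  have ce: "norm (C_ext (of_real l) (Z t) * (exp (2 * H ?t1) * exp (2 * H ?t2)) - 1) \<le> 17 * (\<kappa> * \<rho>)"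
  proof -
    have "norm (C_ext (of_real l) (Z t) - 1) * norm (exp (2 * H ?t1) * exp (2 * H ?t2)) \<le> 8 * (\<kappa> * \<rho>) * (1 + 8 / 100)"
      using c en \<kappa>_ge \<rho>_pos by (intro mult_mono) auto
    then show ?thesis using prod2[of "C_ext (of_real l) (Z t)" "exp (2 * H ?t1) * exp (2 * H ?t2)"] e y
      by linarith
  qed
  have \<eta>: "norm (\<eta> - 1) \<le> 19 * (\<kappa> * \<rho>)"
  proof -
    have "norm (C_ext (of_real l) (Z t) * (exp (2 * H ?t1) * exp (2 * H ?t2)) - 1) * norm (1 - P) \<le> 17 * (\<kappa> * \<rho>) * (1 + 1 / 100)"
      using ce Pn \<kappa>_ge \<rho>_pos by (intro mult_mono) auto
    then show ?thesis
      using prod2[of "C_ext (of_real l) (Z t) * (exp (2 * H ?t1) * exp (2 * H ?t2))" "1 - P"] P y nP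
      unfolding \<eta>_def by linarith
  qed
  have \<eta>2: "norm \<eta> \<le> 2" using norm_triangle_ineq2[of \<eta> 1] \<eta> \<rho>_small(1) by simp
  note sc = scale[of ?t1, folded \<sigma>1_def] scale[of ?t2, folded \<sigma>2_def]
  have Q1: "norm Q1 \<le> 1" "norm (Q1 - 1) \<le> \<bar>\<sigma>1\<bar> + \<bar>\<sigma>2\<bar>"
    unfolding Q1_def \<sigma>1_def \<sigma>2_def by (rule norm_csq_product_le)+
  have Gd: "norm (G s - of_real (g s)) \<le> 432 / sqrt \<kappa> * A s" for s
    using norm_saddle_exp_diff_le[OF \<kappa>_ge(2) scale[of s]] by (simp add: G_def g_def A_def)
  have exA: "exp (- \<bar>s / r\<bar>) \<le> A s" for s
  proof -
    have "- x \<le> - x / 2" if "x \<ge> 0" for x :: real using that by simp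
    then show ?thesis unfolding A_def exp_le_cancel_iff using abs_ge_zero by blast
  qed
  have GA: "norm (G s) \<le> 3 * A s" for s using norm_G_le[of s] exA[of s] by simp
  have gA: "g s \<le> 3 * exp (- \<bar>s / r\<bar>)" for s
    using exp_neg_square_le[OF \<kappa>_ge(2) scale[of s]] by (simp add: g_def)
  have g0: "0 \<le> g s" for s by (simp add: g_def)
  have A0: "0 \<le> A s" for s by (simp add: A_def)
  have \<sigma>A: "\<bar>\<sigma>1\<bar> * exp (- \<bar>?t1 / r\<bar>) \<le> 4 / sqrt \<kappa> * A ?t1" "\<bar>\<sigma>2\<bar> * exp (- \<bar>?t2 / r\<bar>) \<le> 4 / sqrt \<kappa> * A ?t2"
    using abs_sigma_exp_le[OF \<kappa>_ge(2) sc(1)] abs_sigma_exp_le[OF \<kappa>_ge(2) sc(2)] by (simp_all add: A_def)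
  define q where "q = 1 / sqrt \<kappa>"
  have q0: "0 \<le> q" using \<kappa>_ge by (simp add: q_def)
  have q432: "432 / sqrt \<kappa> = 432 * q" "4 / sqrt \<kappa> = 4 * q" by (simp_all add: q_def)
  \<comment> \<open>The factors are replaced one at a time. The constants are 2592 = 432 * 3 * 2 for
    each G, 144 = 9 * 2 * (4 + 4) for Q1 and 171 = 9 * 19 for \<eta>.\<close>
  have split: "G ?t1 * G ?t2 * Q1 * \<eta> - of_real (g ?t1 * g ?t2) =
      (G ?t1 - of_real (g ?t1)) * G ?t2 * (Q1 * \<eta>) + of_real (g ?t1) * (G ?t2 - of_real (g ?t2)) * (Q1 * \<eta>)
      + (of_real (g ?t1 * g ?t2) * ((Q1 - 1) * \<eta>) + of_real (g ?t1 * g ?t2) * (\<eta> - 1))"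
    by (simp add: algebra_simps)
  have Q\<eta>: "norm (Q1 * \<eta>) \<le> 2" unfolding norm_mult using mult_mono[OF Q1(1) \<eta>2] by simp
  have T1: "norm ((G ?t1 - of_real (g ?t1)) * G ?t2 * (Q1 * \<eta>)) \<le> 2592 * q * (A ?t1 * A ?t2)"
  proof -
    have "norm (G ?t1 - of_real (g ?t1)) * norm (G ?t2) * norm (Q1 * \<eta>) \<le> (432 / sqrt \<kappa> * A ?t1) * (3 * A ?t2) * 2"
      using Gd GA Q\<eta> A0 \<kappa>_ge by (intro mult_mono mult_nonneg_nonneg) auto
    then show ?thesis unfolding q432 by (simp add: norm_mult mult_ac)
  qed
  have T2: "norm (of_real (g ?t1) * (G ?t2 - of_real (g ?t2)) * (Q1 * \<eta>)) \<le> 2592 * q * (A ?t1 * A ?t2)"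
  proof -
    have "g ?t1 \<le> 3 * A ?t1" using gA[of ?t1] exA[of ?t1] by simp
    then have "\<bar>g ?t1\<bar> * norm (G ?t2 - of_real (g ?t2)) * norm (Q1 * \<eta>) \<le> (3 * A ?t1) * (432 / sqrt \<kappa> * A ?t2) * 2"
      using Gd Q\<eta> A0 \<kappa>_ge g0[of ?t1] by (intro mult_mono mult_nonneg_nonneg) auto
    then show ?thesis unfolding q432 by (simp add: norm_mult mult_ac)
  qed
  \<comment> \<open>Here g is bounded by the full decay exp (- |s|) and not by the envelope, because
    half of that decay is spent on turning |\<sigma>| into O(1 / sqrt \<kappa>).\<close>
  have T3: "norm (of_real (g ?t1 * g ?t2) * ((Q1 - 1) * \<eta>)) \<le> 144 * q * (A ?t1 * A ?t2)"
  proof -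
    have "g ?t1 * g ?t2 * (norm (Q1 - 1) * norm \<eta>) \<le> (3 * exp (- \<bar>?t1 / r\<bar>)) * (3 * exp (- \<bar>?t2 / r\<bar>)) * ((\<bar>\<sigma>1\<bar> + \<bar>\<sigma>2\<bar>) * 2)"
      using gA g0 Q1(2) \<eta>2 by (intro mult_mono mult_nonneg_nonneg) auto
    also have "\<dots> = 18 * ((\<bar>\<sigma>1\<bar> * exp (- \<bar>?t1 / r\<bar>)) * exp (- \<bar>?t2 / r\<bar>) + exp (- \<bar>?t1 / r\<bar>) * (\<bar>\<sigma>2\<bar> * exp (- \<bar>?t2 / r\<bar>)))"
    proof -
      have "(3 * a) * (3 * b) * ((x + y) * 2) = 18 * ((x * a) * b + a * (y * b))" for a b x y :: real
        by (simp add: algebra_simps)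
      then show ?thesis .
    qed
    also have "\<dots> \<le> 18 * ((4 / sqrt \<kappa> * A ?t1) * A ?t2 + A ?t1 * (4 / sqrt \<kappa> * A ?t2))"
      by (intro mult_left_mono add_mono mult_mono \<sigma>A exA A0 mult_nonneg_nonneg) (use \<kappa>_ge in auto)
    also have "\<dots> = 144 * q * (A ?t1 * A ?t2)" unfolding q432 by (simp only: mult_ac) simp
    finally have "g ?t1 * g ?t2 * (norm (Q1 - 1) * norm \<eta>) \<le> 144 * q * (A ?t1 * A ?t2)" .
    moreover have "norm (complex_of_real (g ?t1 * g ?t2)) = g ?t1 * g ?t2"
      using g0[of ?t1] g0[of ?t2] by (simp add: norm_mult)
    ultimately show ?thesis by (simp only: norm_mult)
  qed
  have T4: "norm (of_real (g ?t1 * g ?t2) * (\<eta> - 1)) \<le> 171 * (\<kappa> * \<rho>) * (A ?t1 * A ?t2)"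
  proof -
    have "g s \<le> 3 * A s" for s using gA[of s] exA[of s] by simp
    then have "g ?t1 * g ?t2 * norm (\<eta> - 1) \<le> (3 * A ?t1) * (3 * A ?t2) * (19 * (\<kappa> * \<rho>))"
      using \<eta> g0 A0 by (intro mult_mono mult_nonneg_nonneg) auto
    also have "\<dots> = 171 * (\<kappa> * \<rho>) * (A ?t1 * A ?t2)" by simp
    finally have "g ?t1 * g ?t2 * norm (\<eta> - 1) \<le> 171 * (\<kappa> * \<rho>) * (A ?t1 * A ?t2)" .
    moreover have "norm (complex_of_real (g ?t1 * g ?t2)) = g ?t1 * g ?t2"
      using g0[of ?t1] g0[of ?t2] by (simp add: norm_mult)
    ultimately show ?thesis by (simp only: norm_mult)
  qed
  have "norm (G ?t1 * G ?t2 * Q1 * \<eta> - of_real (g ?t1 * g ?t2)) \<le>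
     2592 * q * (A ?t1 * A ?t2) + 2592 * q * (A ?t1 * A ?t2) + (144 * q * (A ?t1 * A ?t2) + 171 * (\<kappa> * \<rho>) * (A ?t1 * A ?t2))"
    unfolding split using T1 T2 T3 T4 by (intro norm_triangle_mono)
  also have "\<dots> = (5328 * q + 171 * (\<kappa> * \<rho>)) * (A ?t1 * A ?t2)"
    by (simp add: algebra_simps)
  also have "\<dots> \<le> \<epsilon> * (A ?t1 * A ?t2)"
    unfolding \<epsilon>_def q_def[symmetric] using q0 \<kappa>_ge \<rho>_pos A0 by (intro mult_right_mono) auto
  finally have main: "norm (G ?t1 * G ?t2 * Q1 * \<eta> - of_real (g ?t1 * g ?t2)) \<le> \<epsilon> * (A ?t1 * A ?t2)" .
  have pref0: "0 \<le> prefactor" unfolding prefactor_def using L_pos p_pos by simp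
  have "deriv (\<lambda>b. K b t x) (of_real l) = of_real prefactor * (G ?t1 * G ?t2 * Q1 * \<eta>)"
    unfolding Q1_def \<eta>_def P_def by (rule deriv_K)
  then have "deriv (\<lambda>b. K b t x) (of_real l) - of_real (prefactor * (g ?t1 * g ?t2)) = of_real prefactor * (G ?t1 * G ?t2 * Q1 * \<eta> - of_real (g ?t1 * g ?t2))"
    by (simp add: algebra_simps)
  then have "norm (deriv (\<lambda>b. K b t x) (of_real l) - of_real (prefactor * (g ?t1 * g ?t2))) = prefactor * norm (G ?t1 * G ?t2 * Q1 * \<eta> - of_real (g ?t1 * g ?t2))"
    using pref0 by (simp add: norm_mult)
  also have "\<dots> \<le> prefactor * (\<epsilon> * (A ?t1 * A ?t2))" by (rule mult_left_mono[OF main pref0])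
  finally show ?thesis by (simp only: mult.assoc)
qed

section \<open>Periodised envelopes and Gaussians\<close>

definition a :: "real \<Rightarrow> real" where
  "a t = (exp (- t / (2 * r)) + exp (- (2 * pi - t) / (2 * r))) / (1 - exp (- (pi / r)))"

text \<open>One geometric series for each direction, the nearest point being at distance t for k = 0
  and 2 pi - t for k = -1.\<close>

lemma has_sum_A:
  assumes "t \<in> {0..2 * pi}"
  shows "((\<lambda>k::int. A (shift t k)) has_sum a t) UNIV"
proof -
  let ?q = "exp (- (pi / r))"
  have q: "0 \<le> ?q" "?q < 1" using exp_pi_r_less_one by auto
  have qn: "?q ^ n = exp (- (real n * pi / r))" for n by (simp add: exp_of_nat_mult[symmetric])
  have "((\<lambda>k::int. A (shift t k)) has_sum (exp (- t / (2 * r)) / (1 - ?q) + exp (- (2 * pi - t) / (2 * r)) / (1 - ?q))) UNIV"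
  proof (rule has_sum_int_split)
    have "A (shift t (int n)) = exp (- t / (2 * r)) * ?q ^ n" for n
    proof -
      have "\<bar>(t + 2 * pi * real n) / r\<bar> = (t + 2 * pi * real n) / r" using assms r_pos by simp
      then show ?thesis unfolding A_def qn exp_add[symmetric] using r_pos by (simp add: field_simps)
    qed
    then show "((\<lambda>n. A (shift t (int n))) has_sum exp (- t / (2 * r)) / (1 - ?q)) UNIV"
      using has_sum_geometric[OF q, of "exp (- t / (2 * r))"] by simp
    have "A (shift t (- int n - 1)) = exp (- (2 * pi - t) / (2 * r)) * ?q ^ n" for n
    proof -
      have "shift t (- int n - 1) = - (2 * pi - t + 2 * pi * real n)" by (simp add: algebra_simps)
      moreover have "0 \<le> 2 * pi - t + 2 * pi * real n" using assms by simp
      ultimately have "\<bar>(shift t (- int n - 1)) / r\<bar> = (2 * pi - t + 2 * pi * real n) / r"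
        using r_pos by (simp only: abs_divide abs_minus_cancel abs_of_nonneg abs_of_pos)
      then show ?thesis unfolding A_def qn exp_add[symmetric] using r_pos by (simp add: field_simps)
    qed
    then show "((\<lambda>n. A (shift t (- int n - 1))) has_sum exp (- (2 * pi - t) / (2 * r)) / (1 - ?q)) UNIV"
      using has_sum_geometric[OF q, of "exp (- (2 * pi - t) / (2 * r))"] by simp
  qed
  then show ?thesis by (simp add: a_def add_divide_distrib)
qed

lemma a_nonneg: "0 \<le> a t" using exp_pi_r_less_one by (simp add: a_def)

lemma a_le:
  assumes "t \<in> {0..2 * pi}"
  shows "a t \<le> 2 / (1 - exp (- (pi / r)))"
proof -
  have "exp (- t / (2 * r)) \<le> 1" "exp (- (2 * pi - t) / (2 * r)) \<le> 1"
    using assms r_pos by (auto intro!: divide_nonpos_pos)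
  then have "exp (- t / (2 * r)) + exp (- (2 * pi - t) / (2 * r)) \<le> 2" by linarith
  then show ?thesis unfolding a_def using exp_pi_r_less_one by (intro divide_right_mono) auto
qed

lemma continuous_on_a: "continuous_on S a"
  unfolding a_def using exp_pi_r_less_one r_pos by (intro continuous_intros) auto

text \<open>By unfolding this is the integral of exp (- |t| / (2 r)) over the line. The closed form
  of \<open>a\<close> has an explicit antiderivative.\<close>

lemma integral_a: "integral {0..2 * pi} a = 4 * r"
proof -
  let ?q = "exp (- (pi / r))"
  define F where "F t = (- 2 * r * exp (- t / (2 * r)) + 2 * r * exp (- (2 * pi - t) / (2 * r))) / (1 - ?q)" for t
  have "(a has_integral (F (2 * pi) - F 0)) {0..2 * pi}"
  proof (rule fundamental_theorem_of_calculus)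
    fix t assume "t \<in> {0..2 * pi}"
    have "(F has_real_derivative a t) (at t within {0..2 * pi})"
      unfolding F_def a_def using exp_pi_r_less_one r_pos by (auto intro!: derivative_eq_intros)
    then show "(F has_vector_derivative a t) (at t within {0..2 * pi})"
      by (simp add: has_real_derivative_iff_has_vector_derivative)
  qed simp
  moreover have "F (2 * pi) - F 0 = 4 * r"
  proof -
    have "(- 2 * r * q + 2 * r * 1) / (1 - q) - (- 2 * r * 1 + 2 * r * q) / (1 - q) = (4 * r * (1 - q)) / (1 - q)" for q
      by (simp add: algebra_simps flip: diff_divide_distrib)
    moreover have "exp (- (2 * pi) / (2 * r)) = ?q" "exp (- (2 * pi - 2 * pi) / (2 * r)) = 1"
      "exp (- 0 / (2 * r)) = 1" "exp (- (2 * pi - 0) / (2 * r)) = ?q" by simp_all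
    ultimately have "F (2 * pi) - F 0 = (4 * r * (1 - ?q)) / (1 - ?q)" unfolding F_def by (simp only:)
    then show ?thesis using exp_pi_r_less_one by simp
  qed
  ultimately show ?thesis by (simp add: integral_unique)
qed

definition S :: "real \<Rightarrow> real" where
  "S t = (\<Sum>\<^sub>\<infinity>k\<in>(UNIV::int set). exp (- ((shift t k) / r)\<^sup>2))"

lemma continuous_on_S: "continuous_on {0..2 * pi} S"
  and integral_S: "integral {0..2 * pi} (\<lambda>t. (S t)\<^sup>2) = r\<^sup>2 / 2 * c_const r"
  using integral_periodic_gauss_square[OF r_pos] by (simp_all add: S_def[abs_def])

lemma has_sum_g:
  assumes "t \<in> {0..2 * pi}"
  shows "((\<lambda>k::int. g (shift t k)) has_sum S t) UNIV"
proof -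
  have le: "norm (g (shift t k)) \<le> 3 * A (shift t k)" for k :: int
  proof -
    let ?s = "(shift t k) / r"
    have "exp (- ?s\<^sup>2) \<le> 3 * exp (- \<bar>?s\<bar>)"
      using exp_neg_square_le[OF \<kappa>_ge(2) scale[of "shift t k"]] .
    also have "\<dots> \<le> 3 * exp (- \<bar>?s\<bar> / 2)"
    proof -
      have "- x \<le> - x / 2" if "x \<ge> 0" for x :: real using that by simp
      then have "exp (- \<bar>?s\<bar>) \<le> exp (- \<bar>?s\<bar> / 2)" unfolding exp_le_cancel_iff using abs_ge_zero by blast
      then show ?thesis by (rule mult_left_mono) simp
    qed
    finally show ?thesis by (simp add: g_def A_def)
  qed
  show ?thesis unfolding S_def
    using has_sum_infsum[OF norm_infsum_le_bound(1)[OF le summable_on_cmult_right[OF has_sum_imp_summable[OF has_sum_A[OF assms]]]]]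
    by (simp add: g_def)
qed

lemma \<epsilon>_nonneg: "0 \<le> \<epsilon>" unfolding \<epsilon>_def using \<kappa>_ge \<rho>_pos by simp

lemma prefactor_pos: "0 < prefactor" unfolding prefactor_def using L_pos p_pos by simp

text \<open>Summing \<open>kernel_bound\<close> over all pairs: the double series of products
  factorise into the squares of the periodised Gaussian and of the periodised envelope.\<close>

lemma deriv_one_particle:
  assumes t: "t \<in> {0..2 * pi}"
  obtains d where "((\<lambda>b. C_ext b (Z t) * D_term b t 1) has_field_derivative d) (at (of_real l))"
    "norm (d - of_real (prefactor * (S t)\<^sup>2)) \<le> prefactor * \<epsilon> * (a t)\<^sup>2"
proof -
  have hol: "(\<lambda>b. K b t x) holomorphic_on ball (of_real l) 1" for x
  proof -
    obtain i j where x: "x = (i, j)" by (cases x)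
    show ?thesis unfolding x K_eq_Term by (intro holomorphic_intros holomorphic_on_C_ext holomorphic_on_Term)
  qed
  obtain d where d: "((\<lambda>b. \<Sum>\<^sub>\<infinity>x\<in>UNIV \<times> UNIV. K b t x) has_field_derivative d) (at (of_real l))"
    "((\<lambda>x. deriv (\<lambda>b. K b t x) (of_real l)) has_sum d) (UNIV \<times> UNIV)"
    by (rule has_field_derivative_infsum[where S = "ball (of_real l) 1" and f = "\<lambda>x b. K b t x" and X = "UNIV \<times> UNIV" and M = K_bound and x = "of_real l"])
      (use hol norm_K_le t summable_K_bound in auto)
  have gg: "((\<lambda>(i, j). g (shift t i) * g (shift t j)) has_sum S t * S t) (UNIV \<times> UNIV)"
    by (rule has_sum_times_nonneg[OF has_sum_g[OF t] has_sum_g[OF t]]) (auto simp: g_def)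
  then have "((\<lambda>x. complex_of_real prefactor * of_real (case x of (i, j) \<Rightarrow> g (shift t i) * g (shift t j))) has_sum
      (of_real prefactor * of_real (S t * S t))) (UNIV \<times> UNIV)"
    by (intro has_sum_cmult_right has_sum_of_real)
  then have gg': "((\<lambda>x. - of_real (prefactor * (g (shift t (fst x)) * g (shift t (snd x))))) has_sum
      - (complex_of_real (prefactor * (S t)\<^sup>2))) (UNIV \<times> UNIV)"
    by (intro has_sum_uminus[THEN iffD2]) (simp add: case_prod_unfold power2_eq_square)
  have diff: "((\<lambda>x. deriv (\<lambda>b. K b t x) (of_real l) - of_real (prefactor * (g (shift t (fst x)) * g (shift t (snd x))))) has_sum
      (d - of_real (prefactor * (S t)\<^sup>2))) (UNIV \<times> UNIV)"
    using has_sum_add[OF d(2) gg'] by simp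
  have AA: "((\<lambda>(i, j). A (shift t i) * A (shift t j)) has_sum a t * a t) (UNIV \<times> UNIV)"
    by (rule has_sum_times_nonneg[OF has_sum_A[OF t] has_sum_A[OF t]]) (auto simp: A_def)
  then have "((\<lambda>x. prefactor * \<epsilon> * (A (shift t (fst x)) * A (shift t (snd x)))) has_sum prefactor * \<epsilon> * (a t * a t)) (UNIV \<times> UNIV)"
    using has_sum_cmult_right[OF AA, of "prefactor * \<epsilon>"] by (simp add: case_prod_unfold)
  from norm_infsum_le[OF diff this kernel_bound]
  have "norm (d - of_real (prefactor * (S t)\<^sup>2)) \<le> prefactor * \<epsilon> * (a t)\<^sup>2" by (simp add: power2_eq_square)
  moreover have "((\<lambda>b. C_ext b (Z t) * D_term b t 1) has_field_derivative d) (at (of_real l))"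
    unfolding C_ext_D_term_1 by (rule d(1))
  ultimately show thesis using that by blast
qed

text \<open>Cauchy's inequality on the circle of radius 1 / 2 doubles the bound 4
  \<open>weight_sum\<close>^4 for the function. It is of order exp (- 2 \<kappa>), so no finer
  information on the derivative is called for.\<close>

lemma deriv_many_particles:
  assumes t: "t \<in> {0..2 * pi}"
  obtains d where "((\<lambda>b. C_ext b (Z t) * D_rest b t) has_field_derivative d) (at (of_real l))" "norm d \<le> 8 * weight_sum ^ 4"
proof -
  let ?f = "\<lambda>b. C_ext b (Z t) * D_rest b t"
  have hol: "?f holomorphic_on ball (of_real l) 1"
    by (intro holomorphic_intros holomorphic_on_C_ext holomorphic_on_D_rest t)
  have "norm ((deriv ^^ 1) ?f (of_real l)) \<le> fact 1 * (4 * weight_sum ^ 4) / (1/2) ^ 1"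
  proof (rule Cauchy_inequality)
    show "?f holomorphic_on ball (of_real l) (1/2)" by (rule holomorphic_on_subset[OF hol]) auto
    show "continuous_on (cball (of_real l) (1/2)) ?f"
      by (rule continuous_on_subset[OF holomorphic_on_imp_continuous_on[OF hol]]) auto
    fix b assume "norm (complex_of_real l - b) = 1/2"
    then have b: "b \<in> ball (of_real l) 1" by (simp add: dist_norm)
    have "norm (C_ext b (Z t)) * norm (D_rest b t) \<le> 2 * (2 * weight_sum ^ 4)"
      by (intro mult_mono norm_C_ext_le norm_D_rest_le b t) auto
    then show "norm (?f b) \<le> 4 * weight_sum ^ 4" by (simp add: norm_mult)
  qed simp
  then have "norm (deriv ?f (of_real l)) \<le> 8 * weight_sum ^ 4" by simp
  moreover have "(?f has_field_derivative deriv ?f (of_real l)) (at (of_real l))"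
    by (rule holomorphic_derivI[OF hol]) auto
  ultimately show thesis using that by blast
qed

lemma deriv_\<Psi>_bound:
  assumes t: "t \<in> {0..2 * pi}"
  shows "norm (deriv (\<lambda>b. \<Psi> b t) (of_real l) - of_real (prefactor * (S t)\<^sup>2))
    \<le> prefactor * \<epsilon> * (2 / (1 - exp (- (pi / r)))) * a t + 8 * weight_sum ^ 4"
proof -
  obtain d where d: "((\<lambda>b. C_ext b (Z t) * D_term b t 1) has_field_derivative d) (at (of_real l))"
    "norm (d - of_real (prefactor * (S t)\<^sup>2)) \<le> prefactor * \<epsilon> * (a t)\<^sup>2"
    using deriv_one_particle[OF t] .
  obtain e where e: "((\<lambda>b. C_ext b (Z t) * D_rest b t) has_field_derivative e) (at (of_real l))" "norm e \<le> 8 * weight_sum ^ 4"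
    using deriv_many_particles[OF t] .
  have "((\<lambda>b. \<Psi> b t) has_field_derivative (d + e)) (at (of_real l))"
    unfolding \<Psi>_def by (rule DERIV_add[OF d(1) e(1)])
  then have "deriv (\<lambda>b. \<Psi> b t) (of_real l) - of_real (prefactor * (S t)\<^sup>2) = (d - of_real (prefactor * (S t)\<^sup>2)) + e"
    by (simp add: DERIV_imp_deriv)
  then have "norm (deriv (\<lambda>b. \<Psi> b t) (of_real l) - of_real (prefactor * (S t)\<^sup>2)) \<le> prefactor * \<epsilon> * (a t)\<^sup>2 + 8 * weight_sum ^ 4"
    using norm_triangle_mono[OF d(2) e(2)] by (simp only:)
  \<comment> \<open>One factor a is replaced by its maximum, so that the integral over t reduces to
    \<open>integral_a\<close>.\<close>
  moreover have "(a t)\<^sup>2 \<le> 2 / (1 - exp (- (pi / r))) * a t"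
    unfolding power2_eq_square by (intro mult_right_mono a_le t a_nonneg)
  then have "prefactor * \<epsilon> * (a t)\<^sup>2 \<le> prefactor * \<epsilon> * (2 / (1 - exp (- (pi / r))) * a t)"
    using prefactor_pos \<epsilon>_nonneg by (intro mult_left_mono) auto
  ultimately show ?thesis by (simp only: mult.assoc)
qed

lemma norm_\<Psi>_le:
  assumes "b \<in> ball (of_real l) 1" "t \<in> {0..2 * pi}"
  shows "norm (\<Psi> b t) \<le> 2 * weight_sum\<^sup>2 + 4 * weight_sum ^ 4"
proof -
  have "norm (C_ext b (Z t)) * norm (D_term b t 1) \<le> 2 * (weight_sum\<^sup>2) ^ 1"
    by (intro mult_mono norm_C_ext_le norm_D_term_le assms) auto
  moreover have "norm (C_ext b (Z t)) * norm (D_rest b t) \<le> 2 * (2 * weight_sum ^ 4)"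
    by (intro mult_mono norm_C_ext_le norm_D_rest_le assms) auto
  ultimately show ?thesis
    unfolding \<Psi>_def by (intro order_trans[OF norm_triangle_ineq]) (simp add: norm_mult)
qed

lemma holomorphic_on_\<Psi>:
  assumes "t \<in> {0..2 * pi}"
  shows "(\<lambda>b. \<Psi> b t) holomorphic_on ball (of_real l) 1"
  unfolding \<Psi>_def by (intro holomorphic_intros holomorphic_on_C_ext holomorphic_on_D_rest holomorphic_on_D_term assms)

section \<open>The density at l and its relative error\<close>

lemma density_error:
  assumes "explicit_one_point_law M H'"
  shows "\<bar>one_point_density M H' p l 0 1 - prefactor * (r\<^sup>2 / 2 * c_const r) / (2 * pi)\<bar>
    \<le> (prefactor * \<epsilon> * (2 / (1 - exp (- (pi / r)))) * (4 * r) + 16 * pi * weight_sum ^ 4) / (2 * pi)"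
proof -
  let ?I = "{0..2 * pi}"
  let ?d = "\<lambda>t. deriv (\<lambda>b. \<Psi> b t) (of_real l)"
  let ?T = "\<lambda>b. integral ?I (\<Psi> b)"
  note der = has_field_derivative_integral_holomorphic[of 0 "2 * pi" \<Psi> "of_real l",
      OF holomorphic_on_\<Psi> norm_\<Psi>_le continuous_on_\<Psi>]
  have dc: "continuous_on ?I ?d" by (rule der(1))
  have T: "(?T has_field_derivative integral ?I ?d) (at (of_real l))" by (rule der(2))
  have "((\<lambda>x. ?T (of_real x)) has_vector_derivative integral ?I ?d) (at l)"
    by (rule has_vector_derivative_real_field[OF T])
  then have "((\<lambda>x. Re (?T (of_real x))) has_vector_derivative Re (integral ?I ?d)) (at l)"
    by (rule bounded_linear.has_vector_derivative[OF bounded_linear_Re])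
  then have derR: "((\<lambda>x. Re (?T (of_real x))) has_real_derivative Re (integral ?I ?d)) (at l)"
    unfolding has_real_derivative_iff_has_vector_derivative .
  have der': "((\<lambda>x. 1 + Re (?T (of_real x)) / (2 * pi)) has_real_derivative Re (integral ?I ?d) / (2 * pi)) (at l)"
    using DERIV_add[OF DERIV_const[of 1] DERIV_cdivide[OF derR, of "2 * pi"]] by (simp only: add_0_left)
  have cdf: "one_point_cdf M H' p 0 1 x = 1 + Re (?T (of_real x)) / (2 * pi)" if "x \<in> ball l 1" for x
  proof -
    have x: "complex_of_real x \<in> ball (of_real l) 1" using that by (simp add: dist_of_real)
    have "2 * complex_of_real pi = of_real (2 * pi)" by simp
    then show ?thesis
      using arg_cong[OF cdf_eq[OF assms x], of Re]
      by (simp only: plus_complex.sel one_complex.sel Re_divide_of_real Re_complex_of_real)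
  qed
  have "((\<lambda>x. one_point_cdf M H' p 0 1 x) has_real_derivative Re (integral ?I ?d) / (2 * pi)) (at l)"
    by (rule has_field_derivative_transform_within_open[OF der', of "ball l 1"]) (use cdf in auto)
  then have dens: "one_point_density M H' p l 0 1 = Re (integral ?I ?d) / (2 * pi)"
    unfolding one_point_density_def by (rule DERIV_imp_deriv)
  have Sc: "continuous_on ?I (\<lambda>t. complex_of_real (prefactor * (S t)\<^sup>2))"
    by (intro continuous_intros continuous_on_S)
  have Si: "((\<lambda>t. (S t)\<^sup>2) has_integral (r\<^sup>2 / 2 * c_const r)) ?I"
    unfolding integral_S[symmetric]
    by (intro integrable_integral integrable_continuous_interval continuous_intros continuous_on_S)
  then have "((\<lambda>t. prefactor * (S t)\<^sup>2) has_integral (prefactor * (r\<^sup>2 / 2 * c_const r))) ?I"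
    by (rule has_integral_mult_right)
  then have Sint: "integral ?I (\<lambda>t. complex_of_real (prefactor * (S t)\<^sup>2)) = of_real (prefactor * (r\<^sup>2 / 2 * c_const r))"
    by (intro integral_unique has_integral_of_real)
  have "norm (integral ?I (\<lambda>t. ?d t - of_real (prefactor * (S t)\<^sup>2)))
      \<le> integral ?I (\<lambda>t. prefactor * \<epsilon> * (2 / (1 - exp (- (pi / r)))) * a t + 8 * weight_sum ^ 4)"
  proof (rule Henstock_Kurzweil_Integration.integral_norm_bound_integral)
    show "(\<lambda>t. ?d t - of_real (prefactor * (S t)\<^sup>2)) integrable_on ?I"
      by (intro integrable_continuous_interval continuous_on_diff dc Sc)
    show "(\<lambda>t. prefactor * \<epsilon> * (2 / (1 - exp (- (pi / r)))) * a t + 8 * weight_sum ^ 4) integrable_on ?I"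
      by (intro integrable_continuous_interval continuous_on_add continuous_on_mult continuous_on_const continuous_on_a)
  qed (rule deriv_\<Psi>_bound)
  also have "\<dots> = integral ?I (\<lambda>t. prefactor * \<epsilon> * (2 / (1 - exp (- (pi / r)))) * a t) + integral ?I (\<lambda>t. 8 * weight_sum ^ 4)"
    by (intro Henstock_Kurzweil_Integration.integral_add integrable_continuous_interval continuous_on_mult continuous_on_const continuous_on_a)
  also have "\<dots> = prefactor * \<epsilon> * (2 / (1 - exp (- (pi / r)))) * (4 * r) + 16 * pi * weight_sum ^ 4"
    unfolding integral_mult_right integral_a by simp
  also have "integral ?I (\<lambda>t. ?d t - of_real (prefactor * (S t)\<^sup>2)) = integral ?I ?d - of_real (prefactor * (r\<^sup>2 / 2 * c_const r))"
    unfolding Sint[symmetric]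
    by (intro Henstock_Kurzweil_Integration.integral_diff integrable_continuous_interval dc Sc)
  finally have "\<bar>Re (integral ?I ?d) - prefactor * (r\<^sup>2 / 2 * c_const r)\<bar> \<le> prefactor * \<epsilon> * (2 / (1 - exp (- (pi / r)))) * (4 * r) + 16 * pi * weight_sum ^ 4"
    using order_trans[OF abs_Re_le_cmod[of "integral ?I ?d - of_real (prefactor * (r\<^sup>2 / 2 * c_const r))"]] by simp
  then have "\<bar>Re (integral ?I ?d) - prefactor * (r\<^sup>2 / 2 * c_const r)\<bar> / (2 * pi) \<le> (prefactor * \<epsilon> * (2 / (1 - exp (- (pi / r)))) * (4 * r) + 16 * pi * weight_sum ^ 4) / (2 * pi)"
    by (rule divide_right_mono) simp
  moreover have "\<bar>x / (2 * pi) - y / (2 * pi)\<bar> = \<bar>x - y\<bar> / (2 * pi)" for x y :: real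
    by (simp flip: diff_divide_distrib add: abs_divide)
  ultimately show ?thesis unfolding dens by (simp only:)
qed

text \<open>Since r^2 = p^2 sqrt l and the denominator of \<open>prefactor\<close> is 2 p^2 l sqrt
  l, p survives only inside \<open>c_const r\<close>. This is why a single formula covers all three
  regimes.\<close>

lemma prefactor_r_square: "prefactor * (r\<^sup>2 / 2 * c_const r) / (2 * pi) = c_const r / (8 * pi * l) * exp (- (4 / 3) * \<kappa>)"
proof -
  have "r\<^sup>2 = p\<^sup>2 * sqrt l"
  proof -
    have "(l powr (1/4))\<^sup>2 = l powr (1/2)" using l_pos by (simp add: power2_eq_square flip: powr_add)
    then show ?thesis using l_pos by (simp add: r_def power_mult_distrib powr_half_sqrt)
  qed
  moreover have "2 * L * sqrt L * sqrt p = 2 * p\<^sup>2 * l * sqrt l"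
    using p_pos by (simp add: L_def real_sqrt_mult power2_eq_square)
  ultimately show ?thesis using p_pos l_pos unfolding prefactor_def by (simp add: field_simps)
qed

text \<open>The integrated envelopes give 8 r + 8 r^2 / pi, to be compared with r^2 c(r). The
  quadratic part needs c(r) >= 1; the linear part, dominant for small r, needs r c(r) >= 2.\<close>

lemma density_relative_error:
  assumes "explicit_one_point_law M H'"
  shows "\<bar>one_point_density M H' p l 0 1 - c_const r / (8 * pi * l) * exp (- (4 / 3) * \<kappa>)\<bar>
    \<le> c_const r / (8 * pi * l) * exp (- (4 / 3) * \<kappa>) * (16 * \<epsilon> + 2000000 * l * exp (- (2 / 3) * \<kappa>))"
proof -
  let ?c = "c_const r"
  have c: "1 \<le> ?c" by (rule c_const_ge_one[OF r_pos])
  have rc: "2 \<le> r * ?c"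
  proof -
    \<comment> \<open>By Poisson summation r c(r) = sqrt (2 pi) c(2 pi / r), and the dual sum is at
      least 1.\<close>
    have "1 \<le> c_const (2 * pi / r)" by (rule c_const_ge_one) (use r_pos in simp)
    then have "2 * 1 \<le> sqrt (2 * pi) * c_const (2 * pi / r)" using sqrt_2pi_ge by (intro mult_mono) auto
    also have "\<dots> = r * ?c" using c_const_poisson[OF r_pos] r_pos by (simp add: field_simps)
    finally show ?thesis by simp
  qed
  have pr: "1 \<le> pi" "0 < r" using pi_gt3 r_pos by auto
  have "2 / (1 - exp (- (pi / r))) * (4 * r) \<le> 2 * (1 + r / pi) * (4 * r)"
    using geometric_bound r_pos by (intro mult_right_mono) auto
  also have "\<dots> = 8 * r * 1 + 8 * r * r * (1 / pi)" by (simp add: field_simps)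
  also have "\<dots> \<le> 8 * r * (r * ?c / 2) + 8 * r * r * (?c / 2)"
  proof (intro add_mono mult_left_mono)
    have "1 / pi \<le> 1 / 2" using pi_gt3 by (intro divide_left_mono) auto
    then show "1 / pi \<le> ?c / 2" using c by linarith
  qed (use rc r_pos in auto)
  also have "\<dots> = 16 * (r\<^sup>2 / 2 * ?c)" by (simp add: power2_eq_square)
  finally have "prefactor * \<epsilon> * (2 / (1 - exp (- (pi / r))) * (4 * r)) \<le> prefactor * \<epsilon> * (16 * (r\<^sup>2 / 2 * ?c))"
    using prefactor_pos \<epsilon>_nonneg by (intro mult_left_mono) auto
  then have "prefactor * \<epsilon> * (2 / (1 - exp (- (pi / r)))) * (4 * r) / (2 * pi) \<le> prefactor * \<epsilon> * (16 * (r\<^sup>2 / 2 * ?c)) / (2 * pi)"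
    by (intro divide_right_mono) (simp_all only: mult.assoc, simp)
  also have "\<dots> = prefactor * (r\<^sup>2 / 2 * ?c) / (2 * pi) * (16 * \<epsilon>)" by simp
  finally have 1: "prefactor * \<epsilon> * (2 / (1 - exp (- (pi / r)))) * (4 * r) / (2 * pi) \<le> ?c / (8 * pi * l) * exp (- (4 / 3) * \<kappa>) * (16 * \<epsilon>)"
    unfolding prefactor_r_square .
  have "16 * pi * weight_sum ^ 4 / (2 * pi) = 8 * weight_sum ^ 4" by simp
  also have "\<dots> \<le> 8 * (9 * exp (- \<kappa> / 2)) ^ 4"
    using weight_sum_le weight_sum_nonneg by (intro mult_left_mono power_mono) auto
  also have "\<dots> = 52488 * exp (- 2 * \<kappa>)"
    by (simp add: power_mult_distrib flip: exp_of_nat_mult)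
  also have "\<dots> = exp (- (4 / 3) * \<kappa>) * (52488 * exp (- (2 / 3) * \<kappa>))" by (simp flip: exp_add)
  also have "\<dots> \<le> exp (- (4 / 3) * \<kappa>) * (?c / (8 * pi * l) * (2000000 * l * exp (- (2 / 3) * \<kappa>)))"
  proof (rule mult_left_mono)
    \<comment> \<open>52488 = 8 * 9^4 comes from the bound 9 exp (- \<kappa> / 2) for
      \<open>weight_sum\<close>; 2000000 is 8 * 250000, chosen so that 250000 / pi exceeds
      52488.\<close>
    have "52488 * 1 \<le> 250000 / pi * ?c"
    proof (rule mult_mono)
      have "pi < 4" by (rule pi_less_4)
      then show "52488 \<le> 250000 / pi" by (simp add: field_simps)
    qed (use c in auto)
    then have "52488 * exp (- (2 / 3) * \<kappa>) \<le> 250000 / pi * ?c * exp (- (2 / 3) * \<kappa>)" by (intro mult_right_mono) auto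
    also have "\<dots> = ?c / (8 * pi * l) * (2000000 * l * exp (- (2 / 3) * \<kappa>))" using l_pos by (simp add: field_simps)
    finally show "52488 * exp (- (2 / 3) * \<kappa>) \<le> ?c / (8 * pi * l) * (2000000 * l * exp (- (2 / 3) * \<kappa>))" .
  qed simp
  finally have 2: "16 * pi * weight_sum ^ 4 / (2 * pi) \<le> ?c / (8 * pi * l) * exp (- (4 / 3) * \<kappa>) * (2000000 * l * exp (- (2 / 3) * \<kappa>))"
    by (simp only: mult_ac)
  show ?thesis
    using density_error[OF assms] 1 2 unfolding prefactor_r_square by (simp only: add_divide_distrib distrib_left)
qed

end

section \<open>Asymptotics uniform in p and the three regimes\<close>

lemma c_const_uniform_asymptotics:
  fixes M :: "'w measure" and H :: "real \<Rightarrow> real \<Rightarrow> 'w \<Rightarrow> real" and p :: "real \<Rightarrow> real"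
  assumes law: "explicit_one_point_law M H"
    and p_pos: "\<forall>\<^sub>F l in at_top. p l > 0"
    and p_large: "filterlim (\<lambda>l. p l * l / ln l) at_top at_top"
  shows "(\<lambda>l. one_point_density M H (p l) l 0 1)
    \<sim>[at_top] (\<lambda>l. c_const (p l * l powr (1/4)) / (8 * pi * l) * exp (- (4/3) * l powr (3/2)))"
proof (rule asymp_equivI')
  let ?f = "\<lambda>l. one_point_density M H (p l) l 0 1"
  let ?g = "\<lambda>l. c_const (p l * l powr (1/4)) / (8 * pi * l) * exp (- (4/3) * l powr (3/2))"
  let ?\<delta> = "\<lambda>l::real. 16 * (6000 * (1 / sqrt (l powr (3/2)) + l powr (- 3/2))) + 2000000 * l * exp (- (2 / 3) * l powr (3/2))"
  \<comment> \<open>From p l >= 6 log l follows exp (- p l / 2) <= l^(-3), hence \<kappa> \<rho> <=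
    l^(-3/2), which tends to 0.\<close>
  have "\<forall>\<^sub>F l in at_top. 6 \<le> p l * l / ln l"
    using p_large by (simp add: filterlim_at_top)
  moreover have "\<forall>\<^sub>F l in at_top. l powr (- 3/2) \<le> (1 / 100 :: real)" by real_asymp
  ultimately have bound: "\<forall>\<^sub>F l in at_top. norm (?f l / ?g l - 1) \<le> ?\<delta> l"
    using p_pos eventually_ge_at_top[of 12]
  proof eventually_elim
    case (elim l)
    have "exp 1 \<le> l" using exp_le elim by linarith
    then have ln: "1 \<le> ln l" using elim by (subst ln_ge_iff) auto
    have pl: "6 * ln l \<le> p l * l" using elim ln by (simp add: pos_le_divide_eq)
    have "exp (- (p l * l) / 2) \<le> exp (- 3 * ln l)" using pl by simp
    also have "\<dots> = l powr (- 3)" using elim by (simp add: powr_def)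
    finally have "l powr (3/2) * exp (- (p l * l) / 2) \<le> l powr (3/2) * l powr (- 3)"
      by (rule mult_left_mono) simp
    also have "\<dots> = l powr (- 3/2)" by (simp flip: powr_add)
    finally have exp_le: "l powr (3/2) * exp (- (p l * l) / 2) \<le> l powr (- 3/2)" .
    interpret tail "p l" l
      by unfold_locales (use elim ln pl exp_le in auto)
    have g: "?g l = c_const r / (8 * pi * l) * exp (- (4 / 3) * \<kappa>)"
      by (simp add: r_def \<kappa>_def)
    have gpos: "0 < ?g l"
      unfolding g using c_const_ge_one[OF r_pos] l_pos by (intro mult_pos_pos divide_pos_pos) auto
    have "\<bar>?f l - ?g l\<bar> \<le> ?g l * (16 * \<epsilon> + 2000000 * l * exp (- (2 / 3) * \<kappa>))"
      unfolding g by (rule density_relative_error[OF law])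
    also have "\<dots> \<le> ?g l * ?\<delta> l"
      using gpos exp_le l_pos unfolding \<epsilon>_def \<kappa>_def \<rho>_def L_def
      by (intro mult_left_mono add_mono) auto
    finally have "\<bar>?f l - ?g l\<bar> / ?g l \<le> ?\<delta> l"
      by (subst pos_divide_le_eq[OF gpos]) (simp only: mult.commute)
    moreover have "?f l / ?g l - 1 = (?f l - ?g l) / ?g l"
    proof -
      have "x / y - 1 = (x - y) / y" if "y > 0" for x y :: real using that by (simp add: diff_divide_distrib)
      from this[OF gpos] show ?thesis .
    qed
    then have "norm (?f l / ?g l - 1) = \<bar>?f l - ?g l\<bar> / ?g l" using gpos by (simp only: real_norm_def abs_divide abs_of_pos)
    ultimately show ?case by simp
  qed
  have "(?\<delta> \<longlongrightarrow> 0) at_top" by real_asymp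
  with bound have "((\<lambda>l. ?f l / ?g l - 1) \<longlongrightarrow> 0) at_top"
    by (rule Lim_null_comparison)
  then show "((\<lambda>l. ?f l / ?g l) \<longlongrightarrow> 1) at_top" by (simp add: LIM_zero_iff)
qed

theorem theorem1p5:
  fixes M :: "'w measure" and H :: "real \<Rightarrow> real \<Rightarrow> 'w \<Rightarrow> real"
    and p :: "real \<Rightarrow> real"
  assumes fixed_point: "periodic_KPZ_fixed_point M H"
    and law: "explicit_one_point_law M H"
    and p_pos: "\<forall>\<^sub>F l in at_top. p l > 0"
  shows
    "(filterlim (\<lambda>l. p l * l powr (1/4)) at_top at_top \<and>
      ((\<lambda>l. ln (p l) / l powr (3/2)) \<longlongrightarrow> 0) at_top \<longrightarrow>
        (\<lambda>l. one_point_density M H (p l) l 0 1)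
          \<sim>[at_top] (\<lambda>l. 1 / (8 * pi * l) * exp (- (4/3) * l powr (3/2)))) \<and>
     (\<forall>r>0. (\<forall>\<^sub>F l in at_top. p l = r * l powr (- (1/4))) \<longrightarrow>
        (\<lambda>l. one_point_density M H (p l) l 0 1)
          \<sim>[at_top] (\<lambda>l. c_const r / (8 * pi * l) * exp (- (4/3) * l powr (3/2)))) \<and>
     (filterlim (\<lambda>l. p l * l / ln l) at_top at_top \<and>
      ((\<lambda>l. p l * l powr (1/4)) \<longlongrightarrow> 0) at_top \<longrightarrow>
        (\<lambda>l. one_point_density M H (p l) l 0 1)
          \<sim>[at_top] (\<lambda>l. 1 / (4 * sqrt (2 * pi) * l powr (5/4) * p l) * exp (- (4/3) * l powr (3/2)))) \<and>
     (\<forall>r>0. c_const r =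
        sqrt (2 * pi) / r * (\<Sum>\<^sub>\<infinity>k\<in>(UNIV::int set). exp (- (2 * pi\<^sup>2 / r\<^sup>2) * (of_int k)\<^sup>2)))"
proof (intro conjI impI allI)
  note uniform = c_const_uniform_asymptotics[OF law p_pos]
  let ?f = "\<lambda>l. one_point_density M H (p l) l 0 1"
  let ?e = "\<lambda>l::real. exp (- (4/3) * l powr (3/2))"
  {
    assume "filterlim (\<lambda>l. p l * l powr (1/4)) at_top at_top \<and> ((\<lambda>l. ln (p l) / l powr (3/2)) \<longlongrightarrow> 0) at_top"
    then have r: "filterlim (\<lambda>l. p l * l powr (1/4)) at_top at_top" by blast
    \<comment> \<open>Writing l = l^(1/4) l^(3/4) shows that p l / log l tends to infinity in this
      regime, as the uniform estimate requires.\<close>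
    have "filterlim (\<lambda>l::real. l powr (3/4) / ln l) at_top at_top" by real_asymp
    from filterlim_at_top_mult_at_top[OF r this]
    have "filterlim (\<lambda>l. p l * l powr (1/4) * (l powr (3/4) / ln l)) at_top at_top" .
    moreover have "\<forall>\<^sub>F l in at_top. p l * l powr (1/4) * (l powr (3/4) / ln l) = p l * l / ln l"
      using eventually_gt_at_top[of 0]
    proof eventually_elim
      case (elim l)
      then have "l powr (1/4) * l powr (3/4) = l" by (simp flip: powr_add)
      then show ?case by (simp add: mult.assoc)
    qed
    ultimately have "filterlim (\<lambda>l. p l * l / ln l) at_top at_top"
      by (rule filterlim_cong[OF refl refl, THEN iffD1, rotated])
    note asymp = uniform[OF this]
    have "((\<lambda>l. c_const (p l * l powr (1/4))) \<longlongrightarrow> 1) at_top"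
      by (rule filterlim_compose[OF c_const_tendsto_one r])
    then have "(\<lambda>l. c_const (p l * l powr (1/4))) \<sim>[at_top] (\<lambda>_. 1)"
      by (intro asymp_equivI') simp
    then have "(\<lambda>l. c_const (p l * l powr (1/4)) / (8 * pi * l) * ?e l) \<sim>[at_top] (\<lambda>l. 1 / (8 * pi * l) * ?e l)"
      by (intro asymp_equiv_intros)
    with asymp show "?f \<sim>[at_top] (\<lambda>l. 1 / (8 * pi * l) * ?e l)"
      by (rule asymp_equiv_trans)
  next
    fix r :: real
    assume r: "r > 0" and "\<forall>\<^sub>F l in at_top. p l = r * l powr (- (1/4))"
    then have p: "\<forall>\<^sub>F l in at_top. p l = r * l powr (- (1/4)) \<and> l > 0"
      by (intro eventually_conj eventually_gt_at_top)
    have "filterlim (\<lambda>l. r * l powr (- (1/4)) * l / ln l) at_top at_top" using r by real_asymp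
    then have "filterlim (\<lambda>l. p l * l / ln l) at_top at_top"
      by (rule filterlim_cong[OF refl refl, THEN iffD1, rotated]) (use p in \<open>auto elim: eventually_mono\<close>)
    note asymp = uniform[OF this]
    have ev: "\<forall>\<^sub>F l in at_top. c_const (p l * l powr (1/4)) / (8 * pi * l) * ?e l = c_const r / (8 * pi * l) * ?e l"
      using p
    proof eventually_elim
      case (elim l)
      then have "p l * l powr (1/4) = r" by (simp flip: powr_add)
      then show ?case by simp
    qed
    show "?f \<sim>[at_top] (\<lambda>l. c_const r / (8 * pi * l) * ?e l)"
      by (rule asymp_equiv_trans[OF asymp asymp_equiv_refl_ev[OF ev]])
  next
    assume *: "filterlim (\<lambda>l. p l * l / ln l) at_top at_top \<and> ((\<lambda>l. p l * l powr (1/4)) \<longlongrightarrow> 0) at_top"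
    then have asymp: "?f \<sim>[at_top] (\<lambda>l. c_const (p l * l powr (1/4)) / (8 * pi * l) * ?e l)"
      by (intro uniform) blast
    have pos: "\<forall>\<^sub>F l in at_top. p l * l powr (1/4) > 0 \<and> l > 0 \<and> p l > 0"
      using p_pos eventually_gt_at_top[of 0] by eventually_elim auto
    \<comment> \<open>Here r tends to 0 from above, so the limit of c is read off from the dual sum:
      2 pi / r tends to infinity and c(2 pi / r) to 1.\<close>
    have "filterlim (\<lambda>l. p l * l powr (1/4)) (at_right 0) at_top"
      unfolding filterlim_at
    proof (intro conjI)
      show "\<forall>\<^sub>F l in at_top. p l * l powr (1/4) \<in> {0<..} \<and> p l * l powr (1/4) \<noteq> 0"
        using pos by eventually_elim simp
      show "((\<lambda>l. p l * l powr (1/4)) \<longlongrightarrow> 0) at_top" using * by blast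
    qed
    then have "filterlim (\<lambda>l. 2 * pi * inverse (p l * l powr (1/4))) at_top at_top"
      by (intro filterlim_tendsto_pos_mult_at_top[OF tendsto_const] filterlim_compose[OF filterlim_inverse_at_top_right]) auto
    then have "((\<lambda>l. c_const (2 * pi * inverse (p l * l powr (1/4)))) \<longlongrightarrow> 1) at_top"
      by (rule filterlim_compose[OF c_const_tendsto_one])
    then have "(\<lambda>l. c_const (2 * pi * inverse (p l * l powr (1/4)))) \<sim>[at_top] (\<lambda>_. 1)"
      by (intro asymp_equivI') simp
    then have "(\<lambda>l. c_const (2 * pi * inverse (p l * l powr (1/4))) / (4 * sqrt (2 * pi) * l powr (5/4) * p l) * ?e l)
       \<sim>[at_top] (\<lambda>l. 1 / (4 * sqrt (2 * pi) * l powr (5/4) * p l) * ?e l)"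
      by (intro asymp_equiv_intros)
    note lim = this
    have ev: "\<forall>\<^sub>F l in at_top. c_const (p l * l powr (1/4)) / (8 * pi * l) * ?e l
        = c_const (2 * pi * inverse (p l * l powr (1/4))) / (4 * sqrt (2 * pi) * l powr (5/4) * p l) * ?e l"
      using pos
    proof eventually_elim
      case (elim l)
      let ?r = "p l * l powr (1/4)" and ?c = "c_const (2 * pi / (p l * l powr (1/4)))"
      have l54: "l powr (5/4) = l powr (1/4) * l"
      proof -
        have "l powr (1/4 + 1) = l powr (1/4) * l powr 1" by (rule powr_add)
        then show ?thesis using elim by simp
      qed
      \<comment> \<open>With 8 pi = 4 q^2, the factor q / r from Poisson summation cancels one q and
        contributes p l^(1/4) to the denominator.\<close>
      define q where "q = sqrt (2 * pi)"
      have q: "8 * pi = 4 * (q * q)" "q \<noteq> 0" by (simp_all add: q_def)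
      have "c_const ?r = q / ?r * ?c" unfolding q_def by (rule c_const_poisson) (use elim in blast)
      moreover have "q / (x * y) * c / (4 * (q * q) * l) = c / (4 * q * (y * l) * x)" for x y c :: real
        using q(2) by simp
      ultimately have "c_const ?r / (8 * pi * l) = ?c / (4 * q * l powr (5/4) * p l)"
        unfolding l54 q(1) by (simp only:)
      then show ?case unfolding q_def by (simp only: divide_inverse)
    qed
    show "?f \<sim>[at_top] (\<lambda>l. 1 / (4 * sqrt (2 * pi) * l powr (5/4) * p l) * ?e l)"
      by (rule asymp_equiv_trans[OF asymp asymp_equiv_trans[OF asymp_equiv_refl_ev[OF ev] lim]])
  next
    fix r :: real
    assume "r > 0"
    then show "c_const r = sqrt (2 * pi) / r * (\<Sum>\<^sub>\<infinity>k\<in>(UNIV::int set). exp (- (2 * pi\<^sup>2 / r\<^sup>2) * (of_int k)\<^sup>2))"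
      using c_const_poisson[of r] by (simp add: c_const_def power_divide power_mult_distrib)
  }
qed

end
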